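(* Let $2<p\le 1+\frac{2^*}{2}$ (with $p<\infty$) and let \[\mathcal B_1=\{w\in H^1_{\Gamma_0}(\Omega): J(w)<d \text{ and } K(w)<0\},\] \[\mathcal B_2=\Big\{w\in H^1_{\Gamma_0}(\Omega): J(w)<\frac{p-2}{2p(S_1+S_2)}\big(\|w\|_2^2+\|w\|_{2,\Gamma_1}^2\big)\Big\}.\] Then $\mathcal B_1$ and $\mathcal B_2$ are invariant under the semi-flow associated with problem (P): for $i=1,2$, if $u_0\in\mathcal B_i$ and $u$ is the maximal weak solution of (P) with initial datum $u_0$, then $u(t)\in\mathcal B_i$ for every $t\in(0,T_{max})$. Consequently, if $u_0\in\mathcal B_1\cup\mathcal B_2$, then $K(u(t))<0$ for every $t\in[0,T_{max})$.
   Context: Setting. $\Omega\subset\mathbb R^n$ ($n\ge1$) is a bounded open set with $C^1$ boundary, $\nu$ is the unit outward normal, $\partial\Omega=\Gamma_0\cup\Gamma_1$ is a partition into measurable sets with $\overline{\Gamma_0}\cap\overline{\Gamma_1}=\emptyset$, $\sigma$ is the $(n-1)$-dimensional surface measure, and $\sigma(\Gamma_0)>0$. $2^*=\frac{2n}{n-2}$ if $n\ge3$, $2^*=\infty$ if $n=1,2$. Problem (P) is \[u_t-\Delta u=|u|^{p-2}u \text{ in }\Omega,\ t>0;\quad u=0 \text{ on }\Gamma_0,\ t>0;\quad \tfrac{\partial u}{\partial\nu}=-u_t \text{ on }\Gamma_1,\ t>0;\quad u(x,0)=u_0(x) \text{ in }\Omega.\] Notation. $\|\cdot\|_q$, $\|\cdot\|_{q,\Gamma_1}$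 are the norms of $L^q(\Omega)$, $L^q(\Gamma_1)$; $(\cdot,\cdot)$, $(\cdot,\cdot)_{\Gamma_1}$ are the inner products of $L^2(\Omega)$, $L^2(\Gamma_1)$. $H^1_{\Gamma_0}(\Omega)=\{w\in H^1(\Omega): w|_{\Gamma_0}=0\}$ (trace sense), with norm $\|w\|_{H^1_{\Gamma_0}}=(\|w\|_2^2+\|\nabla w\|_2^2)^{1/2}$. Standing fact: since $\sigma(\Gamma_0)>0$, a Poincaré-type inequality holds, so $\|\nabla w\|_2$ is an equivalent norm on $H^1_{\Gamma_0}(\Omega)$, and the following constants are finite: \[S_1=\sup_{w\in H^1_{\Gamma_0}(\Omega),\,w\ne0}\frac{\|w\|_{2,\Gamma_1}^2}{\|\nabla w\|_2^2},\qquad S_2=\sup_{w\in H^1_{\Gamma_0}(\Omega),\,w\ne0}\frac{\|w\|_2^2}{\|\nabla w\|_2^2}.\] Functionals on $H^1_{\Gamma_0}(\Omega)$: $J(w)=\frac12\|\nabla w\|_2^2-\frac1p\|w\|_p^p$, $K(w)=\|\nabla w\|_2^2-\|w\|_p^p$. Potential well depth: $d=\inf_{w\in N}J(w)$, where $N=\{w\in H^1_{\Gamma_0}(\Omega): K(w)=0\}\setminus\{0\}$. Weak solution. For $u_0\in H^1_{\Gamma_0}(\Omega)$, $u$ is a weak solution of (P) in $[0,T]\times\Omega$ if: (a) $u\in L^\infty(0,T;H^1_{\Gamma_0}(\Omega))$ and $u_t\in L^2((0,T)\times\Omega)$; (b) the spatial trace of $u$ on $(0,T)\times\partial\Omega$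 has a distributional time derivative, also denoted $u_t$, in $L^2((0,T)\times\partial\Omega)$; (c) for all $\phi\in H^1_{\Gamma_0}(\Omega)$ and a.e. $t\in[0,T]$, $(u_t(t),\phi)+(\nabla u(t),\nabla\phi)+(u_t(t),\phi)_{\Gamma_1}=\int_\Omega|u(t)|^{p-2}u(t)\phi\,dx$; (d) $u(0)=u_0$. Known local theory (may be assumed). For $2\le p\le1+\frac{2^*}{2}$ and every $u_0\in H^1_{\Gamma_0}(\Omega)$ there is a unique maximal weak solution $u$ in $[0,T_{max})\times\Omega$; $u\in C([0,T_{max});H^1_{\Gamma_0}(\Omega))$; $u_t\in L^2((0,T)\times\Gamma_1)\cap L^2((0,T)\times\Omega)$ for every $T\in(0,T_{max})$; for $0\le s\le t<T_{max}$, \[\tfrac12\|\nabla u\|_2^2\Big|_s^t+\int_s^t\big(\|u_t(\tau)\|_2^2+\|u_t(\tau)\|_{2,\Gamma_1}^2\big)d\tau=\int_s^t\int_\Omega|u|^{p-2}uu_t\,dx\,d\tau;\] and either $T_{max}=\infty$, or $T_{max}<\infty$ and $\lim_{t\to T_{max}^-}\|u(t)\|_{H^1_{\Gamma_0}}=+\infty$. Moreover $t\mapsto\|u(t)\|_p^p$ is differentiable a.e. on $(0,T_{max})$ with $\frac{d}{dt}\|u(t)\|_p^p=p\int_\Omega|u|^{p-2}uu_t\,dx$, and $J(u(t))-J(u_0)=-\int_0^t(\|u_t\|_2^2+\|u_t\|_{2,\Gamma_1}^2)d\tau$. *)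

theory Defs
  imports "HOL-Analysis.Analysis"
begin

section \<open>Smoothness and domains\<close>

text \<open>\<open>Ck k f\<close>: \<open>f\<close> is \<open>k\<close> times continuously differentiable on the whole space.
  \<open>G\<close> is the gradient field, whose components must be of class \<open>C\<^sup>k\<close>.\<close>

primrec Ck :: "nat \<Rightarrow> ('a::euclidean_space \<Rightarrow> real) \<Rightarrow> bool" where
  "Ck 0 f \<longleftrightarrow> continuous_on UNIV f"
| "Ck (Suc k) f \<longleftrightarrow>
    (\<exists>G. (\<forall>x. (f has_derivative (\<lambda>h. G x \<bullet> h)) (at x)) \<and> (\<forall>b\<in>Basis. Ck k (\<lambda>x. G x \<bullet> b)))"

definition smooth :: "('a::euclidean_space \<Rightarrow> real) \<Rightarrow> bool" where
  "smooth f \<longleftrightarrow> (\<forall>k. Ck k f)"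

definition test_functions :: "'a::euclidean_space set \<Rightarrow> ('a \<Rightarrow> real) set" where
  "test_functions U =
    {\<phi>. smooth \<phi> \<and> compact (closure {x. \<phi> x \<noteq> 0}) \<and> closure {x. \<phi> x \<noteq> 0} \<subseteq> U}"

text \<open>Near each boundary point the set is the strict epigraph of a \<open>C\<^sup>1\<close> function in some
  direction \<open>e\<close>.  The function \<open>\<gamma>\<close> is only evaluated on the hyperplane orthogonal to \<open>e\<close>.\<close>

definition C1_boundary :: "'a::euclidean_space set \<Rightarrow> bool" where
  "C1_boundary \<Omega> \<longleftrightarrow>
    (\<forall>x0\<in>frontier \<Omega>. \<exists>r>0. \<exists>e \<gamma>. norm e = 1 \<and> Ck 1 \<gamma> \<and>
       \<Omega> \<inter> ball x0 r = {x \<in> ball x0 r. \<gamma> (x - (x \<bullet> e) *\<^sub>R e) < x \<bullet> e})"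

section \<open>Surface measure\<close>

text \<open>The surface measure is the \<open>(n-1)\<close>-dimensional Hausdorff measure, with the normalisation
  that makes it the Riemannian surface measure on \<open>C\<^sup>1\<close> hypersurfaces (counting measure if
  \<open>n = 1\<close>).  The empty set has to be singled out because of \<open>0 ^ 0 = 1\<close>, and boundedness is
  required because \<^const>\<open>diameter\<close> is unspecified on unbounded sets.\<close>

definition hausdorff_outer :: "nat \<Rightarrow> 'a::euclidean_space set \<Rightarrow> ennreal" where
  "hausdorff_outer m A =
    (SUP \<delta>\<in>{0::real<..}.
      INF C\<in>{C :: nat \<Rightarrow> 'a set. A \<subseteq> (\<Union>i. C i) \<and> (\<forall>i. bounded (C i) \<and> diameter (C i) \<le> \<delta>)}.
        \<Sum>i. if C i = {} then 0
            else ennreal (unit_ball_vol (real m) * (diameter (C i) / 2) ^ m))"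

definition hausdorff_measure :: "nat \<Rightarrow> 'a::euclidean_space measure" where
  "hausdorff_measure m = measure_of UNIV (sets borel) (hausdorff_outer m)"

definition surface_on :: "'a::euclidean_space set \<Rightarrow> 'a measure" where
  "surface_on S = restrict_space (hausdorff_measure (DIM('a) - 1)) S"

section \<open>Lebesgue and Sobolev spaces\<close>

text \<open>Elements of function spaces are represented by functions; equality is equality almost
  everywhere.\<close>

definition L2 :: "'b measure \<Rightarrow> ('b \<Rightarrow> real) set" where
  "L2 M = {f \<in> borel_measurable M. integrable M (\<lambda>x. (f x)\<^sup>2)}"

definition Lnorm :: "'b measure \<Rightarrow> real \<Rightarrow> ('b \<Rightarrow> real) \<Rightarrow> real" where
  "Lnorm M q f = (LINT x|M. \<bar>f x\<bar> powr q) powr (1 / q)"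

definition has_weak_grad ::
    "'a::euclidean_space set \<Rightarrow> ('a \<Rightarrow> real) \<Rightarrow> ('a \<Rightarrow> 'a) \<Rightarrow> bool" where
  "has_weak_grad \<Omega> w G \<longleftrightarrow>
    G \<in> borel_measurable (lebesgue_on \<Omega>) \<and> integrable (lebesgue_on \<Omega>) (\<lambda>x. (norm (G x))\<^sup>2) \<and>
    (\<forall>\<phi>\<in>test_functions \<Omega>. \<forall>b\<in>Basis.
      (LINT x|lebesgue_on \<Omega>. w x * frechet_derivative \<phi> (at x) b)
        = - (LINT x|lebesgue_on \<Omega>. (G x \<bullet> b) * \<phi> x))"

definition H1 :: "'a::euclidean_space set \<Rightarrow> ('a \<Rightarrow> real) set" where
  "H1 \<Omega> = {w \<in> L2 (lebesgue_on \<Omega>). \<exists>G. has_weak_grad \<Omega> w G}"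

definition wgrad :: "'a::euclidean_space set \<Rightarrow> ('a \<Rightarrow> real) \<Rightarrow> 'a \<Rightarrow> 'a" where
  "wgrad \<Omega> w = (SOME G. has_weak_grad \<Omega> w G)"

definition grad_norm :: "'a::euclidean_space set \<Rightarrow> ('a \<Rightarrow> real) \<Rightarrow> real" where
  "grad_norm \<Omega> w = Lnorm (lebesgue_on \<Omega>) 2 (\<lambda>x. norm (wgrad \<Omega> w x))"

definition H1_norm :: "'a::euclidean_space set \<Rightarrow> ('a \<Rightarrow> real) \<Rightarrow> real" where
  "H1_norm \<Omega> w = sqrt ((Lnorm (lebesgue_on \<Omega>) 2 w)\<^sup>2 + (grad_norm \<Omega> w)\<^sup>2)"

text \<open>The trace on \<open>\<partial>\<Omega>\<close> is the continuous extension to \<open>H\<^sup>1(\<Omega>)\<close> of the restriction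
  of functions that are smooth up to the boundary.\<close>

definition has_trace ::
    "'a::euclidean_space set \<Rightarrow> ('a \<Rightarrow> real) \<Rightarrow> ('a \<Rightarrow> real) \<Rightarrow> bool" where
  "has_trace \<Omega> w g \<longleftrightarrow>
    w \<in> H1 \<Omega> \<and> g \<in> L2 (surface_on (frontier \<Omega>)) \<and>
    (\<exists>\<phi>. (\<forall>k::nat. smooth (\<phi> k)) \<and>
      (\<lambda>k. H1_norm \<Omega> (\<lambda>x. \<phi> k x - w x)) \<longlonglongrightarrow> 0 \<and>
      (\<lambda>k. Lnorm (surface_on (frontier \<Omega>)) 2 (\<lambda>x. \<phi> k x - g x)) \<longlonglongrightarrow> 0)"

definition trace_of :: "'a::euclidean_space set \<Rightarrow> ('a \<Rightarrow> real) \<Rightarrow> 'a \<Rightarrow> real" where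
  "trace_of \<Omega> w = (SOME g. has_trace \<Omega> w g)"

definition H1_zero_on :: "'a::euclidean_space set \<Rightarrow> 'a set \<Rightarrow> ('a \<Rightarrow> real) set" where
  "H1_zero_on \<Omega> \<Gamma>0 =
    {w \<in> H1 \<Omega>. \<exists>g. has_trace \<Omega> w g \<and> (AE x in surface_on (frontier \<Omega>). x \<in> \<Gamma>0 \<longrightarrow> g x = 0)}"

abbreviation bdry_norm :: "'a::euclidean_space set \<Rightarrow> 'a set \<Rightarrow> ('a \<Rightarrow> real) \<Rightarrow> real" where
  "bdry_norm \<Omega> \<Gamma>1 w \<equiv> Lnorm (surface_on \<Gamma>1) 2 (trace_of \<Omega> w)"

definition nonzero :: "'a::euclidean_space set \<Rightarrow> ('a \<Rightarrow> real) \<Rightarrow> bool" where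
  "nonzero \<Omega> w \<longleftrightarrow> \<not> (AE x in lebesgue_on \<Omega>. w x = 0)"

section \<open>Constants and functionals\<close>

text \<open>\<open>2\<^sup>*\<close> as a function of the dimension.\<close>

definition two_star :: "nat \<Rightarrow> ereal" where
  "two_star n = (if n \<ge> 3 then ereal (2 * real n / (real n - 2)) else \<infinity>)"

text \<open>The standing Poincare-type inequality; it says that \<open>S1\<close> and \<open>S2\<close> below are
  finite (and the gradient norm an equivalent norm).  It is a condition on the domain: it fails,
  for instance, if some component of \<open>\<Omega>\<close> does not touch \<open>\<Gamma>0\<close>.\<close>

definition poincare_inequality :: "'a::euclidean_space set \<Rightarrow> 'a set \<Rightarrow> 'a set \<Rightarrow> bool" where
  "poincare_inequality \<Omega> \<Gamma>0 \<Gamma>1 \<longleftrightarrow>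
    (\<exists>C. \<forall>w\<in>H1_zero_on \<Omega> \<Gamma>0. \<forall>g. has_trace \<Omega> w g \<longrightarrow>
      (Lnorm (lebesgue_on \<Omega>) 2 w)\<^sup>2 \<le> C * (grad_norm \<Omega> w)\<^sup>2 \<and>
      (Lnorm (surface_on \<Gamma>1) 2 g)\<^sup>2 \<le> C * (grad_norm \<Omega> w)\<^sup>2)"

definition S1 :: "'a::euclidean_space set \<Rightarrow> 'a set \<Rightarrow> 'a set \<Rightarrow> real" where
  "S1 \<Omega> \<Gamma>0 \<Gamma>1 =
    (SUP w\<in>{w \<in> H1_zero_on \<Omega> \<Gamma>0. nonzero \<Omega> w}. (bdry_norm \<Omega> \<Gamma>1 w)\<^sup>2 / (grad_norm \<Omega> w)\<^sup>2)"

definition S2 :: "'a::euclidean_space set \<Rightarrow> 'a set \<Rightarrow> real" where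
  "S2 \<Omega> \<Gamma>0 =
    (SUP w\<in>{w \<in> H1_zero_on \<Omega> \<Gamma>0. nonzero \<Omega> w}.
      (Lnorm (lebesgue_on \<Omega>) 2 w)\<^sup>2 / (grad_norm \<Omega> w)\<^sup>2)"

definition J :: "'a::euclidean_space set \<Rightarrow> real \<Rightarrow> ('a \<Rightarrow> real) \<Rightarrow> real" where
  "J \<Omega> p w = 1/2 * (grad_norm \<Omega> w)\<^sup>2 - 1/p * Lnorm (lebesgue_on \<Omega>) p w powr p"

definition K :: "'a::euclidean_space set \<Rightarrow> real \<Rightarrow> ('a \<Rightarrow> real) \<Rightarrow> real" where
  "K \<Omega> p w = (grad_norm \<Omega> w)\<^sup>2 - Lnorm (lebesgue_on \<Omega>) p w powr p"

definition nehari :: "'a::euclidean_space set \<Rightarrow> 'a set \<Rightarrow> real \<Rightarrow> ('a \<Rightarrow> real) set" where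
  "nehari \<Omega> \<Gamma>0 p = {w \<in> H1_zero_on \<Omega> \<Gamma>0. K \<Omega> p w = 0 \<and> nonzero \<Omega> w}"

definition well_depth :: "'a::euclidean_space set \<Rightarrow> 'a set \<Rightarrow> real \<Rightarrow> real" where
  "well_depth \<Omega> \<Gamma>0 p = (INF w\<in>nehari \<Omega> \<Gamma>0 p. J \<Omega> p w)"

definition B1 :: "'a::euclidean_space set \<Rightarrow> 'a set \<Rightarrow> real \<Rightarrow> ('a \<Rightarrow> real) set" where
  "B1 \<Omega> \<Gamma>0 p = {w \<in> H1_zero_on \<Omega> \<Gamma>0. J \<Omega> p w < well_depth \<Omega> \<Gamma>0 p \<and> K \<Omega> p w < 0}"

definition B2 :: "'a::euclidean_space set \<Rightarrow> 'a set \<Rightarrow> 'a set \<Rightarrow> real \<Rightarrow> ('a \<Rightarrow> real) set" where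
  "B2 \<Omega> \<Gamma>0 \<Gamma>1 p =
    {w \<in> H1_zero_on \<Omega> \<Gamma>0.
      J \<Omega> p w < (p - 2) / (2 * p * (S1 \<Omega> \<Gamma>0 \<Gamma>1 + S2 \<Omega> \<Gamma>0))
                  * ((Lnorm (lebesgue_on \<Omega>) 2 w)\<^sup>2 + (bdry_norm \<Omega> \<Gamma>1 w)\<^sup>2)}"

section \<open>Weak solutions\<close>

text \<open>\<open>v\<close> is the distributional time derivative of \<open>h\<close>, both being square integrable on
  \<open>(0,T)\<close> times the space of \<open>M\<close>.  Used with \<open>M\<close> the Lebesgue measure on \<open>\<Omega>\<close> and
  \<open>U = \<Omega>\<close>, and with \<open>M\<close> the surface measure on \<open>\<partial>\<Omega>\<close> and \<open>U\<close> the whole space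
  (restrictions to \<open>(0,T) \<times> \<partial>\<Omega>\<close> of smooth functions serve as test functions there).\<close>

definition has_time_deriv ::
    "real \<Rightarrow> 'a::euclidean_space measure \<Rightarrow> 'a set \<Rightarrow> (real \<Rightarrow> 'a \<Rightarrow> real) \<Rightarrow> (real \<Rightarrow> 'a \<Rightarrow> real) \<Rightarrow> bool"
  where
  "has_time_deriv T M U h v \<longleftrightarrow>
    (let P = lebesgue_on {0<..<T} \<Otimes>\<^sub>M M in
      (\<lambda>(t, x). h t x) \<in> L2 P \<and> (\<lambda>(t, x). v t x) \<in> L2 P \<and>
      (\<forall>\<psi>\<in>test_functions ({0<..<T} \<times> U).
        (LINT z|P. h (fst z) (snd z) * frechet_derivative \<psi> (at z) (1, 0))
          = - (LINT z|P. v (fst z) (snd z) * \<psi> z)))"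

text \<open>\<open>ut\<close> and \<open>zt\<close> are the time derivatives of \<open>u\<close> in \<open>\<Omega>\<close> and of its trace \<open>h\<close>
  on \<open>\<partial>\<Omega>\<close>.  Of the functions that agree with \<open>u\<close> at almost every time, the definition
  selects the one that is continuous in time with values in \<open>L\<^sup>2(\<Omega>)\<close>; it exists because the time
  derivative is square integrable, and it gives the initial condition its meaning.\<close>

definition weak_solution_with ::
    "'a::euclidean_space set \<Rightarrow> 'a set \<Rightarrow> 'a set \<Rightarrow> real \<Rightarrow> real \<Rightarrow> ('a \<Rightarrow> real) \<Rightarrow>
     (real \<Rightarrow> 'a \<Rightarrow> real) \<Rightarrow> (real \<Rightarrow> 'a \<Rightarrow> real) \<Rightarrow> (real \<Rightarrow> 'a \<Rightarrow> real) \<Rightarrow> bool" where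
  "weak_solution_with \<Omega> \<Gamma>0 \<Gamma>1 p T u0 u ut zt \<longleftrightarrow>
    \<comment> \<open>essentially bounded with values in \<open>H\<^sup>1\<close>, vanishing on \<open>\<Gamma>0\<close>\<close>
    (\<lambda>(t, x). u t x) \<in> borel_measurable (lebesgue_on {0<..<T} \<Otimes>\<^sub>M lebesgue_on \<Omega>) \<and>
    (\<exists>C. AE t in lebesgue_on {0<..<T}. u t \<in> H1_zero_on \<Omega> \<Gamma>0 \<and> H1_norm \<Omega> (u t) \<le> C) \<and>
    \<comment> \<open>choice of the representative in time\<close>
    (\<forall>t\<in>{0..T}. u t \<in> L2 (lebesgue_on \<Omega>) \<and>
      ((\<lambda>s. Lnorm (lebesgue_on \<Omega>) 2 (\<lambda>x. u s x - u t x)) \<longlongrightarrow> 0) (at t within {0..T})) \<and>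
    \<comment> \<open>time derivatives\<close>
    has_time_deriv T (lebesgue_on \<Omega>) \<Omega> u ut \<and>
    (\<exists>h. (AE t in lebesgue_on {0<..<T}. has_trace \<Omega> (u t) (h t)) \<and>
      has_time_deriv T (surface_on (frontier \<Omega>)) UNIV h zt) \<and>
    \<comment> \<open>weak formulation\<close>
    (\<forall>\<phi>\<in>H1_zero_on \<Omega> \<Gamma>0. AE t in lebesgue_on {0..T}.
      (LINT x|lebesgue_on \<Omega>. ut t x * \<phi> x)
      + (LINT x|lebesgue_on \<Omega>. wgrad \<Omega> (u t) x \<bullet> wgrad \<Omega> \<phi> x)
      + (LINT x|surface_on \<Gamma>1. zt t x * trace_of \<Omega> \<phi> x)
      = (LINT x|lebesgue_on \<Omega>. \<bar>u t x\<bar> powr (p - 2) * u t x * \<phi> x)) \<and>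
    \<comment> \<open>initial condition\<close>
    (AE x in lebesgue_on \<Omega>. u 0 x = u0 x)"

definition weak_solution ::
    "'a::euclidean_space set \<Rightarrow> 'a set \<Rightarrow> 'a set \<Rightarrow> real \<Rightarrow> real \<Rightarrow> ('a \<Rightarrow> real) \<Rightarrow>
     (real \<Rightarrow> 'a \<Rightarrow> real) \<Rightarrow> bool" where
  "weak_solution \<Omega> \<Gamma>0 \<Gamma>1 p T u0 u \<longleftrightarrow> (\<exists>ut zt. weak_solution_with \<Omega> \<Gamma>0 \<Gamma>1 p T u0 u ut zt)"

definition weak_solution_upto ::
    "'a::euclidean_space set \<Rightarrow> 'a set \<Rightarrow> 'a set \<Rightarrow> real \<Rightarrow> ereal \<Rightarrow> ('a \<Rightarrow> real) \<Rightarrow>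
     (real \<Rightarrow> 'a \<Rightarrow> real) \<Rightarrow> bool" where
  "weak_solution_upto \<Omega> \<Gamma>0 \<Gamma>1 p Tmax u0 u \<longleftrightarrow>
    (\<forall>T. 0 < T \<and> ereal T < Tmax \<longrightarrow> weak_solution \<Omega> \<Gamma>0 \<Gamma>1 p T u0 u)"

definition maximal_weak_solution ::
    "'a::euclidean_space set \<Rightarrow> 'a set \<Rightarrow> 'a set \<Rightarrow> real \<Rightarrow> ereal \<Rightarrow> ('a \<Rightarrow> real) \<Rightarrow>
     (real \<Rightarrow> 'a \<Rightarrow> real) \<Rightarrow> bool" where
  "maximal_weak_solution \<Omega> \<Gamma>0 \<Gamma>1 p Tmax u0 u \<longleftrightarrow>
    0 < Tmax \<and> weak_solution_upto \<Omega> \<Gamma>0 \<Gamma>1 p Tmax u0 u \<and>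
    \<not> (\<exists>T' v. Tmax < T' \<and> weak_solution_upto \<Omega> \<Gamma>0 \<Gamma>1 p T' u0 v \<and>
         (\<forall>t. 0 \<le> t \<and> ereal t < Tmax \<longrightarrow> (AE x in lebesgue_on \<Omega>. v t x = u t x)))"

text \<open>The known regularity theory of maximal solutions: time continuity with values in \<open>H\<^sup>1\<close>,
  finiteness of the \<open>L\<^sup>p\<close> norms, the energy identity, almost everywhere
  differentiability of the \<open>p\<close>-th power of the \<open>L\<^sup>p\<close> norm, and the identity for \<open>J\<close>.\<close>

definition local_theory :: "'a::euclidean_space set \<Rightarrow> 'a set \<Rightarrow> 'a set \<Rightarrow> real \<Rightarrow> bool" where
  "local_theory \<Omega> \<Gamma>0 \<Gamma>1 p \<longleftrightarrow>
    (\<forall>u0\<in>H1_zero_on \<Omega> \<Gamma>0. \<forall>Tmax u. maximal_weak_solution \<Omega> \<Gamma>0 \<Gamma>1 p Tmax u0 u \<longrightarrow>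
      (let I = {t. 0 \<le> t \<and> ereal t < Tmax} in
        (\<forall>t\<in>I. u t \<in> H1_zero_on \<Omega> \<Gamma>0 \<and>
          integrable (lebesgue_on \<Omega>) (\<lambda>x. \<bar>u t x\<bar> powr p) \<and>
          ((\<lambda>s. H1_norm \<Omega> (\<lambda>x. u s x - u t x)) \<longlongrightarrow> 0) (at t within I)) \<and>
        (\<exists>ut zt.
          (\<forall>T. 0 < T \<and> ereal T < Tmax \<longrightarrow> weak_solution_with \<Omega> \<Gamma>0 \<Gamma>1 p T u0 u ut zt) \<and>
          (\<forall>s\<in>I. \<forall>t\<in>I. s \<le> t \<longrightarrow>
            1/2 * (grad_norm \<Omega> (u t))\<^sup>2 - 1/2 * (grad_norm \<Omega> (u s))\<^sup>2
            + (LINT \<tau>|lebesgue_on {s..t}. (Lnorm (lebesgue_on \<Omega>) 2 (ut \<tau>))\<^sup>2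
                                         + (Lnorm (surface_on \<Gamma>1) 2 (zt \<tau>))\<^sup>2)
            = (LINT \<tau>|lebesgue_on {s..t}. LINT x|lebesgue_on \<Omega>.
                 \<bar>u \<tau> x\<bar> powr (p - 2) * u \<tau> x * ut \<tau> x)) \<and>
          (AE t in lebesgue_on {t. 0 < t \<and> ereal t < Tmax}.
            ((\<lambda>s. Lnorm (lebesgue_on \<Omega>) p (u s) powr p) has_real_derivative
              p * (LINT x|lebesgue_on \<Omega>. \<bar>u t x\<bar> powr (p - 2) * u t x * ut t x)) (at t)) \<and>
          (\<forall>t\<in>I. J \<Omega> p (u t) - J \<Omega> p u0
            = - (LINT \<tau>|lebesgue_on {0..t}. (Lnorm (lebesgue_on \<Omega>) 2 (ut \<tau>))\<^sup>2
                                            + (Lnorm (surface_on \<Gamma>1) 2 (zt \<tau>))\<^sup>2)))))"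

end

theory Submission
  imports Defs "HOL-Computational_Algebra.Polynomial"
begin

text \<open>
  Write \<open>y = \<parallel>u\<parallel>\<^sup>2 + \<parallel>u\<parallel>\<^sup>2\<close>, the second norm being that of the trace on \<open>\<Gamma>1\<close>.  Formally the weak
  formulation with test function \<open>u(t)\<close> gives \<open>y' = - 2 K(u)\<close>.  On \<open>B2\<close> the definition of \<open>S1\<close>
  and \<open>S2\<close> forces \<open>K < 0\<close>; hence \<open>y\<close> grows while \<open>J(u)\<close> decreases, and \<open>u\<close> cannot leave \<open>B2\<close>.
  On \<open>B1\<close>, at a first time with \<open>K(u) = 0\<close> either \<open>u\<close> lies on the Nehari manifold, which
  \<open>J(u) < d\<close> excludes, or \<open>u = 0\<close>.  In the second case \<open>0 = J(u) < d\<close>, whereas the gradient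
  norm is bounded below by a multiple of \<open>d\<close> wherever \<open>K < 0\<close>, so it cannot have tended to \<open>0\<close>.

  Only the inequality \<open>y(t) \<ge> y(s)\<close> for \<open>t\<close> slightly larger than \<open>s\<close> is needed, and it follows from
  testing with the fixed function \<open>u(s)\<close>, because \<open>y(t) + y(s)\<close> is at least twice the pairing of
  \<open>u(t)\<close> with \<open>u(s)\<close>.  This avoids the differentiability of \<open>y\<close> and the exceptional
  sets of times that depend on the test function.
\<close>

section \<open>Smooth functions\<close>

text \<open>Two obstacles shape the preparations. Time derivatives are known only through smooth
  test functions on space-time, whereas the argument pairs them with \<open>u s\<close>, which is
  merely in H1; the fundamental lemma of the calculus of variations removes the spatial test
  function, and smooth cutoffs built from exp (-1/x) feed that lemma. The boundary carries a
  Hausdorff measure whose finiteness has to be derived: the C1 boundary is covered by finitely many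
  Lipschitz graphs, and the positive mass of \<open>\<Gamma>0\<close> excludes the degenerate zero
  measure. On the flow the delicate term is the source. Its pairing with \<open>u s\<close> is
  bounded below by Fatou's lemma, from L2 convergence and convergence of the L^p mass; the latter is
  continuous in time because \<open>J\<close> and the gradient norm are. Continuity of the boundary
  terms comes from the Poincare inequality, which bounds every trace on \<open>\<Gamma>1\<close>,
  hence also differences of traces, by the gradient norm.\<close>

lemma Ck_continuous: "Ck k f \<Longrightarrow> continuous_on UNIV f"
  by (cases k) (auto intro!: continuous_at_imp_continuous_on dest: has_derivative_continuous)

lemma Ck_SucI:
  assumes "\<And>x. (f has_derivative (\<lambda>h. G x \<bullet> h)) (at x)" "\<And>b. b \<in> Basis \<Longrightarrow> Ck k (\<lambda>x. G x \<bullet> b)"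
  shows "Ck (Suc k) f"
  using assms by auto

text \<open>The product and chain rules leave undifferentiated factors in the gradient; their class
  is lowered with this before the induction hypothesis applies.\<close>

lemma Ck_Suc_imp_Ck: "Ck (Suc k) f \<Longrightarrow> Ck k f"
proof (induction k arbitrary: f)
  case 0
  then show ?case using Ck_continuous[of "Suc 0" f] by simp
next
  case (Suc k)
  then obtain G where "\<forall>x. (f has_derivative (\<lambda>h. G x \<bullet> h)) (at x)" "\<forall>b\<in>Basis. Ck (Suc k) (\<lambda>x. G x \<bullet> b)"
    by (auto simp del: Ck.simps simp: Ck.simps(2)[of "Suc k"])
  then show ?case using Suc.IH by (auto simp del: Ck.simps simp: Ck.simps(2)[of k])
qed

lemma Ck_const: "Ck k (\<lambda>x. c)"
proof (induction k arbitrary: c)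
  case (Suc k)
  have "((\<lambda>x. c) has_derivative (\<lambda>h. 0 \<bullet> h)) (at x)" for x :: 'a
    by simp
  then show ?case using Suc by (fastforce intro!: exI[of _ "\<lambda>x. 0"])
qed simp

lemma Ck_add:
  assumes "Ck k f" "Ck k g"
  shows "Ck k (\<lambda>x. f x + g x)"
  using assms
proof (induction k arbitrary: f g)
  case (Suc k)
  from Suc.prems obtain F G where
    F: "\<And>x. (f has_derivative (\<lambda>h. F x \<bullet> h)) (at x)" "\<forall>b\<in>Basis. Ck k (\<lambda>x. F x \<bullet> b)" and
    G: "\<And>x. (g has_derivative (\<lambda>h. G x \<bullet> h)) (at x)" "\<forall>b\<in>Basis. Ck k (\<lambda>x. G x \<bullet> b)" by auto
  have "((\<lambda>x. f x + g x) has_derivative (\<lambda>h. (F x + G x) \<bullet> h)) (at x)" for x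
    using has_derivative_add[OF F(1) G(1)] by (simp add: inner_add_left)
  moreover have "Ck k (\<lambda>x. (F x + G x) \<bullet> b)" if "b \<in> Basis" for b
    using Suc.IH[of "\<lambda>x. F x \<bullet> b" "\<lambda>x. G x \<bullet> b"] F(2) G(2) that by (simp add: inner_add_left)
  ultimately show ?case by (rule Ck_SucI)
qed (auto intro: continuous_intros)

lemma Ck_mult:
  assumes "Ck k f" "Ck k g"
  shows "Ck k (\<lambda>x. f x * g x)"
  using assms
proof (induction k arbitrary: f g)
  case (Suc k)
  from Suc.prems obtain F G where
    F: "\<And>x. (f has_derivative (\<lambda>h. F x \<bullet> h)) (at x)" "\<forall>b\<in>Basis. Ck k (\<lambda>x. F x \<bullet> b)" and
    G: "\<And>x. (g has_derivative (\<lambda>h. G x \<bullet> h)) (at x)" "\<forall>b\<in>Basis. Ck k (\<lambda>x. G x \<bullet> b)" by auto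
  have "((\<lambda>x. f x * g x) has_derivative (\<lambda>h. (f x *\<^sub>R G x + g x *\<^sub>R F x) \<bullet> h)) (at x)" for x
    using has_derivative_mult[OF F(1) G(1), of x] by (simp add: inner_add_left mult.commute)
  moreover have "Ck k (\<lambda>x. (f x *\<^sub>R G x + g x *\<^sub>R F x) \<bullet> b)" if "b \<in> Basis" for b
    using Suc.IH[OF Ck_Suc_imp_Ck[OF Suc.prems(1)], of "\<lambda>x. G x \<bullet> b"]
      Suc.IH[OF Ck_Suc_imp_Ck[OF Suc.prems(2)], of "\<lambda>x. F x \<bullet> b"] F(2) G(2) that
    by (simp add: inner_add_left Ck_add)
  ultimately show ?case by (rule Ck_SucI)
qed (auto intro: continuous_intros)

lemma Ck_compose:
  fixes f :: "real \<Rightarrow> real"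
  assumes "Ck k f" "Ck k g"
  shows "Ck k (\<lambda>x. f (g x))"
  using assms
proof (induction k arbitrary: f g)
  case (Suc k)
  from Suc.prems obtain F G where
    F: "\<And>x. (f has_derivative (\<lambda>h. F x \<bullet> h)) (at x)" "\<forall>b\<in>Basis. Ck k (\<lambda>x. F x \<bullet> b)" and
    G: "\<And>x. (g has_derivative (\<lambda>h. G x \<bullet> h)) (at x)" "\<forall>b\<in>Basis. Ck k (\<lambda>x. G x \<bullet> b)" by auto
  have "((\<lambda>x. f (g x)) has_derivative (\<lambda>h. (F (g x) *\<^sub>R G x) \<bullet> h)) (at x)" for x
    using has_derivative_compose[OF G(1) F(1), of x] by simp
  moreover have "Ck k (\<lambda>x. (F (g x) *\<^sub>R G x) \<bullet> b)" if "b \<in> Basis" for b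
    using Suc.IH[of F, OF _ Ck_Suc_imp_Ck[OF Suc.prems(2)]] F(2) G(2) that
    by (auto intro!: Ck_mult)
  ultimately show ?case by (rule Ck_SucI)
next
  case 0
  then show ?case using continuous_on_compose2[of UNIV f UNIV g] by auto
qed

lemma Ck_inner: "Ck k (\<lambda>x. x \<bullet> a)"
proof (cases k)
  case (Suc j)
  have "((\<lambda>x. x \<bullet> a) has_derivative (\<lambda>h. a \<bullet> h)) (at x)" for x :: 'a
    by (auto intro!: derivative_eq_intros simp: inner_commute)
  then show ?thesis unfolding Suc by (auto intro!: exI[of _ "\<lambda>x. a"] Ck_const)
qed (auto intro!: continuous_intros)

text \<open>Spatial test functions become factors of space-time test functions this way; the
  gradient gets a zero time component.\<close>

lemma Ck_snd:
  fixes f :: "'a::euclidean_space \<Rightarrow> real"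
  assumes "Ck k f"
  shows "Ck k (\<lambda>z :: real \<times> 'a. f (snd z))"
  using assms
proof (induction k arbitrary: f)
  case (Suc k)
  from Suc.prems obtain F where
    F: "\<And>x. (f has_derivative (\<lambda>h. F x \<bullet> h)) (at x)" "\<forall>b\<in>Basis. Ck k (\<lambda>x. F x \<bullet> b)" by auto
  have "((\<lambda>z. f (snd z)) has_derivative (\<lambda>h. (0, F (snd z)) \<bullet> h)) (at z)" for z :: "real \<times> 'a"
    using has_derivative_compose[OF bounded_linear_imp_has_derivative[OF bounded_linear_snd] F(1), of z]
    by (simp add: inner_prod_def)
  moreover have "Ck k (\<lambda>z :: real \<times> 'a. (0, F (snd z)) \<bullet> b)" if "b \<in> Basis" for b :: "real \<times> 'a"
    using that Suc.IH[of "\<lambda>x. F x \<bullet> snd b"] F(2)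
    by (auto simp: Basis_prod_def inner_prod_def Ck_const)
  ultimately show ?case by (rule Ck_SucI)
next
  case 0
  then show ?case using continuous_on_compose2[of UNIV f UNIV snd] continuous_on_snd[OF continuous_on_id] by auto
qed

lemma smooth_const: "smooth (\<lambda>x. c)"
  and smooth_add: "smooth f \<Longrightarrow> smooth g \<Longrightarrow> smooth (\<lambda>x. f x + g x)"
  and smooth_mult: "smooth f \<Longrightarrow> smooth g \<Longrightarrow> smooth (\<lambda>x. f x * g x)"
  and smooth_inner: "smooth (\<lambda>x. x \<bullet> a)"
  by (auto simp: smooth_def Ck_const Ck_add Ck_mult Ck_inner)

lemma smooth_compose:
  fixes f :: "real \<Rightarrow> real"
  shows "smooth f \<Longrightarrow> smooth g \<Longrightarrow> smooth (\<lambda>x. f (g x))"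
  by (auto simp: smooth_def Ck_compose)

lemma smooth_snd:
  fixes f :: "'a::euclidean_space \<Rightarrow> real"
  shows "smooth f \<Longrightarrow> smooth (\<lambda>z :: real \<times> 'a. f (snd z))"
  by (auto simp: smooth_def Ck_snd)

lemma smooth_real_id: "smooth (\<lambda>x::real. x)"
  using smooth_inner[of "1::real"] by simp

lemma smooth_fst: "smooth (fst :: real \<times> 'a::euclidean_space \<Rightarrow> real)"
  using smooth_inner[of "(1::real, 0::'a)"] by (simp add: inner_prod_def)

lemma smooth_sum: "finite I \<Longrightarrow> (\<And>i. i \<in> I \<Longrightarrow> smooth (f i)) \<Longrightarrow> smooth (\<lambda>x. \<Sum>i\<in>I. f i x)"
  by (induction I rule: finite_induct) (auto intro: smooth_const smooth_add)

lemma smooth_diff: "smooth f \<Longrightarrow> smooth g \<Longrightarrow> smooth (\<lambda>x. f x - g x)"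
  using smooth_add[of f "\<lambda>x. (-1) * g x"] smooth_mult[OF smooth_const, of g "-1"] by simp

lemma smooth_continuous: "smooth f \<Longrightarrow> continuous_on S f"
  using Ck_continuous[of 0 f] continuous_on_subset[of UNIV f S] by (simp add: smooth_def)

lemma smooth_has_gradient:
  assumes "smooth f"
  obtains G where "\<And>x. (f has_derivative (\<lambda>h. G x \<bullet> h)) (at x)" "continuous_on UNIV G"
proof -
  have "Ck (Suc 0) f" using assms by (simp add: smooth_def)
  then obtain G where G: "\<And>x. (f has_derivative (\<lambda>h. G x \<bullet> h)) (at x)"
    "\<forall>b\<in>Basis. continuous_on UNIV (\<lambda>x. G x \<bullet> b)" by auto
  have "continuous_on UNIV (\<lambda>x. \<Sum>b\<in>Basis. (G x \<bullet> b) *\<^sub>R b)"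
    by (intro continuous_on_sum continuous_on_scaleR continuous_on_const) (use G(2) in auto)
  then have "continuous_on UNIV G" by (simp add: euclidean_representation)
  with G(1) show ?thesis by (rule that)
qed

lemma smooth_real_derivI:
  fixes f f' :: "real \<Rightarrow> real"
  assumes "\<And>x. (f has_real_derivative f' x) (at x)" "smooth f'"
  shows "smooth f"
  unfolding smooth_def
proof
  fix k
  show "Ck k f"
  proof (cases k)
    case 0
    then show ?thesis using assms(1)
      by (auto intro!: continuous_at_imp_continuous_on DERIV_isCont)
  next
    case (Suc j)
    have "\<forall>x. (f has_derivative (\<lambda>h. f' x \<bullet> h)) (at x)"
      using assms(1) by (simp add: has_field_derivative_def)
    then show ?thesis using assms(2) unfolding Suc
      by (auto simp: smooth_def intro!: exI[of _ f'])
  qed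
qed

subsection \<open>Cutoff functions\<close>

text \<open>The classical flat function exp (-1/x) times a polynomial in 1/x. Letting the polynomial
  vary makes the family closed under differentiation, so that smoothness is a single induction on
  the order.\<close>

definition exp_poly :: "real poly \<Rightarrow> real \<Rightarrow> real" where
  "exp_poly q x = (if x > 0 then exp (- 1 / x) * poly q (1 / x) else 0)"

text \<open>In the variable y = 1/x the exponential decay beats every power as y tends to
  infinity.\<close>

lemma exp_poly_tendsto_0: "(exp_poly q \<longlongrightarrow> 0) (at_right 0)"
proof -
  have "((\<lambda>y::real. \<Sum>i\<le>degree q. coeff q i * (y ^ i / exp y)) \<longlongrightarrow> (\<Sum>i\<le>degree q. coeff q i * 0)) at_top"
    by (intro tendsto_intros tendsto_power_div_exp_0)
  then have "((\<lambda>y::real. exp (- y) * poly q y) \<longlongrightarrow> 0) at_top"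
    by (simp add: poly_altdef exp_minus sum_distrib_left field_simps)
  from filterlim_compose[OF this filterlim_inverse_at_top_right]
  show ?thesis
    by (rule Lim_transform_eventually)
      (auto simp: exp_poly_def eventually_at_right_less inverse_eq_divide intro!: eventually_at_rightI[of 0 1])
qed

text \<open>For x > 0 a factor 1/x^2 appears both from exp (-1/x) and from the inner derivative of
  \<open>poly q (1 / x)\<close>; the two \<open>pCons 0\<close> multiply by the square of the
  variable.\<close>

lemma DERIV_exp_poly:
  "(exp_poly q has_real_derivative exp_poly (pCons 0 (pCons 0 (q - pderiv q))) x) (at x)"
proof -
  consider "x > 0" | "x < 0" | "x = 0" by linarith
  then show ?thesis
  proof cases
    case 1
    have *: "((\<lambda>x. exp (- 1 / x) * poly q (1 / x)) has_real_derivative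
      exp_poly (pCons 0 (pCons 0 (q - pderiv q))) x) (at x)"
      using 1 by (auto intro!: derivative_eq_intros simp: exp_poly_def field_simps power2_eq_square)
    show ?thesis
      by (rule DERIV_cong_ev[THEN iffD1, OF refl _ refl *])
        (use 1 in \<open>auto simp: exp_poly_def eventually_nhds intro!: exI[of _ "{0<..}"]\<close>)
  next
    case 2
    have *: "((\<lambda>x. 0) has_real_derivative exp_poly (pCons 0 (pCons 0 (q - pderiv q))) x) (at x)"
      using 2 by (simp add: exp_poly_def)
    show ?thesis
      by (rule DERIV_cong_ev[THEN iffD1, OF refl _ refl *])
        (use 2 in \<open>auto simp: exp_poly_def eventually_nhds intro!: exI[of _ "{..<0}"]\<close>)
  next
    case 3
    have "((\<lambda>h. (exp_poly q h - exp_poly q 0) / h) \<longlongrightarrow> 0) (at 0)"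
    proof (rule filterlim_split_at_real)
      show "((\<lambda>h. (exp_poly q h - exp_poly q 0) / h) \<longlongrightarrow> 0) (at_left 0)"
        by (rule Lim_transform_eventually[OF tendsto_const])
          (auto simp: exp_poly_def intro!: eventually_at_leftI[of "-1"])
      \<comment> \<open>Dividing by h multiplies the polynomial by its variable, so the right
        difference quotient is \<open>exp_poly (pCons 0 q)\<close>.\<close>
      show "((\<lambda>h. (exp_poly q h - exp_poly q 0) / h) \<longlongrightarrow> 0) (at_right 0)"
        by (rule Lim_transform_eventually[OF exp_poly_tendsto_0[of "pCons 0 q"]])
          (auto simp: exp_poly_def intro!: eventually_at_rightI[of 0 1])
    qed
    then show ?thesis using 3 by (simp add: DERIV_def exp_poly_def)
  qed
qed

lemma smooth_exp_poly: "smooth (exp_poly q)"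
  unfolding smooth_def
proof
  fix k
  show "Ck k (exp_poly q)"
  proof (induction k arbitrary: q)
    case 0
    then show ?case
      by (auto intro!: continuous_at_imp_continuous_on DERIV_isCont[OF DERIV_exp_poly])
  next
    case (Suc k)
    have "\<forall>x. (exp_poly q has_derivative (\<lambda>h. exp_poly (pCons 0 (pCons 0 (q - pderiv q))) x \<bullet> h)) (at x)"
      using DERIV_exp_poly by (simp add: has_field_derivative_def)
    with Suc show ?case by auto
  qed
qed

lemma exp_poly_1_pos_iff: "exp_poly 1 x > 0 \<longleftrightarrow> x > 0"
  and exp_poly_1_nonneg: "exp_poly 1 x \<ge> 0"
  by (auto simp: exp_poly_def)

text \<open>A bump that is positive exactly on (0,1) is integrated and divided by its total mass.
  \<open>H\<close> serves for spatial cutoffs and for test functions in time; the strict positivity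
  of \<open>\<rho>\<close> later detects a decrease in the weak monotonicity argument.\<close>

lemma smooth_step_exists:
  obtains H \<rho> :: "real \<Rightarrow> real" where "smooth H" "smooth \<rho>"
    "\<And>x. (H has_real_derivative \<rho> x) (at x)" "\<And>x. \<rho> x \<ge> 0"
    "\<And>x. \<rho> x > 0 \<longleftrightarrow> 0 < x \<and> x < 1"
    "\<And>x. x \<le> 0 \<Longrightarrow> H x = 0" "\<And>x. x \<ge> 1 \<Longrightarrow> H x = 1" "mono H"
proof -
  define r where "r x = exp_poly 1 x * exp_poly 1 (1 - x)" for x :: real
  have r_smooth: "smooth r" unfolding r_def
    by (rule smooth_mult[OF smooth_exp_poly smooth_compose[OF smooth_exp_poly
          smooth_diff[OF smooth_const smooth_real_id]]])
  have r_nonneg: "r x \<ge> 0" for x by (simp add: r_def exp_poly_1_nonneg)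
  have r_pos: "r x > 0 \<longleftrightarrow> 0 < x \<and> x < 1" for x
    using exp_poly_1_pos_iff[of x] exp_poly_1_pos_iff[of "1 - x"] exp_poly_1_nonneg[of x]
      exp_poly_1_nonneg[of "1 - x"]
    unfolding r_def zero_less_mult_iff by linarith
  have r_zero: "r x = 0" if "\<not> (0 < x \<and> x < 1)" for x
    using r_nonneg[of x] r_pos[of x] that by linarith
  have r_cont: "continuous_on S r" for S using r_smooth by (rule smooth_continuous)
  \<comment> \<open>Starting at -1 instead of 0 leaves room to the left of 0 for the fundamental
    theorem; \<open>r\<close> vanishes there, so the values are unchanged.\<close>
  define h where "h x = integral {-1..x} r" for x
  have h_nonpos: "h x = 0" if "x \<le> 0" for x
  proof -
    have "integral {-1..x} r = integral {-1..x} (\<lambda>x. 0)"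
      by (rule integral_cong) (use that r_zero in auto)
    then show ?thesis by (simp add: h_def)
  qed
  have h_deriv: "(h has_real_derivative r x) (at x)" for x
  proof (cases "x > - 1")
    case True
    have "(h has_real_derivative r x) (at x within {-1..x+1})"
      unfolding h_def by (rule integral_has_real_derivative[OF r_cont]) (use True in auto)
    then show ?thesis using True by (simp add: at_within_Icc_at)
  next
    case False
    have *: "((\<lambda>x. 0) has_real_derivative r x) (at x)" using False r_zero[of x] by auto
    show ?thesis
      by (rule DERIV_cong_ev[THEN iffD1, OF refl _ refl *])
        (use False h_nonpos in \<open>auto intro!: eventually_mono[OF eventually_nhds_in_open[of "{..<0}"]]\<close>)
  qed
  have h_mono: "h x \<le> h y" if "x \<le> y" for x y
    by (rule DERIV_nonneg_imp_nondecreasing[OF that]) (use h_deriv r_nonneg in blast)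
  have h_ge1: "h x = h 1" if "x \<ge> 1" for x
  proof (cases "x = 1")
    case False
    have "h x = h 1"
    proof (rule DERIV_isconst_end[where f = h])
      show "1 < x" using that False by simp
      show "continuous_on {1..x} h"
        by (intro continuous_at_imp_continuous_on ballI DERIV_isCont[OF h_deriv])
      show "(h has_real_derivative 0) (at y)" if "1 < y" "y < x" for y
        using h_deriv[of y] r_zero[of y] that by simp
    qed
    then show ?thesis .
  qed simp
  have "h 0 < h 1"
  proof (rule DERIV_pos_imp_increasing_open[where f = h])
    show "continuous_on {0..1} h"
      by (intro continuous_at_imp_continuous_on ballI DERIV_isCont[OF h_deriv])
    show "\<exists>y. (h has_real_derivative y) (at x) \<and> 0 < y" if "0 < x" "x < 1" for x
      using h_deriv[of x] r_pos[of x] that by blast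
  qed simp
  then have h1: "h 1 > 0" using h_nonpos[of 0] by simp
  show ?thesis
  proof (rule that[of "\<lambda>x. (1 / h 1) * h x" "\<lambda>x. (1 / h 1) * r x"])
    show "smooth (\<lambda>x. (1 / h 1) * r x)" by (intro smooth_mult smooth_const r_smooth)
    show "((\<lambda>x. (1 / h 1) * h x) has_real_derivative (1 / h 1) * r x) (at x)" for x
      by (intro DERIV_cmult h_deriv)
    show "smooth (\<lambda>x. (1 / h 1) * h x)"
      by (intro smooth_mult smooth_const smooth_real_derivI[OF h_deriv] r_smooth)
    show "1 / h 1 * r x \<ge> 0" for x using h1 r_nonneg[of x] by simp
    show "1 / h 1 * r x > 0 \<longleftrightarrow> 0 < x \<and> x < 1" for x
      using h1 r_pos[of x] by (simp add: zero_less_divide_iff)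
    show "1 / h 1 * h x = 0" if "x \<le> 0" for x using h_nonpos[OF that] by simp
    show "1 / h 1 * h x = 1" if "x \<ge> 1" for x using h_ge1[OF that] h1 by simp
    show "mono (\<lambda>x. 1 / h 1 * h x)" using h1 h_mono by (simp add: mono_def divide_right_mono)
  qed
qed

text \<open>\<open>V\<close> is a countable union of balls whose closed balls stay in
  \<open>V\<close>. A partial sum of bumps is supported in finitely many of these, hence compactly;
  the growing factor \<open>m\<close> in front pushes it past 1 at each point of \<open>V\<close>,
  where \<open>H\<close> is constant.\<close>

lemma cutoff_sequence:
  fixes V :: "'a::euclidean_space set"
  assumes "open V"
  obtains \<xi> :: "nat \<Rightarrow> 'a \<Rightarrow> real" where "\<And>m. \<xi> m \<in> test_functions V"
    "\<And>m x. 0 \<le> \<xi> m x \<and> \<xi> m x \<le> 1" "\<And>x. (\<lambda>m. \<xi> m x) \<longlonglongrightarrow> indicator V x"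
proof -
  obtain H \<rho> :: "real \<Rightarrow> real" where H: "smooth H" "\<And>x. x \<le> 0 \<Longrightarrow> H x = 0" "\<And>x. x \<ge> 1 \<Longrightarrow> H x = 1" "mono H"
    using smooth_step_exists by metis
  define F where "F = {ball a r | a r. cball a r \<subseteq> V}"
  have "\<Union>F = V"
  proof
    show "V \<subseteq> \<Union>F"
    proof
      fix x assume "x \<in> V"
      then obtain e where "e > 0" "cball x e \<subseteq> V" using assms open_contains_cball by blast
      then show "x \<in> \<Union>F" unfolding F_def by (force intro!: exI[of _ "ball x e"])
    qed
    show "\<Union>F \<subseteq> V" unfolding F_def using ball_subset_cball by fast
  qed
  obtain F' where F': "F' \<subseteq> F" "countable F'" "\<Union>F' = \<Union>F"
    using Lindelof[of F] by (auto simp: F_def)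
  \<comment> \<open>The empty set keeps the family nonempty, as the enumeration by
    \<open>from_nat_into\<close> demands; it is the ball of radius -1.\<close>
  define D where "D = insert {} F'"
  have "cball (0::'a) (-1) \<subseteq> V" "ball (0::'a) (-1) = {}" by auto
  then have DF: "D \<subseteq> F" using F' unfolding D_def F_def by (smt (verit) insert_subset mem_Collect_eq)
  have D: "countable D" "D \<noteq> {}" "\<Union>D = V" using F' \<open>\<Union>F = V\<close> by (auto simp: D_def)
  have "\<forall>i. \<exists>a r. from_nat_into D i = ball a r \<and> cball a r \<subseteq> V"
    using from_nat_into[OF D(2)] DF unfolding F_def by blast
  then obtain a r where ar: "\<And>i. from_nat_into D i = ball (a i) (r i)" "\<And>i. cball (a i) (r i) \<subseteq> V"
    by metis
  have cover: "(\<Union>i. ball (a i) (r i)) = V"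
    using range_from_nat_into[OF D(2,1)] D(3) by (simp flip: ar(1))
  \<comment> \<open>Nonpositive radii are separated because only the square of the radius enters the
    formula. The coordinate sum is the squared distance, written so that the closure rules for
    smoothness apply.\<close>
  define b where "b i x = (if r i \<le> 0 then 0 else exp_poly 1 ((r i)\<^sup>2 - (\<Sum>e\<in>Basis. ((x \<bullet> e) - a i \<bullet> e) * ((x \<bullet> e) - a i \<bullet> e))))" for i x
  have sum_eq: "(\<Sum>e\<in>Basis. ((x \<bullet> e) - a i \<bullet> e) * ((x \<bullet> e) - a i \<bullet> e)) = (dist (a i) x)\<^sup>2" for x i
    by (simp add: dist_norm norm_minus_commute power2_norm_eq_inner euclidean_inner[of "x - a i" "x - a i"] flip: inner_diff_left)
  have b_smooth: "smooth (b i)" for i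
  proof (cases "r i \<le> 0")
    case False
    have "smooth (\<lambda>x. exp_poly 1 ((r i)\<^sup>2 - (\<Sum>e\<in>Basis. ((x \<bullet> e) - a i \<bullet> e) * ((x \<bullet> e) - a i \<bullet> e))))"
      by (rule smooth_compose[OF smooth_exp_poly])
        (intro smooth_diff smooth_const smooth_sum smooth_mult smooth_inner finite_Basis)
    then show ?thesis using False by (simp add: b_def[abs_def])
  qed (simp add: b_def[abs_def] smooth_const)
  have b_nonneg: "b i x \<ge> 0" for i x by (simp add: b_def exp_poly_1_nonneg)
  have b_pos: "b i x > 0 \<longleftrightarrow> x \<in> ball (a i) (r i)" for i x
  proof (cases "r i \<le> 0")
    case True
    then have "\<not> dist (a i) x < r i" using zero_le_dist[of "a i" x] by linarith
    with True show ?thesis by (simp add: b_def)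
  next
    case False
    then have "b i x > 0 \<longleftrightarrow> (dist (a i) x)\<^sup>2 < (r i)\<^sup>2"
      by (simp add: b_def sum_eq exp_poly_1_pos_iff)
    also have "\<dots> \<longleftrightarrow> dist (a i) x < r i"
      using False by (auto intro: power_strict_mono power2_less_imp_less)
    finally show ?thesis by simp
  qed
  define \<xi> where "\<xi> m x = H (real m * (\<Sum>i<m. b i x))" for m x
  show ?thesis
  proof (rule that[of \<xi>])
    fix m
    have sm: "smooth (\<xi> m)" unfolding \<xi>_def
      by (rule smooth_compose[OF H(1)]) (intro smooth_mult smooth_const smooth_sum b_smooth finite_lessThan)
    have "{x. \<xi> m x \<noteq> 0} \<subseteq> (\<Union>i<m. cball (a i) (r i))"
    proof
      fix x assume "x \<in> {x. \<xi> m x \<noteq> 0}"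
      then have "real m * (\<Sum>i<m. b i x) > 0" using H(2) unfolding \<xi>_def by (metis linorder_not_le mem_Collect_eq)
      then have "(\<Sum>i<m. b i x) > 0" by (simp add: zero_less_mult_iff)
      then obtain i where "i < m" "b i x > 0"
        using sum_nonpos[of "{..<m}" "\<lambda>i. b i x"] by (meson lessThan_iff linorder_not_le)
      then show "x \<in> (\<Union>i<m. cball (a i) (r i))" using b_pos[of i x] by (auto intro!: bexI[of _ i])
    qed
    moreover have cc: "compact (\<Union>i<m. cball (a i) (r i))" by (intro compact_UN) auto
    ultimately have cl: "closure {x. \<xi> m x \<noteq> 0} \<subseteq> (\<Union>i<m. cball (a i) (r i))"
      by (intro closure_minimal compact_imp_closed)
    then have "closure {x. \<xi> m x \<noteq> 0} \<subseteq> V" using ar(2) by blast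
    moreover have "compact (closure {x. \<xi> m x \<noteq> 0})"
      using compact_Int_closed[OF cc, of "closure {x. \<xi> m x \<noteq> 0}"] cl by (simp add: Int_absorb1)
    ultimately show "\<xi> m \<in> test_functions V" using sm by (simp add: test_functions_def)
  next
    fix m x
    have "H y \<in> {0..1}" for y
      using H(2)[of 0] H(3)[of 1] H(2)[of y] H(3)[of y] monoD[OF H(4), of 0 y] monoD[OF H(4), of y 1] by fastforce
    then show "0 \<le> \<xi> m x \<and> \<xi> m x \<le> 1" by (auto simp: \<xi>_def)
  next
    fix x
    show "(\<lambda>m. \<xi> m x) \<longlonglongrightarrow> indicator V x"
    proof (cases "x \<in> V")
      case True
      then obtain i where i: "b i x > 0" using cover b_pos by blast
      obtain N where N: "real N * b i x > 1" using reals_Archimedean3[OF i] by blast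
      have "\<xi> m x = 1" if "m \<ge> max N (Suc i)" for m
      proof -
        have "b i x \<le> (\<Sum>i<m. b i x)" using that by (intro member_le_sum b_nonneg) auto
        then have "real N * b i x \<le> real m * (\<Sum>i<m. b i x)"
          using that i by (intro mult_mono) auto
        then show ?thesis using N H(3) by (simp add: \<xi>_def)
      qed
      then show ?thesis using True
        by (intro tendsto_eventually) (auto simp: eventually_sequentially intro!: exI[of _ "max N (Suc i)"])
    next
      case False
      then have "b i x = 0" for i using b_nonneg[of i x] b_pos[of i x] cover by fastforce
      then show ?thesis using False H(2) by (simp add: \<xi>_def)
    qed
  qed
qed

section \<open>Square integrable functions\<close>

text \<open>Vector-valued, so that functions, gradient fields and traces share the convergence
  lemmas; on real functions it is membership in \<open>L2\<close>.\<close>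

definition sq_integrable :: "'b measure \<Rightarrow> ('b \<Rightarrow> 'v::euclidean_space) \<Rightarrow> bool" where
  "sq_integrable M f \<longleftrightarrow> f \<in> borel_measurable M \<and> integrable M (\<lambda>x. (norm (f x))\<^sup>2)"

lemma L2_eq_sq_integrable: "f \<in> L2 M \<longleftrightarrow> sq_integrable M f"
  by (simp add: L2_def sq_integrable_def)

lemma sq_integrable_inner:
  assumes "sq_integrable M f" "sq_integrable M g"
  shows "integrable M (\<lambda>x. f x \<bullet> g x)"
proof (rule Bochner_Integration.integrable_bound)
  show "integrable M (\<lambda>x. (norm (f x))\<^sup>2 + (norm (g x))\<^sup>2)"
    using assms by (simp add: sq_integrable_def)
  show "AE x in M. norm (f x \<bullet> g x) \<le> norm ((norm (f x))\<^sup>2 + (norm (g x))\<^sup>2)"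
  proof (rule AE_I2)
    fix x
    have "\<bar>f x \<bullet> g x\<bar> \<le> norm (f x) * norm (g x)" by (rule Cauchy_Schwarz_ineq2)
    moreover have "2 * (norm (f x) * norm (g x)) \<le> (norm (f x))\<^sup>2 + (norm (g x))\<^sup>2"
      using sum_squares_bound[of "norm (f x)" "norm (g x)"] by simp
    moreover have "0 \<le> norm (f x) * norm (g x)" by simp
    ultimately have "\<bar>f x \<bullet> g x\<bar> \<le> (norm (f x))\<^sup>2 + (norm (g x))\<^sup>2" by linarith
    then show "norm (f x \<bullet> g x) \<le> norm ((norm (f x))\<^sup>2 + (norm (g x))\<^sup>2)" by simp
  qed
  show "(\<lambda>x. f x \<bullet> g x) \<in> borel_measurable M"
    using assms by (auto simp: sq_integrable_def)
qed

lemma norm_lin_bound: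
  "(norm (a *\<^sub>R v + b *\<^sub>R w))\<^sup>2 \<le> 2 * a\<^sup>2 * (norm v)\<^sup>2 + 2 * b\<^sup>2 * (norm w)\<^sup>2"
proof -
  have "norm (a *\<^sub>R v + b *\<^sub>R w) \<le> \<bar>a\<bar> * norm v + \<bar>b\<bar> * norm w"
    by (metis norm_scaleR norm_triangle_ineq)
  then have "(norm (a *\<^sub>R v + b *\<^sub>R w))\<^sup>2 \<le> (\<bar>a\<bar> * norm v + \<bar>b\<bar> * norm w)\<^sup>2"
    by (rule power_mono) simp
  also have "\<dots> \<le> 2 * (\<bar>a\<bar> * norm v)\<^sup>2 + 2 * (\<bar>b\<bar> * norm w)\<^sup>2"
    using sum_squares_bound[of "\<bar>a\<bar> * norm v" "\<bar>b\<bar> * norm w"] by (simp add: power2_sum)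
  finally show ?thesis by (simp add: power_mult_distrib)
qed

lemma sq_integrable_lin:
  assumes "sq_integrable M f" "sq_integrable M g"
  shows "sq_integrable M (\<lambda>x. a *\<^sub>R f x + b *\<^sub>R g x)"
  unfolding sq_integrable_def
proof
  have [measurable]: "f \<in> borel_measurable M" "g \<in> borel_measurable M"
    using assms by (auto simp: sq_integrable_def)
  show "(\<lambda>x. a *\<^sub>R f x + b *\<^sub>R g x) \<in> borel_measurable M" by measurable
  show "integrable M (\<lambda>x. (norm (a *\<^sub>R f x + b *\<^sub>R g x))\<^sup>2)"
    by (rule Bochner_Integration.integrable_bound[of M "\<lambda>x. 2 * a\<^sup>2 * (norm (f x))\<^sup>2 + 2 * b\<^sup>2 * (norm (g x))\<^sup>2"])
      (use assms in \<open>auto simp: sq_integrable_def intro!: AE_I2 order_trans[OF norm_lin_bound]\<close>)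
qed

lemma sq_integrable_component: "sq_integrable M G \<Longrightarrow> sq_integrable M (\<lambda>x. G x \<bullet> b)" for G :: "'c \<Rightarrow> 'v::euclidean_space"
  unfolding sq_integrable_def
proof safe
  assume G: "G \<in> borel_measurable M" "integrable M (\<lambda>x. (norm (G x))\<^sup>2)"
  then show "(\<lambda>x. G x \<bullet> b) \<in> borel_measurable M" by simp
  show "integrable M (\<lambda>x. (norm (G x \<bullet> b))\<^sup>2)"
  proof (rule Bochner_Integration.integrable_bound)
    show "integrable M (\<lambda>x. (norm b)\<^sup>2 * (norm (G x))\<^sup>2)" using G by simp
    have "(G x \<bullet> b)\<^sup>2 \<le> (norm b)\<^sup>2 * (norm (G x))\<^sup>2" for x
      using power_mono[OF Cauchy_Schwarz_ineq2[of "G x" b] abs_ge_zero, of 2] by (simp add: power_mult_distrib mult.commute)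
    then show "AE x in M. norm ((norm (G x \<bullet> b))\<^sup>2) \<le> norm ((norm b)\<^sup>2 * (norm (G x))\<^sup>2)" by simp
  qed (use G in simp)
qed

lemma sq_integrable_diff: "sq_integrable M f \<Longrightarrow> sq_integrable M g \<Longrightarrow> sq_integrable M (\<lambda>x. f x - g x)"
  using sq_integrable_lin[of M f g 1 "-1"] by simp

lemma integral_norm_lin_bound:
  assumes "sq_integrable M f" "sq_integrable M g"
  shows "(LINT x|M. (norm (a *\<^sub>R f x + b *\<^sub>R g x))\<^sup>2) \<le>
    2 * a\<^sup>2 * (LINT x|M. (norm (f x))\<^sup>2) + 2 * b\<^sup>2 * (LINT x|M. (norm (g x))\<^sup>2)"
proof -
  have "(LINT x|M. (norm (a *\<^sub>R f x + b *\<^sub>R g x))\<^sup>2) \<le>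
      (LINT x|M. 2 * a\<^sup>2 * (norm (f x))\<^sup>2 + 2 * b\<^sup>2 * (norm (g x))\<^sup>2)"
    using assms sq_integrable_lin[OF assms, of a b] norm_lin_bound
    by (intro integral_mono) (auto simp: sq_integrable_def)
  also have "\<dots> = 2 * a\<^sup>2 * (LINT x|M. (norm (f x))\<^sup>2) + 2 * b\<^sup>2 * (LINT x|M. (norm (g x))\<^sup>2)"
    using assms by (simp add: sq_integrable_def)
  finally show ?thesis .
qed

text \<open>Young's inequality with a free weight: a small c makes the second term small, and the
  large 1 / c is affordable where the first factor tends to 0.\<close>

lemma integral_inner_bound:
  assumes "sq_integrable M f" "sq_integrable M g" "c > 0"
  shows "\<bar>LINT x|M. f x \<bullet> g x\<bar> \<le> (LINT x|M. (norm (f x))\<^sup>2) / c + c * (LINT x|M. (norm (g x))\<^sup>2)"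
proof -
  have ineq: "\<bar>v \<bullet> w\<bar> \<le> (norm v)\<^sup>2 / c + c * (norm w)\<^sup>2" for v w :: 'b
  proof -
    have "0 \<le> (norm v / sqrt c - sqrt c * norm w)\<^sup>2" by simp
    then have "2 * (norm v * norm w) \<le> (norm v)\<^sup>2 / c + c * (norm w)\<^sup>2"
      using assms(3) by (simp add: power2_diff power_divide power_mult_distrib)
    moreover have "0 \<le> norm v * norm w" by simp
    ultimately show ?thesis using Cauchy_Schwarz_ineq2[of v w] by linarith
  qed
  have "\<bar>LINT x|M. f x \<bullet> g x\<bar> \<le> (LINT x|M. \<bar>f x \<bullet> g x\<bar>)"
    using integral_norm_bound[of M "\<lambda>x. f x \<bullet> g x"] by simp
  also have "\<dots> \<le> (LINT x|M. (norm (f x))\<^sup>2 / c + c * (norm (g x))\<^sup>2)"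
    using assms ineq sq_integrable_inner[OF assms(1,2)]
    by (intro integral_mono) (auto simp: sq_integrable_def)
  also have "\<dots> = (LINT x|M. (norm (f x))\<^sup>2) / c + c * (LINT x|M. (norm (g x))\<^sup>2)"
    using assms by (simp add: sq_integrable_def)
  finally show ?thesis .
qed

lemma L2_conv_inner:
  assumes "eventually (\<lambda>s. sq_integrable M (f s)) F" "sq_integrable M f0" "sq_integrable M g"
    and lim: "((\<lambda>s. LINT x|M. (norm (f s x - f0 x))\<^sup>2) \<longlongrightarrow> 0) F"
  shows "((\<lambda>s. LINT x|M. f s x \<bullet> g x) \<longlongrightarrow> (LINT x|M. f0 x \<bullet> g x)) F"
proof (rule tendstoI)
  fix e :: real assume e: "e > 0"
  define G where "G = (LINT x|M. (norm (g x))\<^sup>2)"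
  have G: "G \<ge> 0" by (simp add: G_def)
  \<comment> \<open>The weight makes c * G less than e / 2 for every G, including 0; the convergence
    of the differences then has to beat c * (e / 2).\<close>
  define c where "c = e / (2 * (G + 1))"
  have c: "c > 0" "c * G < e / 2 + 0" using e G by (auto simp: c_def field_simps)
  have "eventually (\<lambda>s. (LINT x|M. (norm (f s x - f0 x))\<^sup>2) < c * (e / 2)) F"
    using order_tendstoD(2)[OF lim, of "c * (e / 2)"] c e by simp
  with assms(1) show "eventually (\<lambda>s. dist (LINT x|M. f s x \<bullet> g x) (LINT x|M. f0 x \<bullet> g x) < e) F"
  proof eventually_elim
    fix s assume s: "sq_integrable M (f s)" "(LINT x|M. (norm (f s x - f0 x))\<^sup>2) < c * (e / 2)"
    have "(LINT x|M. f s x \<bullet> g x) - (LINT x|M. f0 x \<bullet> g x) = (LINT x|M. (f s x - f0 x) \<bullet> g x)"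
      using sq_integrable_inner[OF s(1) assms(3)] sq_integrable_inner[OF assms(2,3)]
      by (simp add: inner_diff_left)
    moreover have "(LINT x|M. (norm (f s x - f0 x))\<^sup>2) / c < e / 2"
      using s(2) c by (simp add: field_simps)
    ultimately show "dist (LINT x|M. f s x \<bullet> g x) (LINT x|M. f0 x \<bullet> g x) < e"
      using integral_inner_bound[OF sq_integrable_diff[OF s(1) assms(2)] assms(3) c(1)] c(2)
      unfolding dist_real_def G_def by linarith
  qed
qed

text \<open>Expanding the square of the difference expresses the squared norm through the distance
  to the limit and the pairing with it, both of which converge.\<close>

lemma L2_conv_norm:
  assumes ev: "eventually (\<lambda>s. sq_integrable M (f s)) F" and f0: "sq_integrable M f0"
    and lim: "((\<lambda>s. LINT x|M. (norm (f s x - f0 x))\<^sup>2) \<longlongrightarrow> 0) F"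
  shows "((\<lambda>s. LINT x|M. (norm (f s x))\<^sup>2) \<longlongrightarrow> (LINT x|M. (norm (f0 x))\<^sup>2)) F"
proof -
  have "((\<lambda>s. (LINT x|M. (norm (f s x - f0 x))\<^sup>2) + 2 * (LINT x|M. f s x \<bullet> f0 x)
      - (LINT x|M. f0 x \<bullet> f0 x)) \<longlongrightarrow> 0 + 2 * (LINT x|M. f0 x \<bullet> f0 x) - (LINT x|M. f0 x \<bullet> f0 x)) F"
    by (intro tendsto_intros lim L2_conv_inner[OF ev f0 f0])
  moreover have "eventually (\<lambda>s. (LINT x|M. (norm (f s x - f0 x))\<^sup>2) + 2 * (LINT x|M. f s x \<bullet> f0 x)
      - (LINT x|M. f0 x \<bullet> f0 x) = (LINT x|M. (norm (f s x))\<^sup>2)) F"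
    using ev
  proof eventually_elim
    fix s assume s: "sq_integrable M (f s)"
    have "(norm (f s x - f0 x))\<^sup>2 = (norm (f s x))\<^sup>2 - 2 * (f s x \<bullet> f0 x) + f0 x \<bullet> f0 x" for x
      by (simp add: power2_norm_eq_inner inner_diff_left inner_diff_right inner_commute)
    moreover have "integrable M (\<lambda>x. (norm (f s x))\<^sup>2)" using s by (simp add: sq_integrable_def)
    ultimately show "(LINT x|M. (norm (f s x - f0 x))\<^sup>2) + 2 * (LINT x|M. f s x \<bullet> f0 x)
      - (LINT x|M. f0 x \<bullet> f0 x) = (LINT x|M. (norm (f s x))\<^sup>2)"
      using sq_integrable_inner[OF s f0] sq_integrable_inner[OF f0 f0] by simp
  qed
  ultimately show ?thesis
    by (auto simp: power2_norm_eq_inner intro: Lim_transform_eventually)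
qed

section \<open>Lebesgue norms as integrals\<close>

lemma Lnorm_2_power2: "(Lnorm M 2 f)\<^sup>2 = (LINT x|M. (f x)\<^sup>2)"
proof -
  have "\<bar>y\<bar> powr 2 = y\<^sup>2" for y :: real by (cases "y = 0") (auto simp: powr_numeral)
  then show ?thesis by (simp add: Lnorm_def powr_half_sqrt)
qed

lemma Lnorm_powr: "p > 0 \<Longrightarrow> Lnorm M p f powr p = (LINT x|M. \<bar>f x\<bar> powr p)"
  by (simp add: Lnorm_def powr_powr)

lemma tendsto_power2_zero_iff: "((\<lambda>s. (f s)\<^sup>2) \<longlongrightarrow> 0) F \<longleftrightarrow> (f \<longlongrightarrow> 0) F" for f :: "'c \<Rightarrow> real"
proof
  assume "((\<lambda>s. (f s)\<^sup>2) \<longlongrightarrow> 0) F"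
  then have "((\<lambda>s. sqrt ((f s)\<^sup>2)) \<longlongrightarrow> sqrt 0) F" by (rule tendsto_real_sqrt)
  then show "(f \<longlongrightarrow> 0) F" by (simp add: tendsto_rabs_zero_iff)
qed (metis tendsto_power zero_power2)

lemma tendsto_add_zero_iff:
  fixes f g :: "'c \<Rightarrow> real"
  assumes "\<And>s. f s \<ge> 0" "\<And>s. g s \<ge> 0"
  shows "((\<lambda>s. f s + g s) \<longlongrightarrow> 0) F \<longleftrightarrow> (f \<longlongrightarrow> 0) F \<and> (g \<longlongrightarrow> 0) F"
proof safe
  assume *: "((\<lambda>s. f s + g s) \<longlongrightarrow> 0) F"
  show "(f \<longlongrightarrow> 0) F" "(g \<longlongrightarrow> 0) F"
    by (rule tendsto_sandwich[OF _ _ tendsto_const *]; use assms in \<open>auto simp: add_increasing add_increasing2\<close>)+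
qed (use tendsto_add[of f 0 F g 0] in simp)

lemma Lnorm_cong:
  assumes "AE x in M. w x = w' x" "w \<in> borel_measurable M" "w' \<in> borel_measurable M"
  shows "Lnorm M q w = Lnorm M q w'"
proof -
  have "(LINT x|M. \<bar>w x\<bar> powr q) = (LINT x|M. \<bar>w' x\<bar> powr q)"
  proof (rule integral_cong_AE)
    show "AE x in M. \<bar>w x\<bar> powr q = \<bar>w' x\<bar> powr q" using assms(1) by eventually_elim simp
  qed (use assms in auto)
  then show ?thesis by (simp add: Lnorm_def)
qed

section \<open>The fundamental lemma of the calculus of variations\<close>

text \<open>The sets of the completed measure on a domain are not Borel, hence the second assumption.\<close>

locale essentially_borel = finite_measure M for M :: "'a::euclidean_space measure" +
  assumes borel_id [measurable]: "(\<lambda>x. x) \<in> borel_measurable M"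
    and ess_borel: "A \<in> sets M \<Longrightarrow> \<exists>B\<in>sets borel. AE x in M. x \<in> A \<longleftrightarrow> x \<in> B"
begin

lemma borel_measurable_continuous:
  fixes f :: "'a \<Rightarrow> 'b::topological_space"
  shows "continuous_on UNIV f \<Longrightarrow> f \<in> borel_measurable M"
  using measurable_compose[OF borel_id borel_measurable_continuous_onI] by simp

lemma Int_space_sets: "B \<in> sets borel \<Longrightarrow> B \<inter> space M \<in> sets M"
  using measurable_sets[OF borel_id, of B] by simp

text \<open>Cutoffs converging to indicators give vanishing integrals over open sets, and a
  pi-lambda argument carries this to Borel sets. The set where \<open>c\<close> is positive is Borel
  up to a null set, and so is the set where it is negative; hence the integrals of both its parts
  vanish.\<close>

lemma AE_zero_of_test_integrals:
  fixes c :: "'a \<Rightarrow> real"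
  assumes c: "integrable M c" and U: "open U" "space M \<subseteq> U"
    and test: "\<And>\<xi>. \<xi> \<in> test_functions U \<Longrightarrow> (LINT x|M. c x * \<xi> x) = 0"
  shows "AE x in M. c x = 0"
proof -
  have [measurable]: "c \<in> borel_measurable M" using c by simp
  have int: "integrable M (\<lambda>x. c x * indicator B x)" if "B \<in> sets borel" for B
  proof -
    have [measurable]: "(indicator B :: 'a \<Rightarrow> real) \<in> borel_measurable M"
      using measurable_compose[OF borel_id, of "indicator B" borel] that by simp
    show ?thesis
      by (rule Bochner_Integration.integrable_bound[OF c]) (auto split: split_indicator)
  qed
  have "open V \<Longrightarrow> (LINT x|M. c x * indicator V x) = 0" for V
  proof -
    assume "open V"
    then have "open (V \<inter> U)" using U by blast
    then obtain \<xi> :: "nat \<Rightarrow> 'a \<Rightarrow> real" where \<xi>: "\<And>m. \<xi> m \<in> test_functions (V \<inter> U)"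
      "\<And>m x. 0 \<le> \<xi> m x \<and> \<xi> m x \<le> 1" "\<And>x. (\<lambda>m. \<xi> m x) \<longlonglongrightarrow> indicator (V \<inter> U) x"
      by (rule cutoff_sequence) (rule that)
    have [measurable]: "\<xi> m \<in> borel_measurable M" for m
      using \<xi>(1)[of m] by (intro borel_measurable_continuous smooth_continuous) (simp add: test_functions_def)
    have "(\<lambda>m. LINT x|M. c x * \<xi> m x) \<longlonglongrightarrow> (LINT x|M. c x * indicator (V \<inter> U) x)"
    proof (rule integral_dominated_convergence)
      show "integrable M (\<lambda>x. \<bar>c x\<bar>)" using c by simp
      show "(\<lambda>x. c x * indicator (V \<inter> U) x) \<in> borel_measurable M"
        using int[of "V \<inter> U"] \<open>open (V \<inter> U)\<close> by (auto intro: borel_measurable_integrable)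
      show "AE x in M. norm (c x * \<xi> m x) \<le> \<bar>c x\<bar>" for m
        using \<xi>(2)[of m] by (auto simp: abs_mult intro!: AE_I2 mult_left_le)
    qed (auto intro!: tendsto_intros \<xi>(3))
    moreover have "\<xi> m \<in> test_functions U" for m using \<xi>(1)[of m] by (auto simp: test_functions_def)
    ultimately have "(LINT x|M. c x * indicator (V \<inter> U) x) = 0"
      using test by (simp add: LIMSEQ_const_iff)
    also have "(LINT x|M. c x * indicator (V \<inter> U) x) = (LINT x|M. c x * indicator V x)"
      using U by (intro Bochner_Integration.integral_cong) (auto simp: indicator_def)
    finally show ?thesis .
  qed
  note open_zero = this
  have borel_zero: "(LINT x|M. c x * indicator B x) = 0" if "B \<in> sets borel" for B
  proof -
    have "Int_stable {S :: 'a set. open S}" by (auto simp: Int_stable_def)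
    moreover have "{S :: 'a set. open S} \<subseteq> Pow UNIV" by simp
    moreover have "B \<in> sigma_sets UNIV {S. open S}" using that by (simp add: borel_def)
    ultimately show ?thesis
    proof (induction rule: sigma_sets_induct_disjoint)
      case (basic A)
      then show ?case using open_zero by simp
    next
      case (compl A)
      then have A: "A \<in> sets borel" by (simp add: borel_def)
      have "(LINT x|M. c x * indicator (UNIV - A) x) = (LINT x|M. c x * indicator UNIV x - c x * indicator A x)"
        by (intro Bochner_Integration.integral_cong) (auto simp: indicator_def)
      also have "\<dots> = (LINT x|M. c x * indicator UNIV x) - (LINT x|M. c x * indicator A x)"
        by (intro Bochner_Integration.integral_diff int) (auto simp: A)
      finally show ?case using compl open_zero[of UNIV] by simp
    next
      case (union A)
      then have A: "A i \<in> sets borel" for i by (auto simp: borel_def)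
      have eq: "(LINT x|M. c x * indicator B x) = (LINT x:(B \<inter> space M)|M. c x)" for B
        unfolding set_lebesgue_integral_def
        by (intro Bochner_Integration.integral_cong) (auto simp: indicator_def)
      have "(LINT x:(\<Union>i. A i \<inter> space M)|M. c x) = (\<Sum>i. LINT x:(A i \<inter> space M)|M. c x)"
      proof (rule lebesgue_integral_countable_add)
        show "set_integrable M (\<Union>i. A i \<inter> space M) c"
          unfolding set_integrable_def
          by (rule integrable_mult_indicator) (use A Int_space_sets c in auto)
      qed (use A Int_space_sets union(1) in \<open>auto simp: disjoint_family_on_def\<close>)
      also have "\<dots> = 0" using union(3) by (simp flip: eq)
      finally show ?case by (simp add: eq)
    qed auto
  qed
  have half: "AE x in M. d x \<le> 0"
    if d: "d = c \<or> d = (\<lambda>x. - c x)" for d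
  proof -
    have [measurable]: "d \<in> borel_measurable M" using d by auto
    have "{x\<in>space M. d x > 0} \<in> sets M" by measurable
    then obtain B where B: "B \<in> sets borel" "AE x in M. x \<in> {x\<in>space M. d x > 0} \<longleftrightarrow> x \<in> B"
      using ess_borel by blast
    have dint: "integrable M d" using d c by auto
    have "(LINT x|M. max (d x) 0) = (LINT x|M. d x * indicator B x)"
    proof (rule integral_cong_AE)
      show "AE x in M. max (d x) 0 = d x * indicator B x"
        using B(2) AE_space by eventually_elim (auto simp: indicator_def)
      show "(\<lambda>x. d x * indicator B x) \<in> borel_measurable M"
        using int[OF B(1)] d by (auto dest: borel_measurable_integrable)
    qed auto
    also have "\<dots> = 0" using borel_zero[OF B(1)] d by auto
    finally have "AE x in M. max (d x) 0 = 0"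
      using dint by (subst (asm) integral_nonneg_eq_0_iff_AE) auto
    then show ?thesis by eventually_elim simp
  qed
  from half[of c] half[of "\<lambda>x. - c x"] have "AE x in M. c x \<le> 0" "AE x in M. - c x \<le> 0" by auto
  then show ?thesis by eventually_elim simp
qed

lemma sq_integrable_bounded:
  fixes f :: "'a \<Rightarrow> 'v::euclidean_space"
  assumes "f \<in> borel_measurable M" "\<And>x. x \<in> space M \<Longrightarrow> norm (f x) \<le> b"
  shows "sq_integrable M f"
  unfolding sq_integrable_def
proof
  have "norm ((norm (f x))\<^sup>2) \<le> b\<^sup>2" if "x \<in> space M" for x
    using power_mono[OF assms(2)[OF that], of 2] by simp
  then show "integrable M (\<lambda>x. (norm (f x))\<^sup>2)"
    using assms(1) by (intro integrable_const_bound[of _ "b\<^sup>2"]) auto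
qed (fact assms(1))

end

lemma test_function_bounded:
  assumes "\<xi> \<in> test_functions U"
  obtains b where "\<And>x. \<bar>\<xi> x\<bar> \<le> b"
proof -
  have "continuous_on UNIV \<xi>" "compact (closure {x. \<xi> x \<noteq> 0})"
    using assms smooth_continuous by (auto simp: test_functions_def)
  then have "compact (\<xi> ` closure {x. \<xi> x \<noteq> 0})"
    by (intro compact_continuous_image) (auto intro: continuous_on_subset)
  then have "bounded (\<xi> ` closure {x. \<xi> x \<noteq> 0})" by (rule compact_imp_bounded)
  then obtain b where b: "\<And>x. x \<in> closure {x. \<xi> x \<noteq> 0} \<Longrightarrow> norm (\<xi> x) \<le> b"
    by (auto simp: bounded_iff)
  show ?thesis
  proof (rule that[of "max b 0"])
    show "\<bar>\<xi> x\<bar> \<le> max b 0" for x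
    proof (cases "\<xi> x = 0")
      case False
      then have "x \<in> closure {x. \<xi> x \<noteq> 0}" by (intro subsetD[OF closure_subset]) simp
      then show ?thesis using b[of x] by simp
    qed simp
  qed
qed

text \<open>A Lebesgue set is a Borel set plus a subset of a Borel null set, and boundedness makes
  the measure finite.\<close>

lemma essentially_borel_lebesgue_on:
  assumes S: "S \<in> sets lebesgue" "bounded S"
  shows "essentially_borel (lebesgue_on S)"
proof (intro essentially_borel.intro finite_measureI essentially_borel_axioms.intro)
  show "emeasure (lebesgue_on S) (space (lebesgue_on S)) \<noteq> \<infinity>"
    using bounded_set_imp_lmeasurable[OF S(2,1)] S
    by (simp add: emeasure_restrict_space fmeasurable_def less_top)
  have "(\<lambda>x. x) \<in> measurable lebesgue borel" 
    by (rule measurable_completion) simp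
  then show "(\<lambda>x. x) \<in> borel_measurable (lebesgue_on S)" by (rule measurable_restrict_space1)
  fix A assume "A \<in> sets (lebesgue_on S)"
  then have "A \<in> sets lebesgue" using S by (auto simp: sets_restrict_space_iff)
  then obtain B N N' where B: "A = B \<union> N" "N \<subseteq> N'" "N' \<in> null_sets lborel" "B \<in> sets lborel"
    by (rule sets_completionE)
  have "AE x in lborel. x \<notin> N'" using B(3) by (rule AE_not_in)
  then have "AE x in lebesgue. x \<notin> N'" by (rule AE_completion)
  then have "AE x in lebesgue_on S. x \<notin> N'" using S by (subst AE_restrict_space_iff) auto
  then have "AE x in lebesgue_on S. x \<in> A \<longleftrightarrow> x \<in> B" by eventually_elim (use B in auto)
  then show "\<exists>B\<in>sets borel. AE x in lebesgue_on S. x \<in> A \<longleftrightarrow> x \<in> B" using B(4) by auto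
qed

section \<open>Time derivatives\<close>

text \<open>The time direction (1, 0) differentiates only the factor \<open>\<eta>\<close>, so
  \<open>has_time_deriv\<close> tested with such products separates time from space.\<close>

lemma test_function_product:
  fixes U :: "'a::euclidean_space set"
  assumes \<eta>: "\<eta> \<in> test_functions {0<..<T::real}" "\<And>t. (\<eta> has_real_derivative \<eta>' t) (at t)"
    and \<xi>: "\<xi> \<in> test_functions U"
  shows "(\<lambda>z. \<eta> (fst z) * \<xi> (snd z)) \<in> test_functions ({0<..<T} \<times> U)"
    and "frechet_derivative (\<lambda>z. \<eta> (fst z) * \<xi> (snd z)) (at z) (1, 0) = \<eta>' (fst z) * \<xi> (snd z)"
proof -
  have sm: "smooth (\<lambda>z::real\<times>'a. \<eta> (fst z) * \<xi> (snd z))"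
    using \<eta>(1) \<xi> by (intro smooth_mult smooth_compose[OF _ smooth_fst] smooth_snd) (auto simp: test_functions_def)
  let ?C = "closure {t. \<eta> t \<noteq> 0} \<times> closure {x. \<xi> x \<noteq> 0}"
  have C: "compact ?C" "?C \<subseteq> {0<..<T} \<times> U"
    using \<eta>(1) \<xi> by (auto simp: test_functions_def intro: compact_Times)
  have sub: "closure {z. \<eta> (fst z) * \<xi> (snd z) \<noteq> 0} \<subseteq> ?C"
  proof (rule closure_minimal)
    have "{t. \<eta> t \<noteq> 0} \<subseteq> closure {t. \<eta> t \<noteq> 0}" "{x. \<xi> x \<noteq> 0} \<subseteq> closure {x. \<xi> x \<noteq> 0}"
      by (rule closure_subset)+
    then show "{z. \<eta> (fst z) * \<xi> (snd z) \<noteq> 0} \<subseteq> ?C" by (auto simp: subset_iff)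
  qed (use C compact_imp_closed in blast)
  moreover have "compact (closure {z. \<eta> (fst z) * \<xi> (snd z) \<noteq> 0})"
    using compact_Int_closed[OF C(1) closed_closure, of "{z. \<eta> (fst z) * \<xi> (snd z) \<noteq> 0}"] sub
    by (simp only: Int_absorb1)
  ultimately show "(\<lambda>z. \<eta> (fst z) * \<xi> (snd z)) \<in> test_functions ({0<..<T} \<times> U)"
    using sm C(2) by (auto simp: test_functions_def)
  obtain G where G: "\<And>x. (\<xi> has_derivative (\<lambda>h. G x \<bullet> h)) (at x)"
    by (rule smooth_has_gradient[of \<xi>]) (use \<xi> in \<open>auto simp: test_functions_def\<close>)
  have "((\<lambda>z. \<eta> (fst z)) has_derivative (\<lambda>h. \<eta>' (fst z) * fst h)) (at z)"
    using has_derivative_compose[OF bounded_linear_imp_has_derivative[OF bounded_linear_fst]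
        \<eta>(2)[unfolded has_field_derivative_def], of z] by simp
  moreover have "((\<lambda>z. \<xi> (snd z)) has_derivative (\<lambda>h. G (snd z) \<bullet> snd h)) (at z)"
    using has_derivative_compose[OF bounded_linear_imp_has_derivative[OF bounded_linear_snd] G, of z] by simp
  ultimately have "((\<lambda>z. \<eta> (fst z) * \<xi> (snd z)) has_derivative
      (\<lambda>h. \<eta> (fst z) * (G (snd z) \<bullet> snd h) + \<eta>' (fst z) * fst h * \<xi> (snd z))) (at z)"
    by (rule has_derivative_mult)
  from frechet_derivative_at[OF this, symmetric]
  show "frechet_derivative (\<lambda>z. \<eta> (fst z) * \<xi> (snd z)) (at z) (1, 0) = \<eta>' (fst z) * \<xi> (snd z)"
    by simp
qed

context essentially_borel
begin

lemma test_function_sq_integrable: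
  assumes "\<xi> \<in> test_functions U" shows "sq_integrable M \<xi>"
proof -
  obtain b where "\<And>x. \<bar>\<xi> x\<bar> \<le> b" using test_function_bounded[OF assms] by blast
  then show ?thesis using assms
    by (intro sq_integrable_bounded borel_measurable_continuous smooth_continuous) (auto simp: test_functions_def)
qed

end

text \<open>Off the support of \<open>\<eta>\<close> the function vanishes in a neighbourhood, so
  its derivative is continuous with compact support.\<close>

lemma test_function_derivative:
  assumes "\<eta> \<in> test_functions {0<..<T::real}" "\<And>t. (\<eta> has_real_derivative \<eta>' t) (at t)"
  shows "continuous_on UNIV \<eta>'" "\<exists>b. \<forall>t. \<bar>\<eta>' t\<bar> \<le> b"
proof -
  obtain G where G: "\<And>x. (\<eta> has_derivative (\<lambda>h. G x \<bullet> h)) (at x)" "continuous_on UNIV G"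
    by (rule smooth_has_gradient[of \<eta>]) (use assms in \<open>auto simp: test_functions_def\<close>)
  have "G t = \<eta>' t" for t
    using DERIV_unique[OF assms(2)[of t], of "G t"] G(1)[of t] by (simp add: has_field_derivative_def)
  then have "G = \<eta>'" by auto
  with G show c: "continuous_on UNIV \<eta>'" by simp
  have "\<eta>' t = 0" if "t \<notin> closure {t. \<eta> t \<noteq> 0}" for t
  proof -
    have "((\<lambda>t. 0) has_real_derivative 0) (at t)" by simp
    moreover have "eventually (\<lambda>s. 0 = \<eta> s) (nhds t)"
    proof (rule eventually_mono[OF eventually_nhds_in_open[of "- closure {t. \<eta> t \<noteq> 0}"]])
      fix s assume "s \<in> - closure {t. \<eta> t \<noteq> 0}"
      then have "s \<notin> {t. \<eta> t \<noteq> 0}" using closure_subset[of "{t. \<eta> t \<noteq> 0}"] by auto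
      then show "0 = \<eta> s" by simp
    qed (use that in auto)
    ultimately have "(\<eta> has_real_derivative 0) (at t)" by (subst (asm) DERIV_cong_ev[OF refl _ refl])
    then show ?thesis using DERIV_unique[OF assms(2)] by blast
  qed
  note zero = this
  have "compact (\<eta>' ` closure {t. \<eta> t \<noteq> 0})"
    using assms(1) by (intro compact_continuous_image continuous_on_subset[OF c]) (auto simp: test_functions_def)
  then have "bounded (\<eta>' ` closure {t. \<eta> t \<noteq> 0})" by (rule compact_imp_bounded)
  then obtain b where b: "\<And>t. t \<in> closure {t. \<eta> t \<noteq> 0} \<Longrightarrow> \<bar>\<eta>' t\<bar> \<le> b"
    by (auto simp: bounded_iff)
  have "\<bar>\<eta>' t\<bar> \<le> max b 0" for t
    using b[of t] zero[of t] by (cases "t \<in> closure {t. \<eta> t \<noteq> 0}") auto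
  then show "\<exists>b. \<forall>t. \<bar>\<eta>' t\<bar> \<le> b" by blast
qed

section \<open>Pairing a space-time function with a fixed spatial function\<close>

locale space_time = essentially_borel M for M :: "'a::euclidean_space measure" +
  fixes T :: real
begin

abbreviation "IT \<equiv> lebesgue_on {0<..<T}"

lemma essentially_borel_IT: "essentially_borel IT"
  by (rule essentially_borel_lebesgue_on) auto

sublocale IT: essentially_borel IT
  by (rule essentially_borel_IT)

sublocale P: pair_sigma_finite IT M ..

lemma borel_measurable_IT: "continuous_on UNIV f \<Longrightarrow> f \<in> borel_measurable IT" for f :: "real \<Rightarrow> real"
  by (rule IT.borel_measurable_continuous)

lemma sq_integrable_product:
  assumes "\<phi> \<in> L2 M" "continuous_on UNIV \<eta>" "\<forall>t. \<bar>\<eta> t\<bar> \<le> b"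
  shows "sq_integrable (IT \<Otimes>\<^sub>M M) (\<lambda>(t, x). \<eta> t * \<phi> x)"
proof -
  have [measurable]: "\<phi> \<in> borel_measurable M" using assms(1) by (simp add: L2_def)
  have [measurable]: "\<eta> \<in> borel_measurable IT" by (rule borel_measurable_IT) fact
  have meas: "(\<lambda>(t, x). \<eta> t * \<phi> x) \<in> borel_measurable (IT \<Otimes>\<^sub>M M)" by measurable
  have int\<phi>: "integrable M (\<lambda>x. (\<phi> x)\<^sup>2)" using assms(1) by (simp add: L2_def)
  have "integrable (IT \<Otimes>\<^sub>M M) (\<lambda>z. (\<eta> (fst z) * \<phi> (snd z))\<^sup>2)"
  proof (rule P.Fubini_integrable)
    show "(\<lambda>z. (\<eta> (fst z) * \<phi> (snd z))\<^sup>2) \<in> borel_measurable (IT \<Otimes>\<^sub>M M)" by measurable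
    show "AE t in IT. integrable M (\<lambda>x. (\<eta> (fst (t, x)) * \<phi> (snd (t, x)))\<^sup>2)"
      using int\<phi> by (simp add: power_mult_distrib)
    have "(\<eta> t)\<^sup>2 \<le> b\<^sup>2" for t using assms(3) by (metis abs_ge_zero power2_abs power_mono)
    then have "integrable IT (\<lambda>t. (\<eta> t)\<^sup>2)"
      by (intro IT.integrable_const_bound[of _ "b\<^sup>2"]) auto
    then show "integrable IT (\<lambda>t. LINT x|M. norm ((\<eta> (fst (t, x)) * \<phi> (snd (t, x)))\<^sup>2))"
      by (simp add: power_mult_distrib)
  qed
  with meas show ?thesis by (simp add: sq_integrable_def case_prod_beta')
qed

lemma integrable_space_time:
  assumes "(\<lambda>(t, x). h t x) \<in> L2 (IT \<Otimes>\<^sub>M M)" "\<phi> \<in> L2 M" "continuous_on UNIV \<eta>" "\<forall>t. \<bar>\<eta> t\<bar> \<le> b"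
  shows "integrable (IT \<Otimes>\<^sub>M M) (\<lambda>(t, x). h t x * (\<eta> t * \<phi> x))"
  using sq_integrable_inner[OF assms(1)[unfolded L2_eq_sq_integrable] sq_integrable_product[OF assms(2-4)]]
  by (simp add: case_prod_beta')

lemma integrable_pairing:
  assumes "(\<lambda>(t, x). h t x) \<in> L2 (IT \<Otimes>\<^sub>M M)" "\<phi> \<in> L2 M"
  shows "integrable IT (\<lambda>t. LINT x|M. h t x * \<phi> x)"
  using P.integrable_fst[OF integrable_space_time[OF assms, of "\<lambda>t. 1" 1]] by simp

text \<open>The indicator is for the boundary: \<open>zt\<close> lives on the whole frontier, while
  the dissipation counts only \<open>\<Gamma>1\<close>.\<close>

lemma integrable_energy:
  assumes "(\<lambda>(t, x). h t x) \<in> L2 (IT \<Otimes>\<^sub>M M)" "A \<in> sets M"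
  shows "integrable IT (\<lambda>t. LINT x|M. (h t x)\<^sup>2 * indicator A x)"
proof -
  have [measurable]: "(\<lambda>(t, x). h t x) \<in> borel_measurable (IT \<Otimes>\<^sub>M M)" using assms(1) by (simp add: L2_def)
  have "integrable (IT \<Otimes>\<^sub>M M) (\<lambda>z. (case z of (t, x) \<Rightarrow> (h t x)\<^sup>2 * indicator A x))"
  proof (rule Bochner_Integration.integrable_bound)
    show "integrable (IT \<Otimes>\<^sub>M M) (\<lambda>z. (case z of (t, x) \<Rightarrow> h t x)\<^sup>2)" using assms(1) by (simp add: L2_def)
    show "(\<lambda>(t, x). (h t x)\<^sup>2 * indicator A x) \<in> borel_measurable (IT \<Otimes>\<^sub>M M)"
      using assms(2) by measurable
  qed (auto simp: indicator_def)
  then show ?thesis by (rule P.integrable_fst)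
qed

text \<open>The spatial factor is merely in L2. Rather than approximating it by test functions, the
  time integral is taken first: it leaves a function \<open>a\<close> of x alone that is orthogonal
  to all spatial test functions, hence zero almost everywhere, and it remains so after
  multiplication by any \<open>\<phi>\<close>.\<close>

lemma weak_time_derivative:
  assumes hv: "has_time_deriv T M U h v" and U: "open U" "space M \<subseteq> U"
    and \<phi>: "\<phi> \<in> L2 M" and \<eta>: "\<eta> \<in> test_functions {0<..<T}" "\<And>t. (\<eta> has_real_derivative \<eta>' t) (at t)"
  shows "(LINT t|IT. \<eta>' t * (LINT x|M. h t x * \<phi> x)) = - (LINT t|IT. \<eta> t * (LINT x|M. v t x * \<phi> x))"
proof -
  have h: "(\<lambda>(t, x). h t x) \<in> L2 (IT \<Otimes>\<^sub>M M)" and v: "(\<lambda>(t, x). v t x) \<in> L2 (IT \<Otimes>\<^sub>M M)"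
    using hv by (auto simp: has_time_deriv_def Let_def)
  obtain b where b: "\<forall>t. \<bar>\<eta> t\<bar> \<le> b" using test_function_bounded[OF \<eta>(1)] by blast
  obtain b' where b': "\<forall>t. \<bar>\<eta>' t\<bar> \<le> b'" using test_function_derivative(2)[OF \<eta>] by blast
  have c: "continuous_on UNIV \<eta>" "continuous_on UNIV \<eta>'"
    using \<eta>(1) smooth_continuous test_function_derivative(1)[OF \<eta>] by (auto simp: test_functions_def)
  \<comment> \<open>The constant 1, in L2 because the measure is finite, yields the integrability of
    \<open>a\<close> itself.\<close>
  have one: "(\<lambda>x. 1) \<in> L2 M" by (simp add: L2_def)
  define a where "a x = (LINT t|IT. h t x * \<eta>' t) + (LINT t|IT. v t x * \<eta> t)" for x
  have ih: "integrable (IT \<Otimes>\<^sub>M M) (\<lambda>(t, x). h t x * (\<eta>' t * \<phi> x))" if "\<phi> \<in> L2 M" for \<phi>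
    by (rule integrable_space_time[OF h that c(2) b'])
  have iv: "integrable (IT \<Otimes>\<^sub>M M) (\<lambda>(t, x). v t x * (\<eta> t * \<phi> x))" if "\<phi> \<in> L2 M" for \<phi>
    by (rule integrable_space_time[OF v that c(1) b])
  have int_a: "integrable M a"
    using P.integrable_snd[OF ih[OF one]] P.integrable_snd[OF iv[OF one]] by (simp add: a_def[abs_def])
  have sum_eq: "(LINT z|(IT \<Otimes>\<^sub>M M). (case z of (t, x) \<Rightarrow> h t x * (\<eta>' t * \<phi> x)))
      + (LINT z|(IT \<Otimes>\<^sub>M M). (case z of (t, x) \<Rightarrow> v t x * (\<eta> t * \<phi> x))) = (LINT x|M. a x * \<phi> x)"
    if "\<phi> \<in> L2 M" for \<phi>
  proof -
    have "(LINT t|IT. h t x * (\<eta>' t * \<phi> x)) + (LINT t|IT. v t x * (\<eta> t * \<phi> x)) = a x * \<phi> x" for x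
      by (simp add: a_def distrib_right flip: mult.assoc)
    then have "(LINT x|M. a x * \<phi> x)
        = (LINT x|M. (LINT t|IT. h t x * (\<eta>' t * \<phi> x)) + (LINT t|IT. v t x * (\<eta> t * \<phi> x)))"
      by simp
    also have "\<dots> = (LINT x|M. LINT t|IT. h t x * (\<eta>' t * \<phi> x)) + (LINT x|M. LINT t|IT. v t x * (\<eta> t * \<phi> x))"
      by (intro Bochner_Integration.integral_add P.integrable_snd ih iv that)
    finally show ?thesis
      using P.integral_snd[OF ih[OF that]] P.integral_snd[OF iv[OF that]] by simp
  qed
  have "AE x in M. a x = 0"
  proof (rule AE_zero_of_test_integrals[OF int_a U])
    fix \<xi> :: "'a \<Rightarrow> real" assume \<xi>: "\<xi> \<in> test_functions U"
    have "(LINT z|(IT \<Otimes>\<^sub>M M). h (fst z) (snd z) * (\<eta>' (fst z) * \<xi> (snd z)))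
        = - (LINT z|(IT \<Otimes>\<^sub>M M). v (fst z) (snd z) * (\<eta> (fst z) * \<xi> (snd z)))"
    proof -
      have "\<forall>\<psi>\<in>test_functions ({0<..<T} \<times> U).
        (LINT z|(IT \<Otimes>\<^sub>M M). h (fst z) (snd z) * frechet_derivative \<psi> (at z) (1, 0))
          = - (LINT z|(IT \<Otimes>\<^sub>M M). v (fst z) (snd z) * \<psi> z)"
        using hv unfolding has_time_deriv_def Let_def by blast
      from bspec[OF this test_function_product(1)[OF \<eta> \<xi>]]
      show ?thesis unfolding test_function_product(2)[OF \<eta> \<xi>] .
    qed
    then show "(LINT x|M. a x * \<xi> x) = 0"
      using sum_eq[of \<xi>] test_function_sq_integrable[OF \<xi>] by (simp add: L2_eq_sq_integrable case_prod_beta')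
  qed
  then have "(LINT x|M. a x * \<phi> x) = (LINT x|M. 0)"
    using int_a \<phi> by (intro integral_cong_AE) (auto simp: L2_def)
  then have "(LINT z|(IT \<Otimes>\<^sub>M M). (case z of (t, x) \<Rightarrow> h t x * (\<eta>' t * \<phi> x)))
      = - (LINT z|(IT \<Otimes>\<^sub>M M). (case z of (t, x) \<Rightarrow> v t x * (\<eta> t * \<phi> x)))"
    using sum_eq[OF \<phi>] by simp
  then have "(LINT t|IT. LINT x|M. h t x * (\<eta>' t * \<phi> x)) = - (LINT t|IT. LINT x|M. v t x * (\<eta> t * \<phi> x))"
    using P.integral_fst[OF ih[OF \<phi>]] P.integral_fst[OF iv[OF \<phi>]] by simp
  moreover have "h t x * (\<eta>' t * \<phi> x) = \<eta>' t * (h t x * \<phi> x)"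
    "v t x * (\<eta> t * \<phi> x) = \<eta> t * (v t x * \<phi> x)" for t x by auto
  ultimately show ?thesis by simp
qed

end

text \<open>Tested against a difference of two smooth steps, placed just after \<open>s\<close> and just after \<open>t\<close>,
  the weak derivative compares the averages of the function there.\<close>

lemma weak_derivative_nonneg_imp_mono:
  fixes f F g :: "real \<Rightarrow> real"
  assumes weak: "\<And>\<eta> \<eta>'. \<eta> \<in> test_functions {0<..<T} \<Longrightarrow> (\<And>t. (\<eta> has_real_derivative \<eta>' t) (at t)) \<Longrightarrow>
      (LINT t|lebesgue_on {0<..<T}. \<eta>' t * f t) = - (LINT t|lebesgue_on {0<..<T}. \<eta> t * g t)"
    and eq: "AE t in lebesgue_on {0<..<T}. f t = F t"
    and meas: "f \<in> borel_measurable (lebesgue_on {0<..<T})"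
    and cont: "continuous_on {a<..<b} F"
    and g: "AE t in lebesgue_on {0<..<T}. a < t \<longrightarrow> t < b \<longrightarrow> g t \<ge> 0"
    and ab: "0 \<le> a" "b \<le> T" "a < s" "s < t" "t < b"
  shows "F s \<le> F t"
proof (rule ccontr)
  assume "\<not> F s \<le> F t"
  \<comment> \<open>A level strictly between the two values: F stays above it just after s and below
    it just after t.\<close>
  define m where "m = (F s + F t) / 2"
  have m: "F t < m" "m < F s" using \<open>\<not> F s \<le> F t\<close> by (auto simp: m_def)
  have right: "\<exists>d>0. \<forall>x. r \<le> x \<and> x \<le> r + d \<longrightarrow> P (F x)"
    if r: "a < r" "r < b" and P: "open {y. P y}" "P (F r)" for r P
  proof -
    have "isCont F r" using cont r by (simp add: continuous_on_eq_continuous_at)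
    then have "eventually (\<lambda>x. P (F x)) (at r)"
      using P topological_tendstoD[of F "F r" "at r" "{y. P y}"] by (simp add: isCont_def)
    then obtain d where "d > 0" "\<And>x. x \<noteq> r \<Longrightarrow> dist x r < d \<Longrightarrow> P (F x)"
      by (auto simp: eventually_at)
    then have "P (F x)" if "r \<le> x" "x \<le> r + d / 2" for x
      using P(2) that \<open>d > 0\<close> by (cases "x = r") (auto simp: dist_real_def)
    then show ?thesis using \<open>d > 0\<close> by (intro exI[of _ "d / 2"]) auto
  qed
  obtain d1 where d1: "d1 > 0" "\<forall>x. s \<le> x \<and> x \<le> s + d1 \<longrightarrow> m < F x"
    using right[of s "\<lambda>y. m < y"] ab m by (auto simp: open_Collect_less)
  obtain d2 where d2: "d2 > 0" "\<forall>x. t \<le> x \<and> x \<le> t + d2 \<longrightarrow> F x < m"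
    using right[of t "\<lambda>y. y < m"] ab m by (auto simp: open_Collect_less)
  define \<epsilon> where "\<epsilon> = min (min d1 d2) ((b - t) / 2)"
  have \<epsilon>: "\<epsilon> > 0" "\<epsilon> \<le> d1" "\<epsilon> \<le> d2" "t + \<epsilon> < b" using d1 d2 ab by (auto simp: \<epsilon>_def field_simps min_def)
  obtain H \<rho> :: "real \<Rightarrow> real" where H: "smooth H" "smooth \<rho>"
    "\<And>x. (H has_real_derivative \<rho> x) (at x)" "\<And>x. \<rho> x \<ge> 0"
    "\<And>x. \<rho> x > 0 \<longleftrightarrow> 0 < x \<and> x < 1"
    "\<And>x. x \<le> 0 \<Longrightarrow> H x = 0" "\<And>x. x \<ge> 1 \<Longrightarrow> H x = 1" "mono H"
    by (rule smooth_step_exists) (rule that)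
  \<comment> \<open>The derivative is a positive bump on (s, s + \<epsilon>) minus an equal bump on
    (t, t + \<epsilon>).\<close>
  define \<eta> where "\<eta> x = H ((1 / \<epsilon>) * (x - s)) - H ((1 / \<epsilon>) * (x - t))" for x
  define \<eta>' where "\<eta>' x = (1 / \<epsilon>) * \<rho> ((1 / \<epsilon>) * (x - s)) - (1 / \<epsilon>) * \<rho> ((1 / \<epsilon>) * (x - t))" for x
  have deriv: "(\<eta> has_real_derivative \<eta>' x) (at x)" for x
  proof -
    have "((\<lambda>x. H ((1 / \<epsilon>) * (x - r))) has_real_derivative \<rho> ((1 / \<epsilon>) * (x - r)) * (1 / \<epsilon>)) (at x)" for r
      by (rule DERIV_chain2[OF H(3)]) (use \<epsilon>(1) in \<open>auto intro!: derivative_eq_intros\<close>)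
    then show ?thesis unfolding \<eta>_def[abs_def] \<eta>'_def
      by (intro DERIV_diff) (auto simp: mult.commute)
  qed
  have sm: "smooth \<eta>" unfolding \<eta>_def
    by (intro smooth_diff smooth_compose[OF H(1)] smooth_mult smooth_const smooth_real_id)
  have sm': "smooth \<eta>'" unfolding \<eta>'_def
    by (intro smooth_diff smooth_mult smooth_const smooth_compose[OF H(2)] smooth_real_id)
  have \<eta>_nonneg: "\<eta> x \<ge> 0" for x
    using monoD[OF H(8), of "(1 / \<epsilon>) * (x - t)" "(1 / \<epsilon>) * (x - s)"] ab \<epsilon>
    by (simp add: \<eta>_def divide_right_mono)
  have \<eta>_zero: "\<eta> x = 0" if "x \<notin> {s..t+\<epsilon>}" for x
  proof (cases "x < s")
    case True
    then show ?thesis using H(6)[of "(1 / \<epsilon>) * (x - s)"] H(6)[of "(1 / \<epsilon>) * (x - t)"] ab \<epsilon>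
      by (simp add: \<eta>_def divide_le_0_iff)
  next
    case False
    then show ?thesis using H(7)[of "(1 / \<epsilon>) * (x - s)"] H(7)[of "(1 / \<epsilon>) * (x - t)"] ab \<epsilon> that
      by (simp add: \<eta>_def)
  qed
  have \<rho>_zero: "\<rho> x = 0" if "\<not> (0 < x \<and> x < 1)" for x using H(4,5)[of x] that by linarith
  have \<eta>'_zero: "\<eta>' x = 0" if "x \<notin> {s..t+\<epsilon>}" for x
    using that \<rho>_zero[of "(1 / \<epsilon>) * (x - s)"] \<rho>_zero[of "(1 / \<epsilon>) * (x - t)"] ab \<epsilon>
    by (auto simp: \<eta>'_def zero_less_divide_iff divide_less_eq)
  have cl: "closure {x. \<eta> x \<noteq> 0} \<subseteq> {s..t+\<epsilon>}"
  proof (rule closure_minimal)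
    show "{x. \<eta> x \<noteq> 0} \<subseteq> {s..t+\<epsilon>}" using \<eta>_zero by blast
  qed simp
  then have "compact (closure {x. \<eta> x \<noteq> 0})"
    using compact_Int_closed[of "{s..t+\<epsilon>}" "closure {x. \<eta> x \<noteq> 0}"] by (simp add: Int_absorb1)
  moreover have "{s..t+\<epsilon>} \<subseteq> {0<..<T}" using ab \<epsilon> by auto
  ultimately have test: "\<eta> \<in> test_functions {0<..<T}"
    using sm cl by (auto simp: test_functions_def)
  \<comment> \<open>The integral of \<open>\<eta>'\<close> is 0, so the level \<open>m\<close> can
    be subtracted from F without changing the weak identity; the sign of F - m then matches that of
    \<open>\<eta>'\<close> in both windows.\<close>
  define w where "w x = \<eta>' x * (F x - m)" for x
  have w_nonneg: "w x \<ge> 0" for x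
  proof (cases "s < x \<and> x < s + \<epsilon>")
    case True
    \<comment> \<open>At a common point of the two windows F would lie on both sides of
      \<open>m\<close>, so at most one bump is active.\<close>
    then have "\<rho> ((1 / \<epsilon>) * (x - t)) = 0 \<or> t < x" using \<rho>_zero[of "(1 / \<epsilon>) * (x - t)"] \<epsilon>
      by (auto simp: zero_less_divide_iff)
    moreover have "\<not> t < x \<or> F x < m" using True d2 \<epsilon> ab by auto
    moreover have "m < F x" using True d1 \<epsilon> by auto
    ultimately have "\<rho> ((1 / \<epsilon>) * (x - t)) = 0" by auto
    then show ?thesis using H(4) \<open>m < F x\<close> \<epsilon> by (simp add: w_def \<eta>'_def)
  next
    case False
    then have "\<rho> ((1 / \<epsilon>) * (x - s)) = 0" using \<rho>_zero[of "(1 / \<epsilon>) * (x - s)"] \<epsilon>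
      by (auto simp: zero_less_divide_iff divide_less_eq)
    moreover have "\<rho> ((1 / \<epsilon>) * (x - t)) = 0 \<or> F x < m"
    proof (cases "t < x \<and> x < t + \<epsilon>")
      case True
      then show ?thesis using d2 \<epsilon> by auto
    next
      case False
      then show ?thesis using \<rho>_zero[of "(1 / \<epsilon>) * (x - t)"] \<epsilon>
        by (auto simp: zero_less_divide_iff divide_less_eq)
    qed
    moreover have "w x = (1 / \<epsilon>) * \<rho> ((1 / \<epsilon>) * (x - t)) * (m - F x)" if "\<rho> ((1 / \<epsilon>) * (x - s)) = 0"
      unfolding w_def \<eta>'_def that by (simp add: right_diff_distrib diff_divide_distrib)
    ultimately show ?thesis using H(4)[of "(1 / \<epsilon>) * (x - t)"] \<epsilon> by auto
  qed
  have F_cont: "continuous_on {s..t+\<epsilon>} F" using ab \<epsilon> by (intro continuous_on_subset[OF cont]) auto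
  have w_cont: "continuous_on {s..t+\<epsilon>} w" unfolding w_def
    by (intro continuous_intros F_cont smooth_continuous[OF sm'])
  \<comment> \<open>The first bump is strictly positive at the middle of its window. The second
    alternative would put t inside that window, where F is above \<open>m\<close>; it is refuted
    next.\<close>
  have w_pos: "w (s + \<epsilon> / 2) > 0 \<or> s + \<epsilon> / 2 > t"
  proof (cases "s + \<epsilon> / 2 > t")
    case False
    then have "\<rho> ((1 / \<epsilon>) * (s + \<epsilon> / 2 - t)) = 0" using \<epsilon> by (intro \<rho>_zero) (auto simp: zero_less_divide_iff)
    moreover have "\<rho> ((1 / \<epsilon>) * (s + \<epsilon> / 2 - s)) > 0" using H(5) \<epsilon> by simp
    moreover have "m < F (s + \<epsilon> / 2)" using d1 \<epsilon> by simp
    ultimately show ?thesis using \<epsilon> by (simp add: w_def \<eta>'_def)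
  qed simp
  have no: "\<not> s + \<epsilon> / 2 > t"
  proof
    assume "s + \<epsilon> / 2 > t"
    then have "m < F t" using d1 \<epsilon> ab by auto
    then show False using m by simp
  qed
  let ?I = "lebesgue_on {0<..<T}"
  \<comment> \<open>\<open>w\<close> and \<open>\<eta>'\<close> vanish off [s, t + \<epsilon>], so
    Lebesgue integrals over (0, T) become Henstock-Kurzweil integrals over a compact interval, to
    which the fundamental theorem and the vanishing criterion apply.\<close>
  have to_hk: "(LINT x|?I. q x) = integral {s..t+\<epsilon>} q" "integrable ?I q"
    if q: "continuous_on {s..t+\<epsilon>} q" "\<And>x. x \<notin> {s..t+\<epsilon>} \<Longrightarrow> q x = 0" for q :: "real \<Rightarrow> real"
  proof -
    have "integrable (lebesgue_on {s..t+\<epsilon>}) q"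
      by (rule continuous_imp_integrable_real[OF q(1)])
    then have "integrable lebesgue (\<lambda>x. indicator {s..t+\<epsilon>} x *\<^sub>R q x)"
      by (simp add: integrable_restrict_space)
    moreover have "indicator S x *\<^sub>R q x = q x" if "{s..t+\<epsilon>} \<subseteq> S" for S x
      using q(2)[of x] that by (cases "x \<in> {s..t+\<epsilon>}") auto
    then have "(\<lambda>x. indicator {s..t+\<epsilon>} x *\<^sub>R q x) = q" "(\<lambda>x. indicator {0<..<T} x *\<^sub>R q x) = q"
      using \<open>{s..t+\<epsilon>} \<subseteq> {0<..<T}\<close> by blast+
    ultimately show i: "integrable ?I q" by (simp add: integrable_restrict_space)
    have "integral {0<..<T} q = integral {s..t+\<epsilon>} q"
      by (rule integral_unique, rule has_integral_on_superset
          [OF integrable_integral[OF integrable_continuous_real[OF q(1)]] q(2) \<open>{s..t+\<epsilon>} \<subseteq> {0<..<T}\<close>])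
    then show "(LINT x|?I. q x) = integral {s..t+\<epsilon>} q"
      using lebesgue_integral_eq_integral[OF i] by simp
  qed
  have zero': "w x = 0" if "x \<notin> {s..t+\<epsilon>}" for x using \<eta>'_zero[OF that] by (simp add: w_def)
  have int\<eta>': "(LINT x|?I. \<eta>' x) = 0"
  proof -
    have "(\<eta>' has_integral (\<eta> (t + \<epsilon>) - \<eta> s)) {s..t+\<epsilon>}"
      by (rule fundamental_theorem_of_calculus)
        (use ab \<epsilon> deriv in \<open>auto simp: has_real_derivative_iff_has_vector_derivative[symmetric] intro: DERIV_subset\<close>)
    moreover have "\<eta> s = 0" using H(6)[of 0] H(6)[of "(1 / \<epsilon>) * (s - t)"] ab \<epsilon> by (simp add: \<eta>_def divide_le_0_iff)
    moreover have "\<eta> (t + \<epsilon>) = 0" using H(7)[of 1] H(7)[of "(1 / \<epsilon>) * (t + \<epsilon> - s)"] ab \<epsilon> by (simp add: \<eta>_def)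
    ultimately show ?thesis using to_hk(1)[OF smooth_continuous[OF sm'] \<eta>'_zero] by (simp add: integral_unique)
  qed
  have "(LINT x|?I. \<eta>' x * f x) = (LINT x|?I. w x + m * \<eta>' x)"
  proof (rule integral_cong_AE)
    show "AE x in ?I. \<eta>' x * f x = w x + m * \<eta>' x"
      using eq by eventually_elim (simp add: w_def algebra_simps)
    have [measurable]: "\<eta>' \<in> borel_measurable ?I" "w \<in> borel_measurable ?I"
      using to_hk(2)[OF smooth_continuous[OF sm'] \<eta>'_zero] to_hk(2)[OF w_cont zero'] by auto
    show "(\<lambda>x. \<eta>' x * f x) \<in> borel_measurable ?I" using meas by measurable
    show "(\<lambda>x. w x + m * \<eta>' x) \<in> borel_measurable ?I" by measurable
  qed
  also have "\<dots> = integral {s..t+\<epsilon>} w"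
    using to_hk[OF w_cont zero'] to_hk(2)[OF smooth_continuous[OF sm'] \<eta>'_zero] int\<eta>' by simp
  finally have "integral {s..t+\<epsilon>} w = - (LINT t|?I. \<eta> t * g t)" using weak[OF test deriv] by simp
  moreover have "(LINT x|?I. \<eta> x * g x) \<ge> 0"
  proof (rule integral_nonneg_AE)
    have "0 \<le> \<eta> x * g x" if "a < x \<longrightarrow> x < b \<longrightarrow> g x \<ge> 0" for x
      using that \<eta>_nonneg[of x] \<eta>_zero[of x] ab \<epsilon> by (cases "x \<in> {s..t+\<epsilon>}") auto
    then show "AE x in ?I. 0 \<le> \<eta> x * g x" using g by auto
  qed
  moreover have "integral {s..t+\<epsilon>} w \<ge> 0"
    using w_nonneg by (intro Henstock_Kurzweil_Integration.integral_nonneg integrable_continuous_real w_cont) auto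
  \<comment> \<open>A nonnegative continuous function with integral 0 vanishes everywhere on the
    interval, against its value at \<open>s + \<epsilon> / 2\<close>.\<close>
  ultimately have "integral {s..t+\<epsilon>} w = 0" by linarith
  then have "(w has_integral 0) (cbox s (t + \<epsilon>))"
    using integrable_integral[OF integrable_continuous_real[OF w_cont]] by simp
  moreover have "s + \<epsilon> / 2 \<in> cbox s (t + \<epsilon>)" "box s (t + \<epsilon>) \<noteq> {}" using ab \<epsilon> by (auto simp: box_ne_empty)
  ultimately have "w (s + \<epsilon> / 2) = 0"
    using has_integral_0_cbox_imp_0[of s "t + \<epsilon>" w] w_cont w_nonneg by simp
  with w_pos no show False by simp
qed

section \<open>Weak gradients\<close>

lemma test_function_gradient:
  assumes "\<xi> \<in> test_functions U"
  obtains G where "\<And>x. (\<xi> has_derivative (\<lambda>h. G x \<bullet> h)) (at x)" "continuous_on UNIV G"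
    "\<And>x. x \<notin> closure {x. \<xi> x \<noteq> 0} \<Longrightarrow> G x = 0"
    "\<And>x b. frechet_derivative \<xi> (at x) b = G x \<bullet> b"
proof -
  obtain G where G: "\<And>x. (\<xi> has_derivative (\<lambda>h. G x \<bullet> h)) (at x)" "continuous_on UNIV G"
    by (rule smooth_has_gradient[of \<xi>]) (use assms in \<open>auto simp: test_functions_def\<close>)
  show ?thesis
  proof (rule that[OF G])
    show "frechet_derivative \<xi> (at x) b = G x \<bullet> b" for x b
      using frechet_derivative_at[OF G(1)[of x]] by metis
    fix x assume x: "x \<notin> closure {x. \<xi> x \<noteq> 0}"
    have "((\<lambda>x. 0) has_derivative (\<lambda>h. G x \<bullet> h)) (at x)"
    proof (rule has_derivative_transform_within_open[OF G(1)])
      show "open (- closure {x. \<xi> x \<noteq> 0})" "x \<in> - closure {x. \<xi> x \<noteq> 0}" using x by auto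
      fix y assume "y \<in> - closure {x. \<xi> x \<noteq> 0}"
      then have "y \<notin> {x. \<xi> x \<noteq> 0}" using closure_subset[of "{x. \<xi> x \<noteq> 0}"] by auto
      then show "\<xi> y = 0" by simp
    qed
    then have "(\<lambda>h. G x \<bullet> h) = (\<lambda>h. 0)" by (rule has_derivative_unique) simp
    then have "G x \<bullet> G x = 0" by metis
    then show "G x = 0" by simp
  qed
qed

text \<open>By translation invariance the integrals of the difference quotients vanish.\<close>

lemma integral_partial_derivative_zero:
  fixes \<xi> :: "'a::euclidean_space \<Rightarrow> real"
  assumes \<xi>: "\<xi> \<in> test_functions UNIV" and G: "\<And>x. (\<xi> has_derivative (\<lambda>h. G x \<bullet> h)) (at x)"
    "continuous_on UNIV G" "\<And>x. x \<notin> closure {x. \<xi> x \<noteq> 0} \<Longrightarrow> G x = 0" and b: "b \<in> Basis"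
  shows "(LINT x|lborel. G x \<bullet> b) = 0"
proof -
  let ?K = "closure {x. \<xi> x \<noteq> 0}"
  have K: "compact ?K" and sm: "smooth \<xi>" using \<xi> by (auto simp: test_functions_def)
  have "bounded ?K" by (rule compact_imp_bounded[OF K])
  then obtain R where R: "\<And>x. x \<in> ?K \<Longrightarrow> norm x \<le> R" unfolding bounded_iff by blast
  have "compact ((\<lambda>x. G x \<bullet> b) ` ?K)"
    by (intro compact_continuous_image continuous_intros continuous_on_subset[OF G(2)] K) auto
  then obtain C0 where C0: "\<And>x. x \<in> ?K \<Longrightarrow> \<bar>G x \<bullet> b\<bar> \<le> C0"
    using compact_imp_bounded[of "(\<lambda>x. G x \<bullet> b) ` ?K"] by (auto simp: bounded_iff)
  define C where "C = max C0 0"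
  have C: "\<bar>G x \<bullet> b\<bar> \<le> C" for x
    using C0[of x] G(3)[of x] by (cases "x \<in> ?K") (auto simp: C_def)
  have \<xi>0: "\<xi> x = 0" if "norm x > R" for x
  proof (rule ccontr)
    assume "\<xi> x \<noteq> 0"
    then have "x \<in> ?K" by (intro subsetD[OF closure_subset]) simp
    then show False using R that by fastforce
  qed
  define D where "D n x = real (Suc n) * (\<xi> (x + (1 / real (Suc n)) *\<^sub>R b) - \<xi> x)" for n x
  \<comment> \<open>The mean value theorem bounds all difference quotients by one constant, which
    the dominated convergence below uses.\<close>
  have lip: "\<bar>\<xi> (x + s *\<^sub>R b) - \<xi> x\<bar> \<le> C * s" if "s > 0" for x s
  proof -
    have "\<bar>\<xi> (x + s *\<^sub>R b) - \<xi> (x + 0 *\<^sub>R b)\<bar> \<le> C * \<bar>s - 0\<bar>"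
    proof (rule field_differentiable_bound[of UNIV "\<lambda>t. \<xi> (x + t *\<^sub>R b)" "\<lambda>t. G (x + t *\<^sub>R b) \<bullet> b", unfolded real_norm_def])
      fix t
      have "((\<lambda>t. x + t *\<^sub>R b) has_derivative (\<lambda>h. h *\<^sub>R b)) (at t)"
        by (auto intro!: derivative_eq_intros)
      from has_derivative_compose[OF this G(1)]
      show "((\<lambda>t. \<xi> (x + t *\<^sub>R b)) has_field_derivative G (x + t *\<^sub>R b) \<bullet> b) (at t within UNIV)"
        by (simp add: has_field_derivative_def mult_commute_abs)
    qed (use C in auto)
    then show ?thesis using that by simp
  qed
  have meas: "\<xi> \<in> borel_measurable borel" using smooth_continuous[OF sm] by (rule borel_measurable_continuous_onI)
  have measG: "(\<lambda>x. G x \<bullet> b) \<in> borel_measurable borel"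
    by (intro borel_measurable_continuous_onI continuous_intros G(2))
  obtain B where B: "\<And>x. \<bar>\<xi> x\<bar> \<le> B" using test_function_bounded[OF \<xi>] by blast
  have B0: "B \<ge> 0" using B[of 0] by linarith
  have int_cball: "integrable lborel (\<lambda>x::'a. c * indicator (cball 0 r) x)" for c r :: real
    by (intro integrable_mult_right integrable_real_indicator) (use emeasure_bounded_finite[OF bounded_cball, of "0::'a" r] in auto)
  have int\<xi>: "integrable lborel \<xi>"
  proof (rule Bochner_Integration.integrable_bound[OF int_cball[of B R]])
    show "AE x in lborel. norm (\<xi> x) \<le> norm (B * indicator (cball 0 R) x)"
      using B \<xi>0 B0 by (intro AE_I2) (auto split: split_indicator)
  qed (use meas in simp)
  have int_shift: "integrable lborel (\<lambda>x. \<xi> (x + y))" "(LINT x|lborel. \<xi> (x + y)) = (LINT x|lborel. \<xi> x)" for y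
  proof -
    have "integrable (distr lborel borel ((+) y)) \<xi>" using int\<xi> by (simp add: lborel_distr_plus)
    then show "integrable lborel (\<lambda>x. \<xi> (x + y))"
      by (subst (asm) integrable_distr_eq) (use meas in \<open>auto simp: add.commute\<close>)
    have "(LINT x|distr lborel borel ((+) y). \<xi> x) = (LINT x|lborel. \<xi> (y + x))"
      by (rule integral_distr) (use meas in auto)
    then show "(LINT x|lborel. \<xi> (x + y)) = (LINT x|lborel. \<xi> x)" by (simp add: lborel_distr_plus add.commute)
  qed
  have D0: "(LINT x|lborel. D n x) = 0" for n
    unfolding D_def using int_shift int\<xi> by simp
  have "(\<lambda>n. LINT x|lborel. D n x) \<longlonglongrightarrow> (LINT x|lborel. G x \<bullet> b)"
  \<comment> \<open>The shifts have length at most 1, so all difference quotients vanish outside the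
    ball of radius R + 1.\<close>
  proof (rule integral_dominated_convergence[OF _ _ int_cball[of C "R + 1"]])
    show "(\<lambda>x. G x \<bullet> b) \<in> borel_measurable lborel" using measG by simp
    show "D n \<in> borel_measurable lborel" for n unfolding D_def
      using borel_measurable_integrable[OF int_shift(1)] meas by simp
    show "AE x in lborel. (\<lambda>n. D n x) \<longlonglongrightarrow> G x \<bullet> b"
    proof (rule AE_I2)
      fix x
      have "((\<lambda>t. x + t *\<^sub>R b) has_derivative (\<lambda>h. h *\<^sub>R b)) (at 0)"
        by (auto intro!: derivative_eq_intros)
      from has_derivative_compose[OF this G(1)]
      have "((\<lambda>t. \<xi> (x + t *\<^sub>R b)) has_field_derivative G x \<bullet> b) (at 0)"
        by (simp add: has_field_derivative_def mult_commute_abs)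
      then have lim: "((\<lambda>h. (\<xi> (x + h *\<^sub>R b) - \<xi> x) / h) \<longlongrightarrow> G x \<bullet> b) (at 0)" by (simp add: DERIV_def)
      have "filterlim (\<lambda>n. 1 / real (Suc n)) (at 0) sequentially"
        unfolding filterlim_at using LIMSEQ_inverse_real_of_nat by (simp add: inverse_eq_divide)
      from filterlim_compose[OF lim this] show "(\<lambda>n. D n x) \<longlonglongrightarrow> G x \<bullet> b"
        by (simp add: D_def mult.commute)
    qed
    show "AE x in lborel. norm (D n x) \<le> C * indicator (cball 0 (R + 1)) x" for n
    proof (rule AE_I2)
      fix x
      have "\<bar>D n x\<bar> \<le> real (Suc n) * (C * (1 / real (Suc n)))"
        unfolding D_def abs_mult
        by (rule mult_mono) (use lip[of "1 / real (Suc n)" x] in \<open>auto simp del: of_nat_Suc\<close>)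
      then have le: "\<bar>D n x\<bar> \<le> C" by simp
      show "norm (D n x) \<le> C * indicator (cball 0 (R + 1)) x"
      proof (cases "norm x \<le> R + 1")
        case False
        have "norm x \<le> norm (x + (1 / real (Suc n)) *\<^sub>R b) + norm ((1 / real (Suc n)) *\<^sub>R b)"
          using norm_triangle_ineq4[of "x + (1 / real (Suc n)) *\<^sub>R b" "(1 / real (Suc n)) *\<^sub>R b"] by simp
        moreover have "norm ((1 / real (Suc n)) *\<^sub>R b) \<le> 1" using b by simp
        ultimately have "norm (x + (1 / real (Suc n)) *\<^sub>R b) > R" using False by linarith
        then show ?thesis using \<xi>0[of x] \<xi>0[of "x + (1 / real (Suc n)) *\<^sub>R b"] False by (simp add: D_def C_def)
      qed (use le in auto)
    qed
  qed
  then show ?thesis by (simp add: D0 LIMSEQ_const_iff)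
qed

lemma (in essentially_borel) sq_integrable_continuous:
  fixes f :: "'a \<Rightarrow> 'v::euclidean_space"
  assumes "continuous_on UNIV f" "bounded (space M)"
  shows "sq_integrable M f"
proof -
  have "compact (f ` closure (space M))"
    by (intro compact_continuous_image continuous_on_subset[OF assms(1)]) (use assms(2) in auto)
  then obtain b where "\<And>x. x \<in> closure (space M) \<Longrightarrow> norm (f x) \<le> b"
    using compact_imp_bounded[of "f ` closure (space M)"] by (auto simp: bounded_iff)
  then show ?thesis
    using closure_subset[of "space M"] assms(1)
    by (intro sq_integrable_bounded borel_measurable_continuous) auto
qed

text \<open>The assumption \<open>surface\<close> is later derived from the C1 boundary and the
  positive mass of a boundary part; stated here, it keeps the Sobolev part free of geometry.\<close>

locale bounded_domain =
  fixes \<Omega> :: "'a::euclidean_space set"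
  assumes open_domain: "open \<Omega>" and bounded_dom: "bounded \<Omega>"
    and surface: "essentially_borel (surface_on (frontier \<Omega>))"
begin

abbreviation "L\<Omega> \<equiv> lebesgue_on \<Omega>"
abbreviation "\<sigma> \<equiv> surface_on (frontier \<Omega>)"

sublocale dom: essentially_borel L\<Omega>
  using open_domain bounded_dom by (intro essentially_borel_lebesgue_on) auto

sublocale bd: essentially_borel \<sigma>
  by (rule surface)

lemma space_L\<Omega> [simp]: "space L\<Omega> = \<Omega>" by simp

lemma bounded_space_\<sigma>: "bounded (space \<sigma>)"
  by (rule bounded_subset[OF bounded_closure[OF bounded_dom]]) (auto simp: surface_on_def space_restrict_space frontier_def)

lemma test_function_partial:
  assumes "\<xi> \<in> test_functions \<Omega>"
  shows "sq_integrable L\<Omega> (\<lambda>x. frechet_derivative \<xi> (at x) b)"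
proof -
  obtain G where G: "continuous_on UNIV G" "\<And>x. frechet_derivative \<xi> (at x) b = G x \<bullet> b"
    by (rule test_function_gradient[OF assms]) (rule that)
  then show ?thesis
    unfolding G(2) using bounded_dom by (intro dom.sq_integrable_continuous continuous_intros) auto
qed

lemma weak_grad_sq_integrable: "has_weak_grad \<Omega> w G \<Longrightarrow> sq_integrable L\<Omega> G"
  by (simp add: has_weak_grad_def sq_integrable_def)

lemma integrable_weak_grad_test:
  assumes "has_weak_grad \<Omega> w G" "\<xi> \<in> test_functions \<Omega>"
  shows "integrable L\<Omega> (\<lambda>x. (G x \<bullet> b) * \<xi> x)"
  using sq_integrable_inner[OF sq_integrable_component[OF weak_grad_sq_integrable[OF assms(1)]]
      dom.test_function_sq_integrable[OF assms(2)]] by simp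

text \<open>Each component of the difference is orthogonal to all test functions.
  \<open>wgrad\<close> is an arbitrary choice, and this uniqueness is what makes it linear up to
  null sets.\<close>

lemma weak_grad_unique:
  assumes "has_weak_grad \<Omega> w G1" "has_weak_grad \<Omega> w G2"
  shows "AE x in L\<Omega>. G1 x = G2 x"
proof -
  have "AE x in L\<Omega>. \<forall>b\<in>Basis. (G1 x - G2 x) \<bullet> b = 0"
  proof (rule AE_finite_allI)
    fix b :: 'a assume b: "b \<in> Basis"
    show "AE x in L\<Omega>. (G1 x - G2 x) \<bullet> b = 0"
    proof (rule dom.AE_zero_of_test_integrals[OF _ open_domain])
      have "sq_integrable L\<Omega> (\<lambda>x. 1::real)" by (simp add: sq_integrable_def)
      from sq_integrable_inner[OF sq_integrable_component[OF sq_integrable_diff[OF assms[THEN weak_grad_sq_integrable]]] this]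
      show "integrable L\<Omega> (\<lambda>x. (G1 x - G2 x) \<bullet> b)" by simp
      fix \<xi> assume \<xi>: "\<xi> \<in> test_functions \<Omega>"
      have "(LINT x|L\<Omega>. (G1 x \<bullet> b) * \<xi> x) = (LINT x|L\<Omega>. (G2 x \<bullet> b) * \<xi> x)"
      proof -
        have "- (LINT x|L\<Omega>. (G1 x \<bullet> b) * \<xi> x) = - (LINT x|L\<Omega>. (G2 x \<bullet> b) * \<xi> x)"
          using assms \<xi> b unfolding has_weak_grad_def by simp
        then show ?thesis by simp
      qed
      then show "(LINT x|L\<Omega>. (G1 x - G2 x) \<bullet> b * \<xi> x) = 0"
        using integrable_weak_grad_test[OF assms(1) \<xi>] integrable_weak_grad_test[OF assms(2) \<xi>]
        by (simp add: inner_diff_left left_diff_distrib)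
    qed simp
  qed simp
  then show ?thesis by eventually_elim (rule euclidean_eqI, simp add: inner_diff_left)
qed

lemma has_weak_grad_lin:
  assumes "w1 \<in> L2 L\<Omega>" "w2 \<in> L2 L\<Omega>" "has_weak_grad \<Omega> w1 G1" "has_weak_grad \<Omega> w2 G2"
  shows "has_weak_grad \<Omega> (\<lambda>x. a * w1 x + b * w2 x) (\<lambda>x. a *\<^sub>R G1 x + b *\<^sub>R G2 x)"
proof -
  have "(LINT x|L\<Omega>. (a * w1 x + b * w2 x) * frechet_derivative \<xi> (at x) e)
      = - (LINT x|L\<Omega>. ((a *\<^sub>R G1 x + b *\<^sub>R G2 x) \<bullet> e) * \<xi> x)"
    if \<xi>: "\<xi> \<in> test_functions \<Omega>" and e: "e \<in> Basis" for \<xi> e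
  proof -
    have i: "integrable L\<Omega> (\<lambda>x. w x * frechet_derivative \<xi> (at x) e)" if "w \<in> L2 L\<Omega>" for w
      using sq_integrable_inner[OF that[unfolded L2_eq_sq_integrable] test_function_partial[OF \<xi>]] by simp
    have "(LINT x|L\<Omega>. (a * w1 x + b * w2 x) * frechet_derivative \<xi> (at x) e)
      = (LINT x|L\<Omega>. a * (w1 x * frechet_derivative \<xi> (at x) e) + b * (w2 x * frechet_derivative \<xi> (at x) e))"
      by (simp add: algebra_simps)
    also have "\<dots> = a * (LINT x|L\<Omega>. w1 x * frechet_derivative \<xi> (at x) e) + b * (LINT x|L\<Omega>. w2 x * frechet_derivative \<xi> (at x) e)"
      using i assms by simp
    also have "\<dots> = a * - (LINT x|L\<Omega>. (G1 x \<bullet> e) * \<xi> x) + b * - (LINT x|L\<Omega>. (G2 x \<bullet> e) * \<xi> x)"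
      using assms(3,4) \<xi> e unfolding has_weak_grad_def by simp
    also have "\<dots> = - (LINT x|L\<Omega>. a * ((G1 x \<bullet> e) * \<xi> x) + b * ((G2 x \<bullet> e) * \<xi> x))"
      using integrable_weak_grad_test[OF assms(3) \<xi>] integrable_weak_grad_test[OF assms(4) \<xi>] by simp
    also have "(\<lambda>x. a * ((G1 x \<bullet> e) * \<xi> x) + b * ((G2 x \<bullet> e) * \<xi> x)) = (\<lambda>x. ((a *\<^sub>R G1 x + b *\<^sub>R G2 x) \<bullet> e) * \<xi> x)"
      by (simp add: inner_add_left algebra_simps)
    finally show ?thesis .
  qed
  then show ?thesis
    using sq_integrable_lin[OF assms(3,4)[THEN weak_grad_sq_integrable], of a b]
    unfolding has_weak_grad_def sq_integrable_def by blast
qed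

text \<open>Multiplication by a test function gives compact support, and the vanishing integral of
  the derivative of the product is integration by parts. This places the smooth approximants of
  \<open>has_trace\<close> in H1.\<close>

lemma smooth_has_weak_grad:
  assumes "smooth f"
  obtains G where "has_weak_grad \<Omega> f G"
proof -
  obtain G where G: "\<And>x. (f has_derivative (\<lambda>h. G x \<bullet> h)) (at x)" "continuous_on UNIV G"
    using assms by (rule smooth_has_gradient) (rule that)
  have cf: "continuous_on UNIV f" by (rule smooth_continuous[OF assms])
  have "sq_integrable L\<Omega> G" by (rule dom.sq_integrable_continuous[OF G(2)]) (simp add: bounded_dom)
  moreover have "(LINT x|L\<Omega>. f x * frechet_derivative \<xi> (at x) b) = - (LINT x|L\<Omega>. (G x \<bullet> b) * \<xi> x)"
    if \<xi>: "\<xi> \<in> test_functions \<Omega>" and b: "b \<in> Basis" for \<xi> b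
  proof -
    obtain D where D: "\<And>x. (\<xi> has_derivative (\<lambda>h. D x \<bullet> h)) (at x)" "continuous_on UNIV D"
      "\<And>x. x \<notin> closure {x. \<xi> x \<noteq> 0} \<Longrightarrow> D x = 0" "\<And>x b. frechet_derivative \<xi> (at x) b = D x \<bullet> b"
      by (rule test_function_gradient[OF \<xi>]) (rule that)
    let ?\<psi> = "\<lambda>x. f x * \<xi> x"
    let ?E = "\<lambda>x. f x *\<^sub>R D x + \<xi> x *\<^sub>R G x"
    have sub: "closure {x. ?\<psi> x \<noteq> 0} \<subseteq> closure {x. \<xi> x \<noteq> 0}" by (rule closure_mono) auto
    have comp: "compact (closure {x. \<xi> x \<noteq> 0})" "closure {x. \<xi> x \<noteq> 0} \<subseteq> \<Omega>" and sm\<xi>: "smooth \<xi>"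
      using \<xi> by (auto simp: test_functions_def)
    have "compact (closure {x. ?\<psi> x \<noteq> 0})"
      using compact_Int_closed[OF comp(1) closed_closure, of "{x. ?\<psi> x \<noteq> 0}"] sub by (simp only: Int_absorb1)
    then have \<psi>: "?\<psi> \<in> test_functions UNIV"
      using smooth_mult[OF assms sm\<xi>] by (simp add: test_functions_def)
    have E: "(?\<psi> has_derivative (\<lambda>h. ?E x \<bullet> h)) (at x)" for x
      using has_derivative_mult[OF G(1) D(1), of x] by (simp add: inner_add_left mult.commute)
    have cE: "continuous_on UNIV ?E"
      by (intro continuous_intros cf D(2) G(2) smooth_continuous[OF sm\<xi>])
    \<comment> \<open>A second gradient of the product, known to vanish off the support, is
      identified with the explicit one by uniqueness of derivatives.\<close>
    obtain E' where E': "\<And>x. (?\<psi> has_derivative (\<lambda>h. E' x \<bullet> h)) (at x)"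
      "\<And>x. x \<notin> closure {x. ?\<psi> x \<noteq> 0} \<Longrightarrow> E' x = 0"
      by (rule test_function_gradient[OF \<psi>]) (rule that)
    have "?E x = E' x" for x
    proof -
      have "(\<lambda>h. ?E x \<bullet> h) = (\<lambda>h. E' x \<bullet> h)" by (rule has_derivative_unique[OF E E'(1)])
      then have "(?E x - E' x) \<bullet> (?E x - E' x) = 0" unfolding inner_diff_left by (simp add: fun_eq_iff)
      then show ?thesis by simp
    qed
    then have E0: "?E x = 0" if "x \<notin> closure {x. ?\<psi> x \<noteq> 0}" for x using E'(2)[OF that] by simp
    have E0': "indicator \<Omega> x *\<^sub>R (?E x \<bullet> b) = ?E x \<bullet> b" for x
    proof (cases "x \<in> \<Omega>")
      case False
      then have "?E x = 0" using sub comp by (intro E0) blast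
      then show ?thesis using False by simp
    qed simp
    have "(LINT x|lborel. ?E x \<bullet> b) = 0"
      by (rule integral_partial_derivative_zero[OF \<psi> E cE E0 b])
    moreover have "(LINT x|L\<Omega>. ?E x \<bullet> b) = (LINT x|lebesgue. indicator \<Omega> x *\<^sub>R (?E x \<bullet> b))"
      by (rule integral_restrict_space) (use open_domain in simp)
    then have "(LINT x|L\<Omega>. ?E x \<bullet> b) = (LINT x|lebesgue. ?E x \<bullet> b)"
      unfolding E0' .
    moreover have "(LINT x|lebesgue. ?E x \<bullet> b) = (LINT x|lborel. ?E x \<bullet> b)"
    proof (rule integral_completion)
      have "(\<lambda>x. ?E x \<bullet> b) \<in> borel_measurable borel"
        by (intro borel_measurable_continuous_onI continuous_on_inner cE continuous_on_const)
      then show "(\<lambda>x. ?E x \<bullet> b) \<in> borel_measurable lborel" by simp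
    qed
    ultimately have "(LINT x|L\<Omega>. ?E x \<bullet> b) = 0" by simp
    moreover have "integrable L\<Omega> (\<lambda>x. f x * (D x \<bullet> b))" "integrable L\<Omega> (\<lambda>x. (G x \<bullet> b) * \<xi> x)"
      using sq_integrable_inner[of L\<Omega> f "\<lambda>x. D x \<bullet> b"] sq_integrable_inner[of L\<Omega> "\<lambda>x. G x \<bullet> b" \<xi>]
        dom.sq_integrable_continuous[OF cf] dom.sq_integrable_continuous[OF D(2), THEN sq_integrable_component]
        dom.sq_integrable_continuous[OF G(2), THEN sq_integrable_component]
        dom.sq_integrable_continuous[OF smooth_continuous[OF sm\<xi>]] bounded_dom by auto
    moreover have "(\<lambda>x. ?E x \<bullet> b) = (\<lambda>x. f x * (D x \<bullet> b) + (G x \<bullet> b) * \<xi> x)"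
      by (auto simp: inner_add_left mult.commute)
    ultimately show ?thesis by (simp add: D(4))
  qed
  ultimately have "has_weak_grad \<Omega> f G" by (auto simp: has_weak_grad_def sq_integrable_def)
  then show ?thesis by (rule that)
qed

lemma wgrad: "w \<in> H1 \<Omega> \<Longrightarrow> has_weak_grad \<Omega> w (wgrad \<Omega> w)"
  unfolding H1_def wgrad_def using someI_ex[of "has_weak_grad \<Omega> w"] by simp

lemma H1_sq_integrable: "w \<in> H1 \<Omega> \<Longrightarrow> sq_integrable L\<Omega> w"
  and H1_wgrad_sq_integrable: "w \<in> H1 \<Omega> \<Longrightarrow> sq_integrable L\<Omega> (wgrad \<Omega> w)"
  using wgrad weak_grad_sq_integrable by (auto simp: H1_def L2_eq_sq_integrable)

lemma H1_lin: "w1 \<in> H1 \<Omega> \<Longrightarrow> w2 \<in> H1 \<Omega> \<Longrightarrow> (\<lambda>x. a * w1 x + b * w2 x) \<in> H1 \<Omega>"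
  unfolding H1_def L2_eq_sq_integrable
  using has_weak_grad_lin sq_integrable_lin[of L\<Omega> w1 w2 a b] by (fastforce simp: L2_eq_sq_integrable)

lemma smooth_H1: "smooth f \<Longrightarrow> f \<in> H1 \<Omega>"
  using smooth_has_weak_grad dom.sq_integrable_continuous[OF smooth_continuous, of f] bounded_dom
  by (fastforce simp: H1_def L2_eq_sq_integrable)

lemma wgrad_lin:
  assumes "w1 \<in> H1 \<Omega>" "w2 \<in> H1 \<Omega>"
  shows "AE x in L\<Omega>. wgrad \<Omega> (\<lambda>x. a * w1 x + b * w2 x) x = a *\<^sub>R wgrad \<Omega> w1 x + b *\<^sub>R wgrad \<Omega> w2 x"
proof (rule weak_grad_unique[OF wgrad[OF H1_lin[OF assms]]])
  show "has_weak_grad \<Omega> (\<lambda>x. a * w1 x + b * w2 x) (\<lambda>x. a *\<^sub>R wgrad \<Omega> w1 x + b *\<^sub>R wgrad \<Omega> w2 x)"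
    using assms by (intro has_weak_grad_lin wgrad) (auto simp: H1_def)
qed

lemma grad_norm_power2: "(grad_norm \<Omega> w)\<^sup>2 = (LINT x|L\<Omega>. (norm (wgrad \<Omega> w x))\<^sup>2)"
  by (simp add: grad_norm_def Lnorm_2_power2)

lemma grad_norm_lin_eq:
  assumes "w1 \<in> H1 \<Omega>" "w2 \<in> H1 \<Omega>"
  shows "(grad_norm \<Omega> (\<lambda>x. a * w1 x + b * w2 x))\<^sup>2 = (LINT x|L\<Omega>. (norm (a *\<^sub>R wgrad \<Omega> w1 x + b *\<^sub>R wgrad \<Omega> w2 x))\<^sup>2)"
  unfolding grad_norm_power2
proof (rule integral_cong_AE)
  show "AE x in L\<Omega>. (norm (wgrad \<Omega> (\<lambda>x. a * w1 x + b * w2 x) x))\<^sup>2 = (norm (a *\<^sub>R wgrad \<Omega> w1 x + b *\<^sub>R wgrad \<Omega> w2 x))\<^sup>2"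
    using wgrad_lin[OF assms, of a b] by eventually_elim simp
qed (use H1_wgrad_sq_integrable[OF H1_lin[OF assms]] sq_integrable_lin[OF assms[THEN H1_wgrad_sq_integrable]] in
    \<open>auto simp: sq_integrable_def intro: borel_measurable_integrable\<close>)

lemma grad_norm_lin:
  assumes "w1 \<in> H1 \<Omega>" "w2 \<in> H1 \<Omega>"
  shows "(grad_norm \<Omega> (\<lambda>x. a * w1 x + b * w2 x))\<^sup>2 \<le> 2 * a\<^sup>2 * (grad_norm \<Omega> w1)\<^sup>2 + 2 * b\<^sup>2 * (grad_norm \<Omega> w2)\<^sup>2"
  unfolding grad_norm_lin_eq[OF assms] unfolding grad_norm_power2
  by (intro integral_norm_lin_bound assms[THEN H1_wgrad_sq_integrable])

lemma grad_norm_scale: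
  assumes "w \<in> H1 \<Omega>"
  shows "(grad_norm \<Omega> (\<lambda>x. a * w x))\<^sup>2 = a\<^sup>2 * (grad_norm \<Omega> w)\<^sup>2"
  using grad_norm_lin_eq[OF assms assms, of a 0] by (simp add: grad_norm_power2 power_mult_distrib)

section \<open>Traces\<close>

lemma H1_norm_power2: "(H1_norm \<Omega> w)\<^sup>2 = (LINT x|L\<Omega>. (w x)\<^sup>2) + (grad_norm \<Omega> w)\<^sup>2"
  by (simp add: H1_norm_def Lnorm_2_power2)

lemma H1_norm_tendsto_zero_iff:
  "((\<lambda>s. H1_norm \<Omega> (w s)) \<longlongrightarrow> 0) F \<longleftrightarrow>
    ((\<lambda>s. LINT x|L\<Omega>. (w s x)\<^sup>2) \<longlongrightarrow> 0) F \<and> ((\<lambda>s. (grad_norm \<Omega> (w s))\<^sup>2) \<longlongrightarrow> 0) F"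
  by (subst tendsto_power2_zero_iff[symmetric]) (simp add: H1_norm_power2 tendsto_add_zero_iff)

text \<open>With squared norms, every estimate on the approximating sequences becomes an estimate on
  integrals.\<close>

lemma has_trace_iff:
  "has_trace \<Omega> w g \<longleftrightarrow> w \<in> H1 \<Omega> \<and> sq_integrable \<sigma> g \<and>
    (\<exists>\<phi>. (\<forall>k::nat. smooth (\<phi> k)) \<and> (\<lambda>k. LINT x|L\<Omega>. (\<phi> k x - w x)\<^sup>2) \<longlonglongrightarrow> 0 \<and>
      (\<lambda>k. (grad_norm \<Omega> (\<lambda>x. \<phi> k x - w x))\<^sup>2) \<longlonglongrightarrow> 0 \<and> (\<lambda>k. LINT x|\<sigma>. (\<phi> k x - g x)\<^sup>2) \<longlonglongrightarrow> 0)"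
  unfolding has_trace_def H1_norm_tendsto_zero_iff L2_eq_sq_integrable
  by (subst tendsto_power2_zero_iff[symmetric]) (simp add: Lnorm_2_power2 conj_assoc)

text \<open>The approximating sequences are combined with the same coefficients; all three squared
  errors obey the same quadratic bound.\<close>

lemma has_trace_lin:
  assumes "has_trace \<Omega> w1 g1" "has_trace \<Omega> w2 g2"
  shows "has_trace \<Omega> (\<lambda>x. a * w1 x + b * w2 x) (\<lambda>x. a * g1 x + b * g2 x)"
proof -
  from assms(1) obtain \<phi>1 where 1: "w1 \<in> H1 \<Omega>" "sq_integrable \<sigma> g1" "\<And>k::nat. smooth (\<phi>1 k)"
    "(\<lambda>k. LINT x|L\<Omega>. (\<phi>1 k x - w1 x)\<^sup>2) \<longlonglongrightarrow> 0"
    "(\<lambda>k. (grad_norm \<Omega> (\<lambda>x. \<phi>1 k x - w1 x))\<^sup>2) \<longlonglongrightarrow> 0" "(\<lambda>k. LINT x|\<sigma>. (\<phi>1 k x - g1 x)\<^sup>2) \<longlonglongrightarrow> 0"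
    unfolding has_trace_iff by blast
  from assms(2) obtain \<phi>2 where 2: "w2 \<in> H1 \<Omega>" "sq_integrable \<sigma> g2" "\<And>k::nat. smooth (\<phi>2 k)"
    "(\<lambda>k. LINT x|L\<Omega>. (\<phi>2 k x - w2 x)\<^sup>2) \<longlonglongrightarrow> 0"
    "(\<lambda>k. (grad_norm \<Omega> (\<lambda>x. \<phi>2 k x - w2 x))\<^sup>2) \<longlonglongrightarrow> 0" "(\<lambda>k. LINT x|\<sigma>. (\<phi>2 k x - g2 x)\<^sup>2) \<longlonglongrightarrow> 0"
    unfolding has_trace_iff by blast
  let ?\<phi> = "\<lambda>k x. a * \<phi>1 k x + b * \<phi>2 k x"
  have squeeze: "X \<longlonglongrightarrow> 0" if "\<And>k. 0 \<le> X k" "\<And>k. X k \<le> 2 * a\<^sup>2 * Y k + 2 * b\<^sup>2 * Z k" "Y \<longlonglongrightarrow> 0" "Z \<longlonglongrightarrow> 0"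
    for X Y Z :: "nat \<Rightarrow> real"
  proof (rule tendsto_sandwich[OF _ _ tendsto_const])
    have "(\<lambda>k. 2 * a\<^sup>2 * Y k + 2 * b\<^sup>2 * Z k) \<longlonglongrightarrow> 2 * a\<^sup>2 * 0 + 2 * b\<^sup>2 * 0" by (intro tendsto_intros that)
    then show "(\<lambda>k. 2 * a\<^sup>2 * Y k + 2 * b\<^sup>2 * Z k) \<longlonglongrightarrow> 0" by simp
  qed (use that in auto)
  have rw: "a * f1 x + b * f2 x - (a * h1 x + b * h2 x) = a * (f1 x - h1 x) + b * (f2 x - h2 x)" for f1 f2 h1 h2 and x :: 'a
    by (simp add: algebra_simps)
  have sq: "sq_integrable M f \<Longrightarrow> sq_integrable M h \<Longrightarrow>
      (LINT x|M. (a * f x + b * h x)\<^sup>2) \<le> 2 * a\<^sup>2 * (LINT x|M. (f x)\<^sup>2) + 2 * b\<^sup>2 * (LINT x|M. (h x)\<^sup>2)"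
    for M :: "'a measure" and f h :: "'a \<Rightarrow> real"
    using integral_norm_lin_bound[of M f h a b] by simp
  have d: "\<And>k. (\<lambda>x. \<phi>1 k x - w1 x) \<in> H1 \<Omega>" "\<And>k. (\<lambda>x. \<phi>2 k x - w2 x) \<in> H1 \<Omega>"
    using H1_lin[OF smooth_H1[OF 1(3)] 1(1), where a = 1 and b = "-1"]
      H1_lin[OF smooth_H1[OF 2(3)] 2(1), where a = 1 and b = "-1"] by auto
  have s: "sq_integrable \<sigma> (\<phi>1 k)" "sq_integrable \<sigma> (\<phi>2 k)" for k
    by (intro bd.sq_integrable_continuous smooth_continuous 1(3) 2(3) bounded_space_\<sigma>)+
  show ?thesis unfolding has_trace_iff
  proof (intro conjI exI[of _ ?\<phi>] allI)
    show "(\<lambda>x. a * w1 x + b * w2 x) \<in> H1 \<Omega>" by (rule H1_lin[OF 1(1) 2(1)])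
    show "sq_integrable \<sigma> (\<lambda>x. a * g1 x + b * g2 x)" using sq_integrable_lin[OF 1(2) 2(2), of a b] by simp
    show "smooth (?\<phi> k)" for k by (intro smooth_add smooth_mult smooth_const 1(3) 2(3))
    show "(\<lambda>k. LINT x|L\<Omega>. (?\<phi> k x - (a * w1 x + b * w2 x))\<^sup>2) \<longlonglongrightarrow> 0"
      unfolding rw by (rule squeeze[OF _ sq 1(4) 2(4)]) (use d H1_sq_integrable in auto)
    show "(\<lambda>k. (grad_norm \<Omega> (\<lambda>x. ?\<phi> k x - (a * w1 x + b * w2 x)))\<^sup>2) \<longlonglongrightarrow> 0"
      unfolding rw by (rule squeeze[OF _ grad_norm_lin 1(5) 2(5)]) (use d in auto)
    show "(\<lambda>k. LINT x|\<sigma>. (?\<phi> k x - (a * g1 x + b * g2 x))\<^sup>2) \<longlonglongrightarrow> 0"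
      unfolding rw by (rule squeeze[OF _ sq 1(6) 2(6)]) (use sq_integrable_diff[OF s(1) 1(2)] sq_integrable_diff[OF s(2) 2(2)] in auto)
  qed
qed

lemma has_weak_grad_cong:
  assumes "AE x in L\<Omega>. w x = w' x" "w \<in> borel_measurable L\<Omega>" "w' \<in> borel_measurable L\<Omega>"
  shows "has_weak_grad \<Omega> w = has_weak_grad \<Omega> w'"
proof -
  have "(LINT x|L\<Omega>. w x * frechet_derivative \<xi> (at x) b) = (LINT x|L\<Omega>. w' x * frechet_derivative \<xi> (at x) b)"
    if "\<xi> \<in> test_functions \<Omega>" for \<xi> b
  proof (rule integral_cong_AE)
    show "AE x in L\<Omega>. w x * frechet_derivative \<xi> (at x) b = w' x * frechet_derivative \<xi> (at x) b"
      using assms(1) by eventually_elim simp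
  qed (use assms test_function_partial[OF that, of b] in \<open>auto simp: sq_integrable_def\<close>)
  then show ?thesis by (intro ext) (simp add: has_weak_grad_def)
qed

text \<open>The equality is literal, not only almost everywhere, because the choice operator is
  applied to the same predicate on both sides.\<close>

lemma wgrad_cong:
  assumes "AE x in L\<Omega>. w x = w' x" "w \<in> borel_measurable L\<Omega>" "w' \<in> borel_measurable L\<Omega>"
  shows "wgrad \<Omega> w = wgrad \<Omega> w'"
  unfolding wgrad_def has_weak_grad_cong[OF assms] ..

lemma grad_norm_cong:
  assumes "AE x in L\<Omega>. w x = w' x" "w \<in> borel_measurable L\<Omega>" "w' \<in> borel_measurable L\<Omega>"
  shows "grad_norm \<Omega> w = grad_norm \<Omega> w'"
  unfolding grad_norm_def wgrad_cong[OF assms] ..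

lemma J_cong:
  assumes "AE x in L\<Omega>. w x = w' x" "w \<in> borel_measurable L\<Omega>" "w' \<in> borel_measurable L\<Omega>"
  shows "J \<Omega> p w = J \<Omega> p w'" "K \<Omega> p w = K \<Omega> p w'"
  using grad_norm_cong[OF assms] Lnorm_cong[OF assms, of p] by (auto simp: J_def K_def)

lemma has_trace_cong:
  assumes "AE x in L\<Omega>. w x = w' x" "w \<in> H1 \<Omega>" "w' \<in> H1 \<Omega>"
  shows "has_trace \<Omega> w = has_trace \<Omega> w'"
proof -
  have "H1_norm \<Omega> (\<lambda>x. \<phi> x - w x) = H1_norm \<Omega> (\<lambda>x. \<phi> x - w' x)" if "smooth \<phi>" for \<phi>
  proof -
    have m: "(\<lambda>x. \<phi> x - w x) \<in> borel_measurable L\<Omega>" "(\<lambda>x. \<phi> x - w' x) \<in> borel_measurable L\<Omega>"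
      using smooth_H1[OF that] assms(2,3) by (auto simp: H1_def L2_def)
    have e: "AE x in L\<Omega>. \<phi> x - w x = \<phi> x - w' x" using assms(1) by eventually_elim simp
    show ?thesis unfolding H1_norm_def grad_norm_cong[OF e m] Lnorm_cong[OF e m] ..
  qed
  then show ?thesis using assms(2,3) by (intro ext) (auto simp: has_trace_def)
qed

lemma zero_has_trace: "has_trace \<Omega> (\<lambda>x. 0) (\<lambda>x. 0)"
proof -
  have "has_weak_grad \<Omega> (\<lambda>x. 0) (\<lambda>x. 0)" by (simp add: has_weak_grad_def)
  then have H: "(\<lambda>x. 0) \<in> H1 \<Omega>" by (auto simp: H1_def L2_def)
  have "(grad_norm \<Omega> (\<lambda>x. 0))\<^sup>2 = 0" using grad_norm_scale[OF H, of 0] by simp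
  then show ?thesis unfolding has_trace_iff
    by (auto simp: H sq_integrable_def intro!: exI[of _ "\<lambda>k x. 0"] smooth_const)
qed

end

section \<open>Finiteness of the surface measure\<close>

text \<open>If \<open>m\<close>-dimensional Hausdorff outer measure were not a measure on the Borel sets,
  then \<^const>\<open>measure_of\<close> would yield the zero measure.\<close>

lemma emeasure_hausdorff_measure:
  fixes A B :: "'a::euclidean_space set"
  assumes "emeasure (hausdorff_measure m) A \<noteq> 0" "B \<in> sets borel"
  shows "emeasure (hausdorff_measure m) B = hausdorff_outer m B"
proof -
  have conv: "emeasure (hausdorff_measure m :: 'a measure) = (\<lambda>B. if B \<in> sigma_sets UNIV (sets borel) \<and>
      measure_space UNIV (sigma_sets UNIV (sets borel)) (hausdorff_outer m :: 'a set \<Rightarrow> _) then hausdorff_outer m B else 0)"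
    unfolding hausdorff_measure_def emeasure_measure_of_conv ..
  then have "measure_space UNIV (sigma_sets UNIV (sets borel)) (hausdorff_outer m :: 'a set \<Rightarrow> _)"
    using assms(1) by (metis (no_types, lifting))
  moreover have "B \<in> sigma_sets UNIV (sets borel)" using assms(2) by (rule sigma_sets.Basic)
  ultimately show ?thesis by (simp add: conv)
qed

lemma sets_hausdorff_measure [simp]: "sets (hausdorff_measure m) = sets borel"
  and space_hausdorff_measure [simp]: "space (hausdorff_measure m) = UNIV"
  unfolding hausdorff_measure_def
  using sets.sigma_sets_eq[of borel] by (auto simp: space_measure_of_conv)

text \<open>A Lipschitz graph over a hyperplane is cut along a grid of mesh \<open>1 / N\<close> in the hyperplane;
  there are of order \<open>N ^ (n - 1)\<close> cells, each of diameter of order \<open>1 / N\<close>.\<close>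

lemma hausdorff_outer_Lipschitz_graph_finite:
  fixes S :: "'a::euclidean_space set"
  assumes S: "bounded S" and e: "norm e = 1"
    and lip: "\<And>x y. x \<in> S \<Longrightarrow> y \<in> S \<Longrightarrow>
      \<bar>x \<bullet> e - y \<bullet> e\<bar> \<le> \<Lambda> * norm ((x - (x \<bullet> e) *\<^sub>R e) - (y - (y \<bullet> e) *\<^sub>R e))" and \<Lambda>: "\<Lambda> \<ge> 0"
  shows "hausdorff_outer (DIM('a) - 1) S < \<infinity>"
proof -
  define m where "m = DIM('a) - 1"
  have "e \<noteq> 0" using e by auto
  have "subspace {x. e \<bullet> x = 0}" by (rule subspace_hyperplane)
  then obtain B where B: "B \<subseteq> {x. e \<bullet> x = 0}" "pairwise orthogonal B" "\<And>x. x \<in> B \<Longrightarrow> norm x = 1"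
    "independent B" "card B = dim {x. e \<bullet> x = 0}" "span B = {x. e \<bullet> x = 0}"
    by (rule orthonormal_basis_subspace) (rule that)
  have finB: "finite B" using B(4) by (rule independent_imp_finite)
  have cardB: "card B = m" using B(5) dim_hyperplane[OF \<open>e \<noteq> 0\<close>] by (simp add: m_def)
  obtain R0 where R0: "\<And>x. x \<in> S \<Longrightarrow> norm x \<le> R0" using S by (auto simp: bounded_iff)
  obtain R :: nat where R: "R0 \<le> real R" using real_arch_simple by blast
  \<comment> \<open>On the graph the component along \<open>e\<close> is controlled by the
    hyperplane component, so the hyperplane coordinates alone bound the distance.\<close>
  have dist_bound: "norm (x - y) \<le> (1 + \<Lambda>) * (\<Sum>b\<in>B. \<bar>(x - y) \<bullet> b\<bar>)" if xy: "x \<in> S" "y \<in> S" for x y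
  proof -
    define v where "v = (x - (x \<bullet> e) *\<^sub>R e) - (y - (y \<bullet> e) *\<^sub>R e)"
    have ee: "e \<bullet> e = 1" using e by (simp add: norm_eq_1)
    have "v \<in> span B" unfolding B(6) v_def by (simp add: inner_diff_right ee inner_commute)
    then have "(\<Sum>b\<in>B. (v \<bullet> b) *\<^sub>R b) = v" using B finB by (intro orthonormal_basis_expand) auto
    moreover have "v \<bullet> b = (x - y) \<bullet> b" if "b \<in> B" for b
      using that B(1) by (auto simp: v_def inner_diff_left)
    ultimately have "norm v \<le> (\<Sum>b\<in>B. \<bar>(x - y) \<bullet> b\<bar>)"
      using norm_sum[of "\<lambda>b. (v \<bullet> b) *\<^sub>R b" B] B(3) by simp
    moreover have "norm (x - y) \<le> norm v + \<bar>x \<bullet> e - y \<bullet> e\<bar>"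
    proof -
      have "x - y = v + (x \<bullet> e - y \<bullet> e) *\<^sub>R e" by (simp add: v_def algebra_simps)
      then show ?thesis using norm_triangle_ineq[of v "(x \<bullet> e - y \<bullet> e) *\<^sub>R e"] e by simp
    qed
    moreover have "\<bar>x \<bullet> e - y \<bullet> e\<bar> \<le> \<Lambda> * norm v" using lip[OF xy] by (simp add: v_def)
    ultimately have "norm (x - y) \<le> (1 + \<Lambda>) * norm v" "norm v \<le> (\<Sum>b\<in>B. \<bar>(x - y) \<bullet> b\<bar>)"
      by (auto simp: algebra_simps)
    then show ?thesis using \<Lambda> by (meson add_increasing mult_left_mono order_trans zero_le_one)
  qed
  \<comment> \<open>Within a cell each of the \<open>m\<close> coordinates varies by at most 1 / N,
    so c / N bounds the diameter.\<close>
  define c where "c = (1 + \<Lambda>) * real m"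
  have c: "c \<ge> 0" using \<Lambda> by (simp add: c_def)
  \<comment> \<open>There are (2 N R + 1)^m cells and 2 N R + 1 \<le> (2 R + 1) N, so the powers of
    N cancel against those of the diameters and the bound does not depend on \<delta>.\<close>
  define W where "W = unit_ball_vol (real m) * ((2 * real R + 1) * (c / 2)) ^ m"
  have "(INF C\<in>{C :: nat \<Rightarrow> 'a set. S \<subseteq> (\<Union>i. C i) \<and> (\<forall>i. bounded (C i) \<and> diameter (C i) \<le> \<delta>)}.
        \<Sum>i. if C i = {} then 0 else ennreal (unit_ball_vol (real m) * (diameter (C i) / 2) ^ m)) \<le> ennreal W"
    if \<delta>: "\<delta> > 0" for \<delta>
  proof -
    obtain N0 :: nat where N0: "c / \<delta> \<le> real N0" using real_arch_simple by blast
    define N where "N = Suc N0"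
    have N: "N > 0" "c / real N \<le> \<delta>"
    proof -
      have "c / \<delta> \<le> real N" using N0 by (simp add: N_def)
      then show "c / real N \<le> \<delta>" using \<delta> by (simp add: N_def field_simps)
    qed (simp add: N_def)
    \<comment> \<open>Cells are labelled by the integer parts of the coordinates scaled by N;
      coordinates bounded by R keep the labels between -N R and N R.\<close>
    define Keys where "Keys = PiE B (\<lambda>_. {- int (N * R) .. int (N * R)})"
    have fK: "finite Keys" unfolding Keys_def using finB by (intro finite_PiE) auto
    have cK: "card Keys = (2 * N * R + 1) ^ m"
      using finB by (simp add: Keys_def card_PiE cardB nat_add_distrib nat_mult_distrib)
         (simp add: algebra_simps)
    define cell where "cell k = {x \<in> S. \<forall>b\<in>B. \<lfloor>real N * (x \<bullet> b)\<rfloor> = k b}" for k :: "'a \<Rightarrow> int"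
    have cell_diam: "norm (x - y) \<le> c / real N" if "x \<in> cell k" "y \<in> cell k" for x y k
    proof -
      have "\<bar>(x - y) \<bullet> b\<bar> \<le> 1 / real N" if b: "b \<in> B" for b
      proof -
        have "\<lfloor>real N * (x \<bullet> b)\<rfloor> = \<lfloor>real N * (y \<bullet> b)\<rfloor>" using \<open>x \<in> cell k\<close> \<open>y \<in> cell k\<close> b by (simp add: cell_def)
        then have "\<bar>real N * (x \<bullet> b) - real N * (y \<bullet> b)\<bar> \<le> 1" by linarith
        then have "real N * \<bar>(x - y) \<bullet> b\<bar> \<le> 1"
          by (simp add: inner_diff_left right_diff_distrib[symmetric] abs_mult)
        then show ?thesis using N by (simp add: field_simps)
      qed
      then have "(\<Sum>b\<in>B. \<bar>(x - y) \<bullet> b\<bar>) \<le> real m * (1 / real N)"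
        using sum_bounded_above[of B "\<lambda>b. \<bar>(x - y) \<bullet> b\<bar>" "1 / real N"] by (simp add: cardB)
      then have "(1 + \<Lambda>) * (\<Sum>b\<in>B. \<bar>(x - y) \<bullet> b\<bar>) \<le> (1 + \<Lambda>) * (real m * (1 / real N))"
        using \<Lambda> by (intro mult_left_mono) auto
      then show ?thesis using dist_bound[of x y] that by (simp add: cell_def c_def)
    qed
    have cell_cover: "S \<subseteq> (\<Union>k\<in>Keys. cell k)"
    proof
      fix x assume x: "x \<in> S"
      let ?k = "\<lambda>b\<in>B. \<lfloor>real N * (x \<bullet> b)\<rfloor>"
      have "?k \<in> Keys" unfolding Keys_def
      proof (rule restrict_PiE_iff[THEN iffD2], rule ballI)
        fix b assume b: "b \<in> B"
        have "\<bar>x \<bullet> b\<bar> \<le> real R" using Cauchy_Schwarz_ineq2[of x b] B(3)[OF b] R0[OF x] R by simp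
        then have "real N * \<bar>x \<bullet> b\<bar> \<le> real N * real R" by (rule mult_left_mono) simp
        then have "\<bar>real N * (x \<bullet> b)\<bar> \<le> real (N * R)" by (simp add: abs_mult)
        then show "\<lfloor>real N * (x \<bullet> b)\<rfloor> \<in> {- int (N * R)..int (N * R)}"
          by (simp add: le_floor_iff floor_le_iff abs_le_iff)
      qed
      moreover have "x \<in> cell ?k" using x by (simp add: cell_def)
      ultimately show "x \<in> (\<Union>k\<in>Keys. cell k)" by blast
    qed
    obtain h where h: "bij_betw h {0..<card Keys} Keys" using ex_bij_betw_nat_finite[OF fK] by blast
    define C where "C i = (if i < card Keys then cell (h i) else {})" for i
    have diamC: "diameter (C i) \<le> c / real N" for i
    proof (rule diameter_le)
      show "norm (x - y) \<le> c / real N" if "x \<in> C i" "y \<in> C i" for x y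
        using that cell_diam[of x "h i" y] by (simp add: C_def split: if_splits)
    qed (use c in simp)
    have bdC: "bounded (C i)" for i
      by (rule bounded_subset[OF S]) (auto simp: C_def cell_def)
    have "S \<subseteq> (\<Union>i. C i)"
    proof
      fix x assume "x \<in> S"
      then obtain k where k: "k \<in> Keys" "x \<in> cell k" using cell_cover by blast
      then have "k \<in> h ` {0..<card Keys}" using bij_betw_imp_surj_on[OF h] by simp
      then obtain i where "i < card Keys" "h i = k" by auto
      then have "x \<in> C i" using k by (simp add: C_def)
      then show "x \<in> (\<Union>i. C i)" by blast
    qed
    moreover have "bounded (C i) \<and> diameter (C i) \<le> \<delta>" for i
      using bdC diamC[of i] N by simp
    ultimately have C: "C \<in> {C. S \<subseteq> (\<Union>i. C i) \<and> (\<forall>i. bounded (C i) \<and> diameter (C i) \<le> \<delta>)}" by blast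
    have "(\<Sum>i. if C i = {} then 0 else ennreal (unit_ball_vol (real m) * (diameter (C i) / 2) ^ m))
        = (\<Sum>i<card Keys. if C i = {} then 0 else ennreal (unit_ball_vol (real m) * (diameter (C i) / 2) ^ m))"
      by (rule suminf_finite) (auto simp: C_def)
    also have "\<dots> \<le> (\<Sum>i<card Keys. ennreal (unit_ball_vol (real m) * (c / real N / 2) ^ m))"
    proof (rule sum_mono)
      fix i
      have "(diameter (C i) / 2) ^ m \<le> (c / real N / 2) ^ m"
        using diamC[of i] diameter_ge_0[OF bdC[of i]] by (intro power_mono divide_right_mono) auto
      then show "(if C i = {} then 0 else ennreal (unit_ball_vol (real m) * (diameter (C i) / 2) ^ m))
          \<le> ennreal (unit_ball_vol (real m) * (c / real N / 2) ^ m)"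
        by (auto intro!: ennreal_leI mult_left_mono)
    qed
    also have "\<dots> = ennreal (real (card Keys) * (unit_ball_vol (real m) * (c / real N / 2) ^ m))"
      using c by (simp add: ennreal_mult'' ennreal_of_nat_eq_real_of_nat)
    also have "\<dots> \<le> ennreal W"
    proof (rule ennreal_leI)
      have "(2 * real N * real R + 1) \<le> (2 * real R + 1) * real N" using N by (simp add: algebra_simps)
      then have "(2 * real N * real R + 1) * (c / real N / 2) \<le> (2 * real R + 1) * real N * (c / real N / 2)"
        using c by (intro mult_right_mono) auto
      also have "\<dots> = (2 * real R + 1) * (c / 2)" using N by simp
      finally have "((2 * real N * real R + 1) * (c / real N / 2)) ^ m \<le> ((2 * real R + 1) * (c / 2)) ^ m"
        using c by (intro power_mono) auto
      then have "unit_ball_vol (real m) * ((2 * real N * real R + 1) * (c / real N / 2)) ^ m \<le> W"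
        unfolding W_def by (rule mult_left_mono) simp
      moreover have "real (card Keys) = (2 * real N * real R + 1) ^ m" by (simp add: cK add.commute)
      ultimately show "real (card Keys) * (unit_ball_vol (real m) * (c / real N / 2) ^ m) \<le> W"
        by (simp only: power_mult_distrib mult.left_commute)
    qed
    finally show ?thesis by (rule INF_lower2[OF C])
  qed
  then have "hausdorff_outer m S \<le> ennreal W"
    unfolding hausdorff_outer_def by (intro SUP_least) auto
  then show ?thesis unfolding m_def by (simp add: less_top top_unique) (metis ennreal_less_top infinity_ennreal_def le_less_trans less_top)
qed

lemma C1_Lipschitz_on_cball:
  fixes \<gamma> :: "'a::euclidean_space \<Rightarrow> real"
  assumes "Ck 1 \<gamma>"
  obtains \<Lambda> where "\<Lambda> \<ge> 0" "\<And>x y. x \<in> cball 0 \<rho> \<Longrightarrow> y \<in> cball 0 \<rho> \<Longrightarrow> \<bar>\<gamma> x - \<gamma> y\<bar> \<le> \<Lambda> * norm (x - y)"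
proof -
  from assms obtain G where G: "\<And>x. (\<gamma> has_derivative (\<lambda>h. G x \<bullet> h)) (at x)"
    "\<forall>b\<in>Basis. continuous_on UNIV (\<lambda>x. G x \<bullet> b)" by auto
  have "continuous_on UNIV (\<lambda>x. \<Sum>b\<in>Basis. (G x \<bullet> b) *\<^sub>R b)"
    by (intro continuous_on_sum continuous_on_scaleR continuous_on_const) (use G(2) in auto)
  then have cG: "continuous_on UNIV G" by (simp add: euclidean_representation)
  have "compact (G ` cball 0 \<rho>)" by (intro compact_continuous_image continuous_on_subset[OF cG]) auto
  then obtain \<Lambda> where \<Lambda>: "\<And>x. x \<in> cball 0 \<rho> \<Longrightarrow> norm (G x) \<le> \<Lambda>"
    using compact_imp_bounded[of "G ` cball 0 \<rho>"] unfolding bounded_iff by blast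
  show ?thesis
  proof (rule that[of "max \<Lambda> 0"])
    fix x y :: 'a assume xy: "x \<in> cball 0 \<rho>" "y \<in> cball 0 \<rho>"
    have "norm (\<gamma> x - \<gamma> y) \<le> max \<Lambda> 0 * norm (x - y)"
    proof (rule differentiable_bound[OF convex_cball _ _ xy])
      fix z :: 'a assume z: "z \<in> cball 0 \<rho>"
      show "(\<gamma> has_derivative (\<lambda>h. G z \<bullet> h)) (at z within cball 0 \<rho>)"
        by (rule has_derivative_at_withinI[OF G(1)])
      show "onorm (\<lambda>h. G z \<bullet> h) \<le> max \<Lambda> 0"
      proof (rule onorm_le)
        fix h
        have "norm (G z \<bullet> h) \<le> norm (G z) * norm h" using Cauchy_Schwarz_ineq2[of "G z" h] by simp
        also have "\<dots> \<le> max \<Lambda> 0 * norm h" using \<Lambda>[OF z] by (intro mult_right_mono) auto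
        finally show "norm (G z \<bullet> h) \<le> max \<Lambda> 0 * norm h" .
      qed
    qed
    then show "\<bar>\<gamma> x - \<gamma> y\<bar> \<le> max \<Lambda> 0 * norm (x - y)" by simp
  qed simp
qed

text \<open>A frontier point in the ball lies on the graph: above the graph it would belong to the
  open set \<open>\<Omega>\<close>, and below it has a neighbourhood free of
  \<open>\<Omega>\<close>. Over a bounded set the graph of a C1 function is Lipschitz.\<close>

lemma frontier_piece_hausdorff_finite:
  fixes \<Omega> :: "'a::euclidean_space set"
  assumes "open \<Omega>" and e: "norm e = 1" and \<gamma>: "Ck 1 \<gamma>"
    and graph: "\<Omega> \<inter> ball x0 r = {x \<in> ball x0 r. \<gamma> (x - (x \<bullet> e) *\<^sub>R e) < x \<bullet> e}"
  shows "hausdorff_outer (DIM('a) - 1) (frontier \<Omega> \<inter> ball x0 r) < \<infinity>"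
proof -
  define q where "q x = x \<bullet> e - \<gamma> (x - (x \<bullet> e) *\<^sub>R e)" for x
  have "continuous_on UNIV (\<lambda>x. \<gamma> (x - (x \<bullet> e) *\<^sub>R e))"
    by (rule continuous_on_compose2[OF Ck_continuous[OF \<gamma>]]) (auto intro!: continuous_intros)
  then have cq: "continuous_on UNIV q" unfolding q_def by (intro continuous_intros)
  have on_graph: "x \<bullet> e = \<gamma> (x - (x \<bullet> e) *\<^sub>R e)" if x: "x \<in> frontier \<Omega>" "x \<in> ball x0 r" for x
  proof -
    have "\<not> q x > 0"
    proof
      assume "q x > 0"
      then have "x \<in> \<Omega>" using x graph by (auto simp: q_def)
      then show False using x \<open>open \<Omega>\<close> by (simp add: frontier_def interior_open)
    qed
    moreover have "\<not> q x < 0"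
    proof
      assume "q x < 0"
      have "open (ball x0 r \<inter> {x. q x < 0})"
        by (intro open_Int open_ball open_Collect_less cq continuous_on_const)
      moreover have "\<not> q y < 0" if "y \<in> \<Omega>" "y \<in> ball x0 r" for y
      proof -
        have "y \<in> {x \<in> ball x0 r. \<gamma> (x - (x \<bullet> e) *\<^sub>R e) < x \<bullet> e}" using that graph by blast
        then show ?thesis by (simp add: q_def)
      qed
      then have "(ball x0 r \<inter> {x. q x < 0}) \<inter> \<Omega> = {}" by blast
      ultimately have "(ball x0 r \<inter> {x. q x < 0}) \<inter> closure \<Omega> = {}"
        using open_Int_closure_eq_empty by blast
      then show False using x \<open>q x < 0\<close> by (auto simp: frontier_def)
    qed
    ultimately show ?thesis by (simp add: q_def)
  qed
  \<comment> \<open>The projection of x has norm at most the norm of x plus the absolute value of x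
    \<bullet> e, hence at most twice the norm of x.\<close>
  define \<rho> where "\<rho> = 2 * (norm x0 + r)"
  have proj: "x - (x \<bullet> e) *\<^sub>R e \<in> cball 0 \<rho>" if "x \<in> ball x0 r" for x
  proof -
    have "norm x \<le> norm x0 + r" using that norm_triangle_ineq2[of x x0] by (simp add: dist_norm norm_minus_commute)
    moreover have "norm (x - (x \<bullet> e) *\<^sub>R e) \<le> norm x + \<bar>x \<bullet> e\<bar>" using norm_triangle_ineq4[of x "(x \<bullet> e) *\<^sub>R e"] e by simp
    moreover have "\<bar>x \<bullet> e\<bar> \<le> norm x" using Cauchy_Schwarz_ineq2[of x e] e by simp
    ultimately show ?thesis by (simp add: \<rho>_def)
  qed
  obtain \<Lambda> where \<Lambda>: "\<Lambda> \<ge> 0" "\<And>x y. x \<in> cball 0 \<rho> \<Longrightarrow> y \<in> cball 0 \<rho> \<Longrightarrow> \<bar>\<gamma> x - \<gamma> y\<bar> \<le> \<Lambda> * norm (x - y)"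
    using C1_Lipschitz_on_cball[OF \<gamma>] by blast
  show ?thesis
  proof (rule hausdorff_outer_Lipschitz_graph_finite[OF _ e _ \<Lambda>(1)])
    show "bounded (frontier \<Omega> \<inter> ball x0 r)" by (rule bounded_subset[OF bounded_ball]) auto
    fix x y assume "x \<in> frontier \<Omega> \<inter> ball x0 r" "y \<in> frontier \<Omega> \<inter> ball x0 r"
    then show "\<bar>x \<bullet> e - y \<bullet> e\<bar> \<le> \<Lambda> * norm ((x - (x \<bullet> e) *\<^sub>R e) - (y - (y \<bullet> e) *\<^sub>R e))"
      using \<Lambda>(2)[OF proj proj, of x y] on_graph[of x] on_graph[of y] by simp
  qed
qed

text \<open>The frontier is compact, so finitely many graph pieces cover it and their finite masses
  add up. The positive mass of a boundary part certifies that the measure agrees with the outer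
  measure on Borel sets.\<close>

lemma essentially_borel_surface:
  fixes \<Omega> :: "'a::euclidean_space set"
  assumes \<Omega>: "open \<Omega>" "bounded \<Omega>" "C1_boundary \<Omega>" and pos: "emeasure (surface_on (frontier \<Omega>)) \<Gamma> > 0"
    and \<Gamma>: "\<Gamma> \<subseteq> frontier \<Omega>"
  shows "essentially_borel (surface_on (frontier \<Omega>))"
proof (intro essentially_borel.intro finite_measureI essentially_borel_axioms.intro)
  define HM where "HM = (hausdorff_measure (DIM('a) - 1) :: 'a measure)"
  have s: "sets HM = sets borel" "space HM = UNIV" by (auto simp: HM_def)
  have \<sigma>: "surface_on (frontier \<Omega>) = restrict_space HM (frontier \<Omega>)" by (simp add: surface_on_def HM_def)
  have F: "frontier \<Omega> \<in> sets borel" "compact (frontier \<Omega>)"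
    using frontier_closed \<Omega>(2) by (auto intro: compact_frontier_bounded)
  have em: "emeasure (surface_on (frontier \<Omega>)) A = emeasure HM A" if "A \<subseteq> frontier \<Omega>" for A
    unfolding \<sigma> using F that s by (intro emeasure_restrict_space) auto
  have HM: "emeasure HM B = hausdorff_outer (DIM('a) - 1) B" if "B \<in> sets borel" for B
    unfolding HM_def by (rule emeasure_hausdorff_measure[OF _ that, of _ \<Gamma>]) (use pos em[OF \<Gamma>] in \<open>auto simp: HM_def\<close>)
  have "\<forall>x\<in>frontier \<Omega>. \<exists>r>0. hausdorff_outer (DIM('a) - 1) (frontier \<Omega> \<inter> ball x r) < \<infinity>"
    using \<Omega>(3) frontier_piece_hausdorff_finite[OF \<Omega>(1)] unfolding C1_boundary_def by meson
  then obtain r where r: "\<And>x. x \<in> frontier \<Omega> \<Longrightarrow> r x > 0 \<and> hausdorff_outer (DIM('a) - 1) (frontier \<Omega> \<inter> ball x (r x)) < \<infinity>"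
    by metis
  then have "frontier \<Omega> \<subseteq> (\<Union>x\<in>frontier \<Omega>. ball x (r x))" by force
  then obtain D where D: "D \<subseteq> frontier \<Omega>" "finite D" "frontier \<Omega> \<subseteq> (\<Union>x\<in>D. ball x (r x))"
    using compactE_image[OF F(2), of "frontier \<Omega>" "\<lambda>x. ball x (r x)"] by auto
  have "emeasure HM (frontier \<Omega>) = emeasure HM (\<Union>x\<in>D. frontier \<Omega> \<inter> ball x (r x))"
    using D(3) by (intro arg_cong[of _ _ "emeasure HM"]) auto
  also have "\<dots> \<le> (\<Sum>x\<in>D. emeasure HM (frontier \<Omega> \<inter> ball x (r x)))"
    using F by (intro emeasure_subadditive_finite D) (auto simp: s)
  also have "\<dots> < \<infinity>" 
  proof -
    have "emeasure HM (frontier \<Omega> \<inter> ball x (r x)) < \<infinity>" if "x \<in> D" for x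
      using r[of x] D(1) that F by (subst HM) auto
    then show ?thesis using D(2) by (simp add: less_top)
  qed
  finally show "emeasure (surface_on (frontier \<Omega>)) (space (surface_on (frontier \<Omega>))) \<noteq> \<infinity>"
    using em[of "frontier \<Omega>"] by (simp add: \<sigma> s space_restrict_space)
  have "(\<lambda>x. x) \<in> measurable HM borel" using s by (simp add: measurable_def)
  then show "(\<lambda>x. x) \<in> borel_measurable (surface_on (frontier \<Omega>))"
    unfolding \<sigma> by (rule measurable_restrict_space1)
  fix A assume "A \<in> sets (surface_on (frontier \<Omega>))"
  then have "A \<in> sets borel" using F by (auto simp: \<sigma> sets_restrict_space s)
  then show "\<exists>B\<in>sets borel. AE x in surface_on (frontier \<Omega>). x \<in> A \<longleftrightarrow> x \<in> B" by auto
qed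

text \<open>All boundary integrals over \<open>\<Gamma>1\<close> can thus be taken against the one
  measure on the frontier, with an indicator.\<close>

lemma surface_on_subset:
  fixes f :: "'a::euclidean_space \<Rightarrow> real"
  assumes "\<Gamma> \<in> sets borel" "\<Gamma> \<subseteq> F" "F \<in> sets borel"
  shows "(LINT x|surface_on \<Gamma>. f x) = (LINT x|surface_on F. f x * indicator \<Gamma> x)"
proof -
  have "indicator \<Gamma> x *\<^sub>R f x = indicator F x *\<^sub>R (f x * indicator \<Gamma> x)" for x
    using assms(2) by (auto simp: indicator_def)
  then show ?thesis unfolding surface_on_def
    using assms by (simp only: integral_restrict_space sets_hausdorff_measure space_hausdorff_measure Int_UNIV_right)
qed

section \<open>The potential well\<close>

locale well_problem = bounded_domain \<Omega> for \<Omega> :: "'a::euclidean_space set" +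
  fixes \<Gamma>0 \<Gamma>1 :: "'a set" and p :: real
  assumes \<Gamma>1_borel: "\<Gamma>1 \<in> sets borel" and \<Gamma>1_frontier: "\<Gamma>1 \<subseteq> frontier \<Omega>"
    and poincare: "poincare_inequality \<Omega> \<Gamma>0 \<Gamma>1" and p: "2 < p"
begin

abbreviation "V \<equiv> H1_zero_on \<Omega> \<Gamma>0"

definition dirichlet :: "('a \<Rightarrow> real) \<Rightarrow> real" where "dirichlet w = (grad_norm \<Omega> w)\<^sup>2"

definition p_mass :: "('a \<Rightarrow> real) \<Rightarrow> real" where "p_mass w = (LINT x|L\<Omega>. \<bar>w x\<bar> powr p)"

text \<open>Cut off to \<open>\<Gamma>1\<close> but kept as a function on the whole boundary, so
  that it lives on the same measure space as \<open>zt\<close>.\<close>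

definition bdry :: "('a \<Rightarrow> real) \<Rightarrow> 'a \<Rightarrow> real" where
  "bdry w x = trace_of \<Omega> w x * indicator \<Gamma>1 x"

text \<open>This is the quantity y of the introductory remarks.\<close>

definition l2_mass :: "('a \<Rightarrow> real) \<Rightarrow> real" where
  "l2_mass w = (LINT x|L\<Omega>. (w x)\<^sup>2) + (LINT x|\<sigma>. (bdry w x)\<^sup>2)"

lemma Gamma1_sets: "\<Gamma>1 \<in> sets \<sigma>"
  using \<Gamma>1_borel \<Gamma>1_frontier by (auto simp: surface_on_def sets_restrict_space)

lemma surface_on_Gamma1:
  "(LINT x|surface_on \<Gamma>1. f x) = (LINT x|\<sigma>. f x * indicator \<Gamma>1 x)" for f :: "'a \<Rightarrow> real"
  by (rule surface_on_subset[OF \<Gamma>1_borel \<Gamma>1_frontier]) (simp add: frontier_closed borel_closed)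

lemma J_eq: "J \<Omega> p w = dirichlet w / 2 - p_mass w / p"
  and K_eq: "K \<Omega> p w = dirichlet w - p_mass w"
  using p by (simp_all add: J_def K_def dirichlet_def p_mass_def Lnorm_powr)

text \<open>Here 1/2 - 1/p = (p - 2) / (2p) produces the coefficient that occurs in
  \<open>B2\<close> and in the bound on the well depth.\<close>

lemma J_eq_K: "J \<Omega> p w = (p - 2) / (2 * p) * dirichlet w + K \<Omega> p w / p"
  using p by (simp add: J_eq K_eq field_simps)

lemma dirichlet_nonneg: "dirichlet w \<ge> 0"
  by (simp add: dirichlet_def)

lemma Lnorm_surface_Gamma1: "(Lnorm (surface_on \<Gamma>1) 2 g)\<^sup>2 = (LINT x|\<sigma>. (g x * indicator \<Gamma>1 x)\<^sup>2)"
  unfolding Lnorm_2_power2 surface_on_Gamma1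
  by (intro Bochner_Integration.integral_cong) (auto simp: indicator_def)

lemma l2_mass_eq: "l2_mass w = (Lnorm L\<Omega> 2 w)\<^sup>2 + (bdry_norm \<Omega> \<Gamma>1 w)\<^sup>2"
  unfolding l2_mass_def Lnorm_surface_Gamma1 by (simp add: Lnorm_2_power2 bdry_def)

lemma V_H1: "w \<in> V \<Longrightarrow> w \<in> H1 \<Omega>"
  by (simp add: H1_zero_on_def)

lemma V_measurable: "w \<in> V \<Longrightarrow> w \<in> borel_measurable L\<Omega>"
  using H1_sq_integrable[OF V_H1] by (simp add: sq_integrable_def)

lemma V_lin:
  assumes "w1 \<in> V" "w2 \<in> V"
  shows "(\<lambda>x. a * w1 x + b * w2 x) \<in> V"
proof -
  obtain g1 g2 where g: "has_trace \<Omega> w1 g1" "AE x in \<sigma>. x \<in> \<Gamma>0 \<longrightarrow> g1 x = 0"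
    "has_trace \<Omega> w2 g2" "AE x in \<sigma>. x \<in> \<Gamma>0 \<longrightarrow> g2 x = 0"
    using assms by (auto simp: H1_zero_on_def)
  have "AE x in \<sigma>. x \<in> \<Gamma>0 \<longrightarrow> a * g1 x + b * g2 x = 0"
    using g(2,4) by eventually_elim simp
  then show ?thesis using has_trace_lin[OF g(1,3), of a b] H1_lin[OF assms[THEN V_H1], of a b]
    unfolding H1_zero_on_def by blast
qed

lemma V_diff: "w1 \<in> V \<Longrightarrow> w2 \<in> V \<Longrightarrow> (\<lambda>x. w1 x - w2 x) \<in> V"
  using V_lin[of w1 w2 1 "-1"] by simp

lemma V_zero: "(\<lambda>x. 0) \<in> V"
  using zero_has_trace unfolding H1_zero_on_def has_trace_def by force

lemma V_trace: "w \<in> V \<Longrightarrow> has_trace \<Omega> w (trace_of \<Omega> w)"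
  unfolding H1_zero_on_def trace_of_def using someI_ex[of "has_trace \<Omega> w"] by blast

text \<open>The boundary estimate is for every trace \<open>g\<close> of \<open>w\<close>, not only
  the chosen one; uniqueness and continuity of traces on \<open>\<Gamma>1\<close> rest on
  that.\<close>

lemma poincare_bound:
  obtains C where "C \<ge> 0" "\<And>w. w \<in> V \<Longrightarrow> (LINT x|L\<Omega>. (w x)\<^sup>2) \<le> C * dirichlet w"
    "\<And>w g. w \<in> V \<Longrightarrow> has_trace \<Omega> w g \<Longrightarrow> (LINT x|\<sigma>. (g x * indicator \<Gamma>1 x)\<^sup>2) \<le> C * dirichlet w"
proof -
  obtain C where C: "\<And>w g. w \<in> V \<Longrightarrow> has_trace \<Omega> w g \<Longrightarrow>
      (LINT x|L\<Omega>. (w x)\<^sup>2) \<le> C * dirichlet w \<and> (LINT x|\<sigma>. (g x * indicator \<Gamma>1 x)\<^sup>2) \<le> C * dirichlet w"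
  proof -
    from poincare obtain C where "\<forall>w\<in>V. \<forall>g. has_trace \<Omega> w g \<longrightarrow>
        (Lnorm L\<Omega> 2 w)\<^sup>2 \<le> C * (grad_norm \<Omega> w)\<^sup>2 \<and> (Lnorm (surface_on \<Gamma>1) 2 g)\<^sup>2 \<le> C * (grad_norm \<Omega> w)\<^sup>2"
      unfolding poincare_inequality_def by (rule exE)
    then show ?thesis unfolding Lnorm_surface_Gamma1 unfolding Lnorm_2_power2 dirichlet_def[symmetric]
      by (intro that[of C]) blast
  qed
  have le: "C * dirichlet w \<le> max C 0 * dirichlet w" for w by (rule mult_right_mono) (auto simp: dirichlet_nonneg)
  show ?thesis
  proof (rule that[of "max C 0"])
    show "(LINT x|L\<Omega>. (w x)\<^sup>2) \<le> max C 0 * dirichlet w" if "w \<in> V" for w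
      using C[OF that V_trace[OF that]] le[of w] by linarith
    show "(LINT x|\<sigma>. (g x * indicator \<Gamma>1 x)\<^sup>2) \<le> max C 0 * dirichlet w" if "w \<in> V" "has_trace \<Omega> w g" for w g
      using C[OF that] le[of w] by linarith
  qed simp
qed

lemma bdry_sq_integrable: "w \<in> V \<Longrightarrow> sq_integrable \<sigma> (bdry w)"
proof -
  assume "w \<in> V"
  then have t: "sq_integrable \<sigma> (trace_of \<Omega> w)" using V_trace has_trace_iff by blast
  then have [measurable]: "trace_of \<Omega> w \<in> borel_measurable \<sigma>" by (simp add: sq_integrable_def)
  have [measurable]: "\<Gamma>1 \<in> sets \<sigma>" by (rule Gamma1_sets)
  show ?thesis unfolding sq_integrable_def bdry_def[abs_def]
  proof
    show "integrable \<sigma> (\<lambda>x. (norm (trace_of \<Omega> w x * indicator \<Gamma>1 x))\<^sup>2)"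
      by (rule Bochner_Integration.integrable_bound[of \<sigma> "\<lambda>x. (norm (trace_of \<Omega> w x))\<^sup>2"])
        (use t in \<open>auto simp: sq_integrable_def split: split_indicator\<close>)
  qed measurable
qed

text \<open>The difference of two traces of \<open>w\<close> is a trace of the zero function, which
  the Poincare inequality forces to vanish on \<open>\<Gamma>1\<close>.\<close>

lemma trace_unique:
  assumes "w \<in> V" "has_trace \<Omega> w g1" "has_trace \<Omega> w g2"
  shows "AE x in \<sigma>. g1 x * indicator \<Gamma>1 x = g2 x * indicator \<Gamma>1 x"
proof -
  obtain C where C: "\<And>w g. w \<in> V \<Longrightarrow> has_trace \<Omega> w g \<Longrightarrow> (LINT x|\<sigma>. (g x * indicator \<Gamma>1 x)\<^sup>2) \<le> C * dirichlet w"
    by (rule poincare_bound) (rule that)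
  have g: "sq_integrable \<sigma> (\<lambda>x. g1 x - g2 x)"
    using assms has_trace_iff by (blast intro: sq_integrable_diff)
  then have [measurable]: "(\<lambda>x. g1 x - g2 x) \<in> borel_measurable \<sigma>" by (simp add: sq_integrable_def)
  have [measurable]: "\<Gamma>1 \<in> sets \<sigma>" by (rule Gamma1_sets)
  have "has_trace \<Omega> (\<lambda>x. 0) (\<lambda>x. g1 x - g2 x)"
    using has_trace_lin[OF assms(2,3), of 1 "-1"] by simp
  moreover have "dirichlet (\<lambda>x. 0) = 0"
    using grad_norm_scale[OF V_H1[OF V_zero], of 0] by (simp add: dirichlet_def)
  ultimately have "(LINT x|\<sigma>. ((g1 x - g2 x) * indicator \<Gamma>1 x)\<^sup>2) \<le> 0"
    using C[OF V_zero] by fastforce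
  then have "(LINT x|\<sigma>. ((g1 x - g2 x) * indicator \<Gamma>1 x)\<^sup>2) = 0"
    by (intro antisym Bochner_Integration.integral_nonneg) auto
  moreover have "integrable \<sigma> (\<lambda>x. ((g1 x - g2 x) * indicator \<Gamma>1 x)\<^sup>2)"
    by (rule Bochner_Integration.integrable_bound[of \<sigma> "\<lambda>x. (norm (g1 x - g2 x))\<^sup>2"])
      (use g in \<open>auto simp: sq_integrable_def split: split_indicator\<close>)
  ultimately have "AE x in \<sigma>. ((g1 x - g2 x) * indicator \<Gamma>1 x)\<^sup>2 = 0"
    by (subst (asm) integral_nonneg_eq_0_iff_AE) auto
  then show ?thesis by eventually_elim (auto simp: indicator_def)
qed

lemma zero_AE_imp:
  assumes "w \<in> V" "\<not> nonzero \<Omega> w"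
  shows "dirichlet w = 0" "p_mass w = 0" "l2_mass w = 0"
proof -
  have ae: "AE x in L\<Omega>. w x = 0" using assms(2) by (simp add: nonzero_def)
  have "dirichlet w = dirichlet (\<lambda>x. 0)"
    unfolding dirichlet_def using grad_norm_cong[OF ae V_measurable[OF assms(1)]] by simp
  then show G: "dirichlet w = 0"
    using grad_norm_scale[OF V_H1[OF V_zero], of 0] by (simp add: dirichlet_def)
  have "p_mass w = (LINT x|L\<Omega>. 0)" unfolding p_mass_def
    using ae V_measurable[OF assms(1)] by (intro integral_cong_AE) auto
  then show "p_mass w = 0" by simp
  obtain C where C: "\<And>w. w \<in> V \<Longrightarrow> (LINT x|L\<Omega>. (w x)\<^sup>2) \<le> C * dirichlet w"
    "\<And>w g. w \<in> V \<Longrightarrow> has_trace \<Omega> w g \<Longrightarrow> (LINT x|\<sigma>. (g x * indicator \<Gamma>1 x)\<^sup>2) \<le> C * dirichlet w"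
    by (rule poincare_bound) (rule that)
  have "(LINT x|L\<Omega>. (w x)\<^sup>2) \<le> C * dirichlet w" "(LINT x|\<sigma>. (bdry w x)\<^sup>2) \<le> C * dirichlet w"
    using C(1)[OF assms(1)] C(2)[OF assms(1) V_trace[OF assms(1)]] by (simp_all add: bdry_def)
  moreover have "(LINT x|L\<Omega>. (w x)\<^sup>2) \<ge> 0" "(LINT x|\<sigma>. (bdry w x)\<^sup>2) \<ge> 0" by simp_all
  ultimately show "l2_mass w = 0" using G by (simp add: l2_mass_def)
qed

lemma L2_norm_pos:
  assumes "w \<in> V" "nonzero \<Omega> w"
  shows "(LINT x|L\<Omega>. (w x)\<^sup>2) > 0"
proof -
  have "integrable L\<Omega> (\<lambda>x. (w x)\<^sup>2)" using H1_sq_integrable[OF V_H1[OF assms(1)]] by (simp add: sq_integrable_def)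
  then have "(LINT x|L\<Omega>. (w x)\<^sup>2) \<noteq> 0"
    using assms(2) by (subst integral_nonneg_eq_0_iff_AE) (auto simp: nonzero_def)
  then show ?thesis by (simp add: less_le)
qed

lemma dirichlet_pos:
  assumes "w \<in> V" "nonzero \<Omega> w"
  shows "dirichlet w > 0"
proof (rule ccontr)
  assume "\<not> dirichlet w > 0"
  then have "dirichlet w = 0" using dirichlet_nonneg[of w] by simp
  moreover obtain C where "\<And>w. w \<in> V \<Longrightarrow> (LINT x|L\<Omega>. (w x)\<^sup>2) \<le> C * dirichlet w"
    by (rule poincare_bound) (rule that)
  ultimately show False using L2_norm_pos[OF assms] assms(1) by fastforce
qed

text \<open>A real supremum bounds its members only if they are bounded above; the Poincare constant
  is such a bound.\<close>

lemma S_bounds: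
  assumes "w \<in> V" "nonzero \<Omega> w"
  shows "(LINT x|\<sigma>. (bdry w x)\<^sup>2) / dirichlet w \<le> S1 \<Omega> \<Gamma>0 \<Gamma>1" "(LINT x|L\<Omega>. (w x)\<^sup>2) / dirichlet w \<le> S2 \<Omega> \<Gamma>0"
proof -
  obtain C where C: "\<And>w. w \<in> V \<Longrightarrow> (LINT x|L\<Omega>. (w x)\<^sup>2) \<le> C * dirichlet w"
    "\<And>w g. w \<in> V \<Longrightarrow> has_trace \<Omega> w g \<Longrightarrow> (LINT x|\<sigma>. (g x * indicator \<Gamma>1 x)\<^sup>2) \<le> C * dirichlet w"
    by (rule poincare_bound) (rule that)
  let ?W = "{w \<in> V. nonzero \<Omega> w}"
  have "bdd_above ((\<lambda>w. (LINT x|\<sigma>. (bdry w x)\<^sup>2) / dirichlet w) ` ?W)"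
  proof (rule bdd_aboveI2)
    fix w assume "w \<in> ?W"
    then show "(LINT x|\<sigma>. (bdry w x)\<^sup>2) / dirichlet w \<le> C"
      using C(2)[OF _ V_trace, of w] dirichlet_pos[of w] by (simp add: divide_le_eq bdry_def)
  qed
  from cSUP_upper[OF _ this, of w] show "(LINT x|\<sigma>. (bdry w x)\<^sup>2) / dirichlet w \<le> S1 \<Omega> \<Gamma>0 \<Gamma>1"
    using assms by (simp add: S1_def Lnorm_surface_Gamma1 dirichlet_def bdry_def)
  have "bdd_above ((\<lambda>w. (LINT x|L\<Omega>. (w x)\<^sup>2) / dirichlet w) ` ?W)"
  proof (rule bdd_aboveI2)
    fix w assume "w \<in> ?W"
    then show "(LINT x|L\<Omega>. (w x)\<^sup>2) / dirichlet w \<le> C"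
      using C(1)[of w] dirichlet_pos[of w] by (simp add: divide_le_eq)
  qed
  from cSUP_upper[OF _ this, of w] show "(LINT x|L\<Omega>. (w x)\<^sup>2) / dirichlet w \<le> S2 \<Omega> \<Gamma>0"
    using assms by (simp add: S2_def Lnorm_2_power2 dirichlet_def)
qed

text \<open>The positivity of the sum comes from the existence of one nonzero function, whose L2
  quotient is positive.\<close>

lemma l2_mass_le:
  assumes "w \<in> V" "nonzero \<Omega> w"
  shows "l2_mass w \<le> (S1 \<Omega> \<Gamma>0 \<Gamma>1 + S2 \<Omega> \<Gamma>0) * dirichlet w" and "S1 \<Omega> \<Gamma>0 \<Gamma>1 + S2 \<Omega> \<Gamma>0 > 0"
proof -
  have g: "dirichlet w > 0" by (rule dirichlet_pos[OF assms])
  show "l2_mass w \<le> (S1 \<Omega> \<Gamma>0 \<Gamma>1 + S2 \<Omega> \<Gamma>0) * dirichlet w"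
    using S_bounds[OF assms] g by (simp add: l2_mass_def divide_le_eq distrib_right)
  have "0 < (LINT x|L\<Omega>. (w x)\<^sup>2) / dirichlet w" using L2_norm_pos[OF assms] g by simp
  moreover have "0 \<le> (LINT x|\<sigma>. (bdry w x)\<^sup>2) / dirichlet w" using g by simp
  ultimately show "S1 \<Omega> \<Gamma>0 \<Gamma>1 + S2 \<Omega> \<Gamma>0 > 0" using S_bounds[OF assms] by linarith
qed

definition B2_const :: real where "B2_const = (p - 2) / (2 * p * (S1 \<Omega> \<Gamma>0 \<Gamma>1 + S2 \<Omega> \<Gamma>0))"

lemma B2_iff: "w \<in> B2 \<Omega> \<Gamma>0 \<Gamma>1 p \<longleftrightarrow> w \<in> V \<and> J \<Omega> p w < B2_const * l2_mass w"
  by (simp add: B2_def B2_const_def l2_mass_eq)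

text \<open>At the zero function both sides of the defining inequality are 0, and the inequality is
  strict.\<close>

lemma B2_nonzero: "w \<in> B2 \<Omega> \<Gamma>0 \<Gamma>1 p \<Longrightarrow> nonzero \<Omega> w"
  using zero_AE_imp[of w] by (cases "nonzero \<Omega> w") (auto simp: B2_iff J_eq)

lemma B2_const_nonneg: "w \<in> B2 \<Omega> \<Gamma>0 \<Gamma>1 p \<Longrightarrow> B2_const \<ge> 0"
  using l2_mass_le(2)[OF _ B2_nonzero, of w] p by (simp add: B2_iff B2_const_def)

text \<open>Bounding \<open>l2_mass\<close> by S1 + S2 times the Dirichlet term cancels S1 + S2 and
  leaves exactly the first summand of \<open>J_eq_K\<close>; so the other summand, K / p, must be
  negative.\<close>

lemma B2_K_neg:
  assumes w: "w \<in> B2 \<Omega> \<Gamma>0 \<Gamma>1 p"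
  shows "K \<Omega> p w < 0"
proof -
  have V: "w \<in> V" and J: "J \<Omega> p w < B2_const * l2_mass w" using w by (auto simp: B2_iff)
  note nz = B2_nonzero[OF w]
  have "B2_const * l2_mass w \<le> B2_const * ((S1 \<Omega> \<Gamma>0 \<Gamma>1 + S2 \<Omega> \<Gamma>0) * dirichlet w)"
    by (rule mult_left_mono[OF l2_mass_le(1)[OF V nz] B2_const_nonneg[OF w]])
  also have "\<dots> = (p - 2) / (2 * p) * dirichlet w"
    using l2_mass_le(2)[OF V nz] by (simp add: B2_const_def)
  finally have "K \<Omega> p w / p < 0" using J J_eq_K[of w] by linarith
  then show ?thesis using p by (simp add: divide_less_0_iff)
qed

section \<open>The Nehari manifold and the depth of the well\<close>

lemma nehari_J: "w \<in> nehari \<Omega> \<Gamma>0 p \<Longrightarrow> J \<Omega> p w \<ge> 0"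
  using p dirichlet_nonneg[of w] J_eq_K[of w] by (simp add: nehari_def)

text \<open>The nonnegativity of \<open>J\<close> on the Nehari manifold bounds the set below, so
  that its real infimum is a genuine lower bound.\<close>

lemma well_depth_le: "w \<in> nehari \<Omega> \<Gamma>0 p \<Longrightarrow> well_depth \<Omega> \<Gamma>0 p \<le> J \<Omega> p w"
  unfolding well_depth_def by (rule cINF_lower) (auto intro!: bdd_belowI2[of _ 0] nehari_J)

text \<open>Where \<open>K\<close> is negative, shrinking the function along its ray meets the Nehari manifold.\<close>

lemma well_depth_le_gradient:
  assumes w: "w \<in> V" "K \<Omega> p w < 0"
  shows "well_depth \<Omega> \<Gamma>0 p \<le> (p - 2) / (2 * p) * dirichlet w"
proof -
  have nz: "nonzero \<Omega> w" using zero_AE_imp[OF w(1)] w(2) by (cases "nonzero \<Omega> w") (auto simp: K_eq)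
  have G: "dirichlet w > 0" by (rule dirichlet_pos[OF w(1) nz])
  have lt: "dirichlet w < p_mass w" using w(2) by (simp add: K_eq)
  \<comment> \<open>The solution of l^2 * dirichlet w = l^p * p_mass w, that is K = 0 at l * w. The
    negative sign of K at w makes the quotient less than 1, hence l \<le> 1.\<close>
  define l where "l = (dirichlet w / p_mass w) powr (1 / (p - 2))"
  have l: "0 < l" "l \<le> 1" using G lt p unfolding l_def by (auto intro!: powr_le1)
  have lp: "l powr (p - 2) = dirichlet w / p_mass w" using G lt p by (simp add: l_def powr_powr)
  have "l powr p = l powr (2 + (p - 2))" by simp
  also have "\<dots> = l\<^sup>2 * (dirichlet w / p_mass w)" unfolding powr_add lp using l by (simp add: powr_numeral)
  finally have lpN: "l powr p * p_mass w = l\<^sup>2 * dirichlet w" using G lt by simp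
  let ?v = "\<lambda>x. l * w x"
  have v: "?v \<in> V" using V_lin[OF w(1) w(1), of l 0] by simp
  have Gv: "dirichlet ?v = l\<^sup>2 * dirichlet w" unfolding dirichlet_def by (rule grad_norm_scale[OF V_H1[OF w(1)]])
  have "p_mass ?v = l powr p * p_mass w"
    unfolding p_mass_def using l by (simp add: abs_mult powr_mult)
  then have Nv: "p_mass ?v = l\<^sup>2 * dirichlet w" using lpN by simp
  have "nonzero \<Omega> ?v" using nz l by (simp add: nonzero_def)
  then have "?v \<in> nehari \<Omega> \<Gamma>0 p" using v by (simp add: nehari_def K_eq Gv Nv)
  then have "well_depth \<Omega> \<Gamma>0 p \<le> J \<Omega> p ?v" by (rule well_depth_le)
  also have "\<dots> = (p - 2) / (2 * p) * (l\<^sup>2 * dirichlet w)" unfolding J_eq_K by (simp add: K_eq Gv Nv)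
  also have "\<dots> \<le> (p - 2) / (2 * p) * (1 * dirichlet w)"
    using p l G by (intro mult_left_mono mult_right_mono) (auto simp: power_le_one)
  finally show ?thesis by simp
qed

text \<open>Serves to pass from \<open>u0\<close> to \<open>u 0\<close>, which agree only almost
  everywhere.\<close>

lemma J_K_Y_cong:
  assumes "w \<in> V" "w' \<in> V" "AE x in L\<Omega>. w x = w' x"
  shows "J \<Omega> p w = J \<Omega> p w'" "K \<Omega> p w = K \<Omega> p w'" "l2_mass w = l2_mass w'"
proof -
  note m = V_measurable[OF assms(1)] V_measurable[OF assms(2)]
  show "J \<Omega> p w = J \<Omega> p w'" "K \<Omega> p w = K \<Omega> p w'" using J_cong[OF assms(3) m] by auto
  have "trace_of \<Omega> w = trace_of \<Omega> w'"
    unfolding trace_of_def using has_trace_cong[OF assms(3) V_H1[OF assms(1)] V_H1[OF assms(2)]] by simp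
  moreover have "(LINT x|L\<Omega>. (w x)\<^sup>2) = (LINT x|L\<Omega>. (w' x)\<^sup>2)"
    using assms(3) m by (intro integral_cong_AE) auto
  ultimately show "l2_mass w = l2_mass w'" by (simp add: l2_mass_def bdry_def)
qed

end

section \<open>The source term paired with a function\<close>

lemma powr_pairing_bound:
  fixes a b p :: real
  assumes "p > 2"
  shows "\<bar>\<bar>a\<bar> powr (p - 2) * a * b\<bar> \<le> \<bar>a\<bar> powr p + \<bar>b\<bar> powr p"
proof -
  have pow: "x powr (p - 2) * x * x = x powr p" if "x \<ge> 0" for x :: real
  proof (cases "x = 0")
    case False
    then have "x powr p = x powr (p - 2) * x powr 2" by (simp flip: powr_add)
    then show ?thesis using that False by (simp add: powr_numeral power2_eq_square)
  qed (use assms in simp)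
  \<comment> \<open>Replacing both absolute values by the larger one collapses the product to a
    single p-th power.\<close>
  let ?m = "max \<bar>a\<bar> \<bar>b\<bar>"
  have "\<bar>a\<bar> powr (p - 2) * \<bar>a\<bar> * \<bar>b\<bar> \<le> ?m powr (p - 2) * ?m * ?m"
    using assms by (intro mult_mono powr_mono2) auto
  also have "\<dots> = ?m powr p" by (rule pow) simp
  also have "\<dots> \<le> \<bar>a\<bar> powr p + \<bar>b\<bar> powr p" by (simp add: max_def)
  finally show ?thesis by (simp add: abs_mult)
qed

lemma powr_pairing_self: "\<bar>a\<bar> powr (p - 2) * a * a = \<bar>a\<bar> powr p" if "p > 2" for a p :: real
proof (cases "a = 0")
  case False
  have "\<bar>a\<bar> powr ((p - 2) + 2) = \<bar>a\<bar> powr (p - 2) * \<bar>a\<bar> powr 2" by (rule powr_add)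
  also have "\<bar>a\<bar> powr 2 = a * a" using False by (simp add: powr_numeral power2_eq_square)
  finally show ?thesis by simp
qed (use that in simp)

lemma integrable_powr_pairing:
  fixes a b :: "'b \<Rightarrow> real"
  assumes p: "p > 2" and [measurable]: "a \<in> borel_measurable M" "b \<in> borel_measurable M"
    and "integrable M (\<lambda>x. \<bar>a x\<bar> powr p)" "integrable M (\<lambda>x. \<bar>b x\<bar> powr p)"
  shows "integrable M (\<lambda>x. \<bar>a x\<bar> powr (p - 2) * a x * b x)"
proof (rule Bochner_Integration.integrable_bound)
  show "integrable M (\<lambda>x. \<bar>a x\<bar> powr p + \<bar>b x\<bar> powr p)" using assms by simp
  show "AE x in M. norm (\<bar>a x\<bar> powr (p - 2) * a x * b x) \<le> norm (\<bar>a x\<bar> powr p + \<bar>b x\<bar> powr p)"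
    using powr_pairing_bound[OF p] by simp
qed measurable

text \<open>Fatou's lemma, applied along an almost everywhere convergent subsequence to
  \<open>|a|^(p-2) a b + |a|^p + |b|^p\<close>, which is nonnegative by Young's inequality.\<close>

lemma powr_pairing_liminf:
  fixes a :: "nat \<Rightarrow> 'b \<Rightarrow> real" and b :: "'b \<Rightarrow> real"
  assumes p: "p > 2" and a: "\<And>n. sq_integrable M (a n)" "\<And>n. integrable M (\<lambda>x. \<bar>a n x\<bar> powr p)"
    and b: "sq_integrable M b" "integrable M (\<lambda>x. \<bar>b x\<bar> powr p)"
    and lim_p: "(\<lambda>n. LINT x|M. \<bar>a n x\<bar> powr p) \<longlonglongrightarrow> (LINT x|M. \<bar>b x\<bar> powr p)"
    and lim_2: "(\<lambda>n. LINT x|M. (a n x - b x)\<^sup>2) \<longlonglongrightarrow> 0"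
    and le: "\<And>n. (LINT x|M. \<bar>a n x\<bar> powr (p - 2) * a n x * b x) \<le> c"
  shows "(LINT x|M. \<bar>b x\<bar> powr p) \<le> c"
proof -
  have [measurable]: "a n \<in> borel_measurable M" "b \<in> borel_measurable M" for n
    using a(1)[of n] b(1) by (auto simp: sq_integrable_def)
  \<comment> \<open>Convergence of the integrals of the squares gives almost everywhere convergence
    only along a subsequence; the integral hypotheses pass to it.\<close>
  have "\<exists>r::nat\<Rightarrow>nat. strict_mono r \<and> (AE x in M. (\<lambda>n. (a (r n) x - b x)\<^sup>2) \<longlonglongrightarrow> 0)"
    using sq_integrable_diff[OF a(1) b(1)] lim_2
    by (intro tendsto_L1_AE_subseq) (auto simp: sq_integrable_def)
  then obtain r :: "nat \<Rightarrow> nat" where r: "strict_mono r" "AE x in M. (\<lambda>n. (a (r n) x - b x)\<^sup>2) \<longlonglongrightarrow> 0" by blast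
  define h where "h n x = \<bar>a (r n) x\<bar> powr (p - 2) * a (r n) x * b x + \<bar>a (r n) x\<bar> powr p + \<bar>b x\<bar> powr p" for n x
  let ?B = "LINT x|M. \<bar>b x\<bar> powr p"
  have h_nonneg: "h n x \<ge> 0" for n x using powr_pairing_bound[OF p, of "a (r n) x" "b x"] by (simp add: h_def abs_le_iff)
  have h_int: "integrable M (h n)" for n unfolding h_def
    using a b p by (intro Bochner_Integration.integrable_add integrable_powr_pairing) auto
  have h_le: "(LINT x|M. h n x) \<le> c + (LINT x|M. \<bar>a (r n) x\<bar> powr p) + ?B" for n
  proof -
    have "(LINT x|M. h n x) = (LINT x|M. \<bar>a (r n) x\<bar> powr (p - 2) * a (r n) x * b x) + (LINT x|M. \<bar>a (r n) x\<bar> powr p) + ?B"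
      unfolding h_def using a b p integrable_powr_pairing[OF p _ _ a(2) b(2), of "r n"] by simp
    then show ?thesis using le[of "r n"] by simp
  qed
  have h_lim: "AE x in M. (\<lambda>n. h n x) \<longlonglongrightarrow> 3 * \<bar>b x\<bar> powr p"
    using r(2)
  proof eventually_elim
    fix x assume "(\<lambda>n. (a (r n) x - b x)\<^sup>2) \<longlonglongrightarrow> 0"
    then have "(\<lambda>n. sqrt ((a (r n) x - b x)\<^sup>2)) \<longlonglongrightarrow> sqrt 0" by (rule tendsto_real_sqrt)
    then have "(\<lambda>n. a (r n) x - b x) \<longlonglongrightarrow> 0" by (simp add: tendsto_rabs_zero_iff)
    then have *: "(\<lambda>n. a (r n) x) \<longlonglongrightarrow> b x" by (rule LIM_zero_cancel)
    have "(\<lambda>n. h n x) \<longlonglongrightarrow> \<bar>b x\<bar> powr (p - 2) * b x * b x + \<bar>b x\<bar> powr p + \<bar>b x\<bar> powr p"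
      unfolding h_def using p by (intro tendsto_intros tendsto_powr' *) auto
    then show "(\<lambda>n. h n x) \<longlonglongrightarrow> 3 * \<bar>b x\<bar> powr p" using powr_pairing_self[OF p] by simp
  qed
  \<comment> \<open>The factor 3 counts the limit of the pairing and of the two added powers.
    Comparison with c plus twice the p-th power integral leaves the claim.\<close>
  have "ennreal (3 * ?B) = (\<integral>\<^sup>+x. ennreal (3 * \<bar>b x\<bar> powr p) \<partial>M)"
    using b(2) by (subst nn_integral_eq_integral) auto
  also have "\<dots> = (\<integral>\<^sup>+x. liminf (\<lambda>n. ennreal (h n x)) \<partial>M)"
  proof (rule nn_integral_cong_AE)
    show "AE x in M. ennreal (3 * \<bar>b x\<bar> powr p) = liminf (\<lambda>n. ennreal (h n x))"
      using h_lim
    proof eventually_elim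
      fix x assume "(\<lambda>n. h n x) \<longlonglongrightarrow> 3 * \<bar>b x\<bar> powr p"
      then have "(\<lambda>n. ennreal (h n x)) \<longlonglongrightarrow> ennreal (3 * \<bar>b x\<bar> powr p)" by (rule tendsto_ennrealI)
      then show "ennreal (3 * \<bar>b x\<bar> powr p) = liminf (\<lambda>n. ennreal (h n x))"
        by (rule lim_imp_Liminf[OF sequentially_bot, symmetric])
    qed
  qed
  also have "\<dots> \<le> liminf (\<lambda>n. \<integral>\<^sup>+x. ennreal (h n x) \<partial>M)"
    by (rule nn_integral_liminf) (use h_int in auto)
  also have "\<dots> = liminf (\<lambda>n. ennreal (LINT x|M. h n x))"
    using h_nonneg by (subst nn_integral_eq_integral[OF h_int]) auto
  also have "\<dots> \<le> liminf (\<lambda>n. ennreal (c + (LINT x|M. \<bar>a (r n) x\<bar> powr p) + ?B))"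
    by (intro Liminf_mono always_eventually allI ennreal_leI h_le)
  also have "\<dots> = ennreal (c + ?B + ?B)"
  proof (rule lim_imp_Liminf[OF sequentially_bot], rule tendsto_ennrealI)
    show "(\<lambda>n. c + (LINT x|M. \<bar>a (r n) x\<bar> powr p) + ?B) \<longlonglongrightarrow> c + ?B + ?B"
      using LIMSEQ_subseq_LIMSEQ[OF lim_p r(1)] by (intro tendsto_intros) (simp add: o_def)
  qed
  finally have "ennreal (3 * ?B) \<le> ennreal (c + ?B + ?B)" .
  \<comment> \<open>\<open>ennreal\<close> sends negative reals to 0, so the sign of the right-hand
    side is settled before the inequality returns to the reals.\<close>
  moreover have "c + ?B + ?B \<ge> 0"
  proof -
    have "(\<lambda>n. c + (LINT x|M. \<bar>a (r n) x\<bar> powr p) + ?B) \<longlonglongrightarrow> c + ?B + ?B"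
      using LIMSEQ_subseq_LIMSEQ[OF lim_p r(1)] by (intro tendsto_intros) (simp add: o_def)
    moreover have "0 \<le> c + (LINT x|M. \<bar>a (r n) x\<bar> powr p) + ?B" for n
      using h_le[of n] Bochner_Integration.integral_nonneg[of M "h n"] h_nonneg by (meson order_trans)
    then have "\<exists>N. \<forall>n\<ge>N. 0 \<le> c + (LINT x|M. \<bar>a (r n) x\<bar> powr p) + ?B" by blast
    ultimately show ?thesis by (rule LIMSEQ_le_const)
  qed
  ultimately show ?thesis by (simp add: ennreal_le_iff)
qed

section \<open>Monotonicity along the flow\<close>

text \<open>The setting for a maximal solution restricted to a compact interval [0, T] inside its
  lifespan, with the local theory stated there.\<close>

locale well_flow = well_problem \<Omega> \<Gamma>0 \<Gamma>1 p for \<Omega> \<Gamma>0 \<Gamma>1 :: "'a::euclidean_space set" and p :: real +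
  fixes T :: real and u0 :: "'a \<Rightarrow> real" and u ut zt :: "real \<Rightarrow> 'a \<Rightarrow> real"
  assumes T: "0 < T" and u0_V: "u0 \<in> V" and u_V: "t \<in> {0..T} \<Longrightarrow> u t \<in> V"
    and u_p: "t \<in> {0..T} \<Longrightarrow> integrable L\<Omega> (\<lambda>x. \<bar>u t x\<bar> powr p)"
    and u_cont: "t \<in> {0..T} \<Longrightarrow> ((\<lambda>s. H1_norm \<Omega> (\<lambda>x. u s x - u t x)) \<longlongrightarrow> 0) (at t within {0..T})"
    and sol: "weak_solution_with \<Omega> \<Gamma>0 \<Gamma>1 p T u0 u ut zt"
    and J_id: "t \<in> {0..T} \<Longrightarrow> J \<Omega> p (u t) - J \<Omega> p u0 =
      - (LINT \<tau>|lebesgue_on {0..t}. (Lnorm L\<Omega> 2 (ut \<tau>))\<^sup>2 + (Lnorm (surface_on \<Gamma>1) 2 (zt \<tau>))\<^sup>2)"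
begin

sublocale ST: space_time L\<Omega> T ..
sublocale SB: space_time \<sigma> T ..

lemma interior_deriv: "has_time_deriv T L\<Omega> \<Omega> u ut"
  and weak_form: "\<phi> \<in> V \<Longrightarrow> AE t in lebesgue_on {0..T}.
      (LINT x|L\<Omega>. ut t x * \<phi> x) + (LINT x|L\<Omega>. wgrad \<Omega> (u t) x \<bullet> wgrad \<Omega> \<phi> x)
      + (LINT x|surface_on \<Gamma>1. zt t x * trace_of \<Omega> \<phi> x)
      = (LINT x|L\<Omega>. \<bar>u t x\<bar> powr (p - 2) * u t x * \<phi> x)"
  and initial: "AE x in L\<Omega>. u 0 x = u0 x"
  using sol unfolding weak_solution_with_def by blast+

lemma boundary_deriv:
  obtains h where "AE t in ST.IT. has_trace \<Omega> (u t) (h t)" "has_time_deriv T \<sigma> UNIV h zt"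
  using sol unfolding weak_solution_with_def by blast

text \<open>Integrability is what makes the integral in \<open>J_id\<close> grow with t; a
  non-integrable integrand would give the default value 0.\<close>

lemma energy_integrable:
  "integrable ST.IT (\<lambda>t. (Lnorm L\<Omega> 2 (ut t))\<^sup>2 + (Lnorm (surface_on \<Gamma>1) 2 (zt t))\<^sup>2)"
proof -
  obtain h where h: "has_time_deriv T \<sigma> UNIV h zt" by (rule boundary_deriv) (rule that)
  have ut: "(\<lambda>(t, x). ut t x) \<in> L2 (ST.IT \<Otimes>\<^sub>M L\<Omega>)" and zt: "(\<lambda>(t, x). zt t x) \<in> L2 (ST.IT \<Otimes>\<^sub>M \<sigma>)"
    using interior_deriv h by (auto simp: has_time_deriv_def Let_def)
  have "(LINT x|L\<Omega>. (ut t x)\<^sup>2 * indicator \<Omega> x) = (LINT x|L\<Omega>. (ut t x)\<^sup>2)" for t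
    by (intro Bochner_Integration.integral_cong) auto
  moreover have "\<Omega> \<in> sets L\<Omega>" using sets.top[of L\<Omega>] by simp
  ultimately have 1: "integrable ST.IT (\<lambda>t. LINT x|L\<Omega>. (ut t x)\<^sup>2)"
    using ST.integrable_energy[OF ut, of \<Omega>] by simp
  have "(LINT x|\<sigma>. (zt t x)\<^sup>2 * indicator \<Gamma>1 x) = (LINT x|\<sigma>. (zt t x * indicator \<Gamma>1 x)\<^sup>2)" for t
    by (intro Bochner_Integration.integral_cong) (auto simp: indicator_def)
  then have 2: "integrable ST.IT (\<lambda>t. LINT x|\<sigma>. (zt t x * indicator \<Gamma>1 x)\<^sup>2)"
    using SB.integrable_energy[OF zt Gamma1_sets] by simp
  show ?thesis unfolding Lnorm_surface_Gamma1 unfolding Lnorm_2_power2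
    by (rule Bochner_Integration.integrable_add[OF 1 2])
qed

lemma J_continuous: "continuous_on {0..T} (\<lambda>t. J \<Omega> p (u t))"
  and J_antimono: "0 \<le> s \<Longrightarrow> s \<le> t \<Longrightarrow> t \<le> T \<Longrightarrow> J \<Omega> p (u t) \<le> J \<Omega> p (u s)"
proof -
  define D where "D t = (Lnorm L\<Omega> 2 (ut t))\<^sup>2 + (Lnorm (surface_on \<Gamma>1) 2 (zt t))\<^sup>2" for t
  have D0: "D t \<ge> 0" for t by (simp add: D_def)
  have "integrable ST.IT D" unfolding D_def[abs_def] by (rule energy_integrable)
  \<comment> \<open>Integrability is known over the open interval; closing it, which adds a null
    set, makes all intervals {0..t} available.\<close>
  then have "D absolutely_integrable_on box 0 T"
    by (simp add: set_integrable_def integrable_restrict_space box_real)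
  then have abs: "D absolutely_integrable_on {0..T}"
    using absolutely_integrable_on_open_interval[where f = D and a = 0 and b = T] by (simp add: cbox_interval box_real)
  have sub: "D absolutely_integrable_on {0..t}" if "t \<in> {0..T}" for t
    by (rule set_integrable_subset[OF abs]) (use that in auto)
  then have int: "D integrable_on {0..t}" if "t \<in> {0..T}" for t
    using that set_lebesgue_integral_eq_integral(1) by blast
  have eq: "J \<Omega> p (u t) = J \<Omega> p u0 - integral {0..t} D" if "t \<in> {0..T}" for t
  proof -
    have "integrable (lebesgue_on {0..t}) D"
      using sub[OF that] by (simp add: set_integrable_def integrable_restrict_space)
    from lebesgue_integral_eq_integral[OF this] show ?thesis using J_id[OF that] by (simp add: D_def[abs_def])
  qed
  have "continuous_on {0..T} (\<lambda>t. J \<Omega> p u0 - integral {0..t} D)"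
    using int[of T] T by (intro continuous_intros indefinite_integral_continuous_1) auto
  then show "continuous_on {0..T} (\<lambda>t. J \<Omega> p (u t))"
    by (rule continuous_on_eq) (simp add: eq)
  assume st: "0 \<le> s" "s \<le> t" "t \<le> T"
  then have "integral {0..s} D \<le> integral {0..t} D"
    by (intro integral_subset_le int) (auto simp: D0)
  then show "J \<Omega> p (u t) \<le> J \<Omega> p (u s)" using eq[of s] eq[of t] st by simp
qed

section \<open>Continuity in time\<close>

lemma eventually_in: "eventually (\<lambda>s. s \<in> {0..T}) (at t within {0..T})"
  by (simp add: eventually_at_filter)

lemma dirichlet_diff_tendsto:
  assumes "t \<in> {0..T}"
  shows "((\<lambda>s. dirichlet (\<lambda>x. u s x - u t x)) \<longlongrightarrow> 0) (at t within {0..T})"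
    and "((\<lambda>s. LINT x|L\<Omega>. (u s x - u t x)\<^sup>2) \<longlongrightarrow> 0) (at t within {0..T})"
  using u_cont[OF assms] unfolding H1_norm_tendsto_zero_iff dirichlet_def by auto

lemma wgrad_tendsto:
  assumes t: "t \<in> {0..T}"
  shows "((\<lambda>s. LINT x|L\<Omega>. (norm (wgrad \<Omega> (u s) x - wgrad \<Omega> (u t) x))\<^sup>2) \<longlongrightarrow> 0) (at t within {0..T})"
proof (rule Lim_transform_eventually[OF dirichlet_diff_tendsto(1)[OF t]])
  show "\<forall>\<^sub>F s in at t within {0..T}. dirichlet (\<lambda>x. u s x - u t x) =
      (LINT x|L\<Omega>. (norm (wgrad \<Omega> (u s) x - wgrad \<Omega> (u t) x))\<^sup>2)"
    using eventually_in
  proof eventually_elim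
    fix s assume "s \<in> {0..T}"
    then show "dirichlet (\<lambda>x. u s x - u t x) = (LINT x|L\<Omega>. (norm (wgrad \<Omega> (u s) x - wgrad \<Omega> (u t) x))\<^sup>2)"
      using grad_norm_lin_eq[OF V_H1[OF u_V] V_H1[OF u_V[OF t]], of s 1 "-1"] by (simp add: dirichlet_def)
  qed
qed

text \<open>Differences of traces are traces of differences, and the Poincare inequality bounds
  these by the gradient norm.\<close>

lemma bdry_tendsto:
  assumes t: "t \<in> {0..T}"
  shows "((\<lambda>s. LINT x|\<sigma>. (norm (bdry (u s) x - bdry (u t) x))\<^sup>2) \<longlongrightarrow> 0) (at t within {0..T})"
proof -
  obtain C where C: "\<And>w g. w \<in> V \<Longrightarrow> has_trace \<Omega> w g \<Longrightarrow> (LINT x|\<sigma>. (g x * indicator \<Gamma>1 x)\<^sup>2) \<le> C * dirichlet w"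
    by (rule poincare_bound) (rule that)
  show ?thesis
  proof (rule tendsto_sandwich[OF _ _ tendsto_const])
    show "\<forall>\<^sub>F s in at t within {0..T}. (LINT x|\<sigma>. (norm (bdry (u s) x - bdry (u t) x))\<^sup>2)
        \<le> C * dirichlet (\<lambda>x. u s x - u t x)"
      using eventually_in
    proof eventually_elim
      fix s assume s: "s \<in> {0..T}"
      have "has_trace \<Omega> (\<lambda>x. u s x - u t x) (\<lambda>x. trace_of \<Omega> (u s) x - trace_of \<Omega> (u t) x)"
        using has_trace_lin[OF V_trace[OF u_V[OF s]] V_trace[OF u_V[OF t]], of 1 "-1"] by simp
      from C[OF V_diff[OF u_V[OF s] u_V[OF t]] this]
      show "(LINT x|\<sigma>. (norm (bdry (u s) x - bdry (u t) x))\<^sup>2) \<le> C * dirichlet (\<lambda>x. u s x - u t x)"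
        by (simp add: bdry_def left_diff_distrib)
    qed
    have "((\<lambda>s. C * dirichlet (\<lambda>x. u s x - u t x)) \<longlongrightarrow> C * 0) (at t within {0..T})"
      by (intro tendsto_intros dirichlet_diff_tendsto t)
    then show "((\<lambda>s. C * dirichlet (\<lambda>x. u s x - u t x)) \<longlongrightarrow> 0) (at t within {0..T})" by simp
  qed simp
qed

lemma u_sq: "t \<in> {0..T} \<Longrightarrow> sq_integrable L\<Omega> (u t)"
  and wgrad_sq: "t \<in> {0..T} \<Longrightarrow> sq_integrable L\<Omega> (wgrad \<Omega> (u t))"
  and bdry_sq: "t \<in> {0..T} \<Longrightarrow> sq_integrable \<sigma> (bdry (u t))"
  by (simp_all add: H1_sq_integrable H1_wgrad_sq_integrable bdry_sq_integrable V_H1 u_V)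

lemma ev_sq:
  "eventually (\<lambda>s. sq_integrable L\<Omega> (u s)) (at t within {0..T})"
  "eventually (\<lambda>s. sq_integrable L\<Omega> (wgrad \<Omega> (u s))) (at t within {0..T})"
  "eventually (\<lambda>s. sq_integrable \<sigma> (bdry (u s))) (at t within {0..T})"
  by (rule eventually_mono[OF eventually_in], erule u_sq wgrad_sq bdry_sq)+

lemma u_tendsto:
  assumes "t \<in> {0..T}"
  shows "((\<lambda>s. LINT x|L\<Omega>. (norm (u s x - u t x))\<^sup>2) \<longlongrightarrow> 0) (at t within {0..T})"
  using dirichlet_diff_tendsto(2)[OF assms] by simp

lemma dirichlet_continuous: "continuous_on {0..T} (\<lambda>t. dirichlet (u t))"
  unfolding continuous_on_def dirichlet_def grad_norm_power2
  by (intro ballI L2_conv_norm ev_sq wgrad_sq wgrad_tendsto)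

text \<open>The L^p mass is read off from \<open>J\<close>: it is p times the difference of half the
  Dirichlet term and \<open>J\<close>, both already continuous in time.\<close>

lemma p_mass_continuous: "continuous_on {0..T} (\<lambda>t. p_mass (u t))"
proof -
  have "continuous_on {0..T} (\<lambda>t. p * (dirichlet (u t) / 2 - J \<Omega> p (u t)))"
    by (intro continuous_intros dirichlet_continuous J_continuous) simp
  moreover have "p * (dirichlet (u t) / 2 - J \<Omega> p (u t)) = p_mass (u t)" for t using p by (simp add: J_eq)
  ultimately show ?thesis by simp
qed

lemma K_continuous: "continuous_on {0..T} (\<lambda>t. K \<Omega> p (u t))"
  unfolding K_eq by (intro continuous_intros dirichlet_continuous p_mass_continuous)

lemma l2_mass_continuous: "continuous_on {0..T} (\<lambda>t. l2_mass (u t))"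
proof -
  have "continuous_on {0..T} (\<lambda>t. (LINT x|L\<Omega>. (norm (u t x))\<^sup>2) + (LINT x|\<sigma>. (norm (bdry (u t) x))\<^sup>2))"
    unfolding continuous_on_def
    by (intro ballI tendsto_add L2_conv_norm ev_sq u_sq bdry_sq u_tendsto bdry_tendsto)
  then show ?thesis by (simp add: l2_mass_def)
qed

lemma pairing_continuous:
  assumes "sq_integrable L\<Omega> \<phi>" "sq_integrable \<sigma> \<psi>"
  shows "continuous_on {0..T} (\<lambda>t. (LINT x|L\<Omega>. u t x * \<phi> x) + (LINT x|\<sigma>. bdry (u t) x * \<psi> x))"
proof -
  have "continuous_on {0..T} (\<lambda>t. (LINT x|L\<Omega>. u t x \<bullet> \<phi> x) + (LINT x|\<sigma>. bdry (u t) x \<bullet> \<psi> x))"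
    unfolding continuous_on_def
    by (intro ballI tendsto_add L2_conv_inner ev_sq u_sq bdry_sq u_tendsto bdry_tendsto assms)
  then show ?thesis by simp
qed

text \<open>Otherwise a sequence of times tending to s keeps the pairing at most c, against
  \<open>powr_pairing_liminf\<close>. The one-sided control fits its use, where the source pairing
  must exceed a gradient pairing.\<close>

lemma source_lower_semicontinuous:
  assumes s: "s \<in> {0..T}" and c: "c < p_mass (u s)"
  shows "eventually (\<lambda>t. (LINT x|L\<Omega>. \<bar>u t x\<bar> powr (p - 2) * u t x * u s x) > c) (at s within {0..T})"
proof (rule ccontr)
  let ?P = "\<lambda>t. (LINT x|L\<Omega>. \<bar>u t x\<bar> powr (p - 2) * u t x * u s x) > c"
  assume not: "\<not> eventually ?P (at s within {0..T})"
  have "\<forall>n. \<exists>t. t \<in> {0..T} \<and> t \<noteq> s \<and> dist t s < inverse (real (Suc n)) \<and> \<not> ?P t"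
  proof
    fix n
    have "\<not> (\<forall>t\<in>{0..T}. t \<noteq> s \<and> dist t s < inverse (real (Suc n)) \<longrightarrow> ?P t)"
    proof
      assume "\<forall>t\<in>{0..T}. t \<noteq> s \<and> dist t s < inverse (real (Suc n)) \<longrightarrow> ?P t"
      moreover have "inverse (real (Suc n)) > 0" by simp
      ultimately have "eventually ?P (at s within {0..T})" unfolding eventually_at by blast
      with not show False by contradiction
    qed
    then show "\<exists>t. t \<in> {0..T} \<and> t \<noteq> s \<and> dist t s < inverse (real (Suc n)) \<and> \<not> ?P t" by blast
  qed
  from choice[OF this] obtain f where
    "\<forall>n. f n \<in> {0..T} \<and> f n \<noteq> s \<and> dist (f n) s < inverse (real (Suc n)) \<and> \<not> ?P (f n)" ..
  then have f: "\<And>n. f n \<in> {0..T}" "\<And>n. f n \<noteq> s" "\<And>n. dist (f n) s < inverse (real (Suc n))" "\<And>n. \<not> ?P (f n)"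
    by simp_all
  have "(\<lambda>n. dist (f n) s) \<longlonglongrightarrow> 0"
  proof (rule tendsto_sandwich[OF _ _ tendsto_const LIMSEQ_inverse_real_of_nat])
    show "\<forall>\<^sub>F n in sequentially. dist (f n) s \<le> inverse (real (Suc n))"
      by (intro always_eventually allI less_imp_le f(3))
  qed simp
  then have "f \<longlonglongrightarrow> s" by (subst tendsto_dist_iff)
  have fl: "filterlim f (at s within {0..T}) sequentially"
    using f(1,2) \<open>f \<longlonglongrightarrow> s\<close> by (simp add: filterlim_at)
  have "(LINT x|L\<Omega>. \<bar>u s x\<bar> powr p) \<le> c"
  proof (rule powr_pairing_liminf[OF p, of L\<Omega> "\<lambda>n. u (f n)"])
    show "(\<lambda>n. LINT x|L\<Omega>. \<bar>u (f n) x\<bar> powr p) \<longlonglongrightarrow> (LINT x|L\<Omega>. \<bar>u s x\<bar> powr p)"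
    proof -
      have "((\<lambda>t. p_mass (u t)) \<longlongrightarrow> p_mass (u s)) (at s within {0..T})"
        using p_mass_continuous s by (simp add: continuous_on_def)
      from filterlim_compose[OF this fl] show ?thesis by (simp add: p_mass_def)
    qed
    show "(\<lambda>n. LINT x|L\<Omega>. (u (f n) x - u s x)\<^sup>2) \<longlonglongrightarrow> 0"
      using filterlim_compose[OF dirichlet_diff_tendsto(2)[OF s] fl] by simp
    show "(LINT x|L\<Omega>. \<bar>u (f n) x\<bar> powr (p - 2) * u (f n) x * u s x) \<le> c" for n
      using f(4)[of n] by simp
  qed (use f(1) s u_sq u_p in auto)
  then show False using c by (simp add: p_mass_def)
qed

text \<open>Shortly after \<open>s\<close> the weak formulation makes the time derivative of the pairing with the
  fixed function \<open>u s\<close> positive.\<close>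

lemma l2_mass_locally_increasing:
  assumes s: "0 \<le> s" "s < T" and K: "K \<Omega> p (u s) < 0"
  obtains \<delta> where "\<delta> > 0" "\<And>t. s \<le> t \<Longrightarrow> t < s + \<delta> \<Longrightarrow> t \<le> T \<Longrightarrow> l2_mass (u s) \<le> l2_mass (u t)"
proof -
  have sI: "s \<in> {0..T}" using s by simp
  define \<phi> where "\<phi> = u s"
  define \<psi> where "\<psi> = bdry (u s)"
  have \<phi>V: "\<phi> \<in> V" unfolding \<phi>_def by (rule u_V[OF sI])
  have sq: "sq_integrable L\<Omega> \<phi>" "sq_integrable \<sigma> \<psi>"
    unfolding \<phi>_def \<psi>_def by (rule u_sq[OF sI], rule bdry_sq[OF sI])
  then have L2: "\<phi> \<in> L2 L\<Omega>" "\<psi> \<in> L2 \<sigma>" by (auto simp: L2_eq_sq_integrable)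
  obtain h where h: "AE t in ST.IT. has_trace \<Omega> (u t) (h t)" "has_time_deriv T \<sigma> UNIV h zt"
    by (rule boundary_deriv) (rule that)
  \<comment> \<open>\<open>F\<close> uses the chosen traces and is continuous; \<open>f\<close> uses
    the trace family \<open>h\<close> from the definition of a solution, for which the weak time
    derivative \<open>zt\<close> is given. They agree at almost every time.\<close>
  define F where "F t = (LINT x|L\<Omega>. u t x * \<phi> x) + (LINT x|\<sigma>. bdry (u t) x * \<psi> x)" for t
  define f where "f t = (LINT x|L\<Omega>. u t x * \<phi> x) + (LINT x|\<sigma>. h t x * \<psi> x)" for t
  define g where "g t = (LINT x|L\<Omega>. ut t x * \<phi> x) + (LINT x|\<sigma>. zt t x * \<psi> x)" for t
  have F_cont: "continuous_on {0..T} F" unfolding F_def by (rule pairing_continuous[OF sq])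
  have L2P: "(\<lambda>(t, x). u t x) \<in> L2 (ST.IT \<Otimes>\<^sub>M L\<Omega>)" "(\<lambda>(t, x). ut t x) \<in> L2 (ST.IT \<Otimes>\<^sub>M L\<Omega>)"
    "(\<lambda>(t, x). h t x) \<in> L2 (ST.IT \<Otimes>\<^sub>M \<sigma>)" "(\<lambda>(t, x). zt t x) \<in> L2 (ST.IT \<Otimes>\<^sub>M \<sigma>)"
    using interior_deriv h(2) by (auto simp: has_time_deriv_def Let_def)
  note ints = ST.integrable_pairing[OF L2P(1) L2(1)] ST.integrable_pairing[OF L2P(2) L2(1)]
    SB.integrable_pairing[OF L2P(3) L2(2)] SB.integrable_pairing[OF L2P(4) L2(2)]
  have AE_in: "AE t in ST.IT. t \<in> {0..T}" by (rule AE_I2) auto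
  have \<psi>_ind: "y * \<psi> x = y * indicator \<Gamma>1 x * \<psi> x" for y x
    by (simp add: \<psi>_def bdry_def indicator_def)
  have f_eq: "AE t in ST.IT. f t = F t"
    using h(1) AE_in
  proof eventually_elim
    fix t assume t: "has_trace \<Omega> (u t) (h t)" "t \<in> {0..T}"
    have m: "h t \<in> borel_measurable \<sigma>" "bdry (u t) \<in> borel_measurable \<sigma>" "\<psi> \<in> borel_measurable \<sigma>"
      using t has_trace_iff bdry_sq[OF t(2)] sq(2) by (auto simp: sq_integrable_def)
    have "(LINT x|\<sigma>. h t x * \<psi> x) = (LINT x|\<sigma>. bdry (u t) x * \<psi> x)"
    proof (rule integral_cong_AE)
      show "AE x in \<sigma>. h t x * \<psi> x = bdry (u t) x * \<psi> x"
        using trace_unique[OF u_V[OF t(2)] t(1) V_trace[OF u_V[OF t(2)]]]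
        by eventually_elim (simp add: bdry_def \<psi>_ind[of "h t _"])
    qed (use m in auto)
    then show "f t = F t" by (simp add: f_def F_def)
  qed
  have weak: "(LINT t|ST.IT. \<eta>' t * f t) = - (LINT t|ST.IT. \<eta> t * g t)"
    if \<eta>: "\<eta> \<in> test_functions {0<..<T}" "\<And>t. (\<eta> has_real_derivative \<eta>' t) (at t)" for \<eta> \<eta>'
  proof -
    obtain b where b: "\<And>t. \<bar>\<eta> t\<bar> \<le> b" using test_function_bounded[OF \<eta>(1)] by blast
    obtain b' where b': "\<And>t. \<bar>\<eta>' t\<bar> \<le> b'" using test_function_derivative(2)[OF \<eta>] by blast
    have c: "continuous_on UNIV \<eta>" "continuous_on UNIV \<eta>'"
      using \<eta>(1) smooth_continuous test_function_derivative(1)[OF \<eta>] by (auto simp: test_functions_def)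
    have mult: "integrable ST.IT (\<lambda>t. e t * q t)"
      if "integrable ST.IT q" "continuous_on UNIV e" "\<And>t. \<bar>e t\<bar> \<le> B" for e q :: "real \<Rightarrow> real" and B
    proof (rule Bochner_Integration.integrable_bound)
      show "integrable ST.IT (\<lambda>t. B * q t)" using that by simp
      have "\<bar>e t * q t\<bar> \<le> \<bar>B * q t\<bar>" for t
        using that(3)[of t] by (simp add: abs_mult mult_right_mono)
      then show "AE t in ST.IT. norm (e t * q t) \<le> norm (B * q t)" by simp
    qed (use that ST.borel_measurable_IT in auto)
    show ?thesis
      using ST.weak_time_derivative[OF interior_deriv open_domain _ L2(1) \<eta>]
        SB.weak_time_derivative[OF h(2) open_UNIV _ L2(2) \<eta>]
        mult[OF ints(1) c(2) b'] mult[OF ints(2) c(1) b] mult[OF ints(3) c(2) b'] mult[OF ints(4) c(1) b]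
      by (simp add: f_def g_def distrib_left)
  qed
  have f_meas: "f \<in> borel_measurable ST.IT"
    using ints unfolding f_def[abs_def] by auto
  \<comment> \<open>A level inside the gap opened by K < 0: shortly after s the gradient pairing is
    below it and the source pairing above it.\<close>
  define c where "c = (dirichlet (u s) + p_mass (u s)) / 2"
  have c: "dirichlet (u s) < c" "c < p_mass (u s)" using K by (auto simp: c_def K_eq)
  have "((\<lambda>t. LINT x|L\<Omega>. wgrad \<Omega> (u t) x \<bullet> wgrad \<Omega> (u s) x) \<longlongrightarrow>
      (LINT x|L\<Omega>. wgrad \<Omega> (u s) x \<bullet> wgrad \<Omega> (u s) x)) (at s within {0..T})"
    by (intro L2_conv_inner ev_sq wgrad_sq[OF sI] wgrad_tendsto[OF sI])
  moreover have "(LINT x|L\<Omega>. wgrad \<Omega> (u s) x \<bullet> wgrad \<Omega> (u s) x) = dirichlet (u s)"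
    by (simp add: dirichlet_def grad_norm_power2 power2_norm_eq_inner)
  ultimately have "eventually (\<lambda>t. (LINT x|L\<Omega>. wgrad \<Omega> (u t) x \<bullet> wgrad \<Omega> (u s) x) < c) (at s within {0..T})"
    using c(1) order_tendstoD(2) by fastforce
  with source_lower_semicontinuous[OF sI c(2)]
  have "eventually (\<lambda>t. (LINT x|L\<Omega>. wgrad \<Omega> (u t) x \<bullet> wgrad \<Omega> (u s) x)
      < (LINT x|L\<Omega>. \<bar>u t x\<bar> powr (p - 2) * u t x * u s x)) (at s within {0..T})"
    by eventually_elim simp
  then obtain d where d: "d > 0" "\<And>t. t \<in> {0..T} \<Longrightarrow> t \<noteq> s \<Longrightarrow> dist t s < d \<Longrightarrow>
      (LINT x|L\<Omega>. wgrad \<Omega> (u t) x \<bullet> wgrad \<Omega> (u s) x) < (LINT x|L\<Omega>. \<bar>u t x\<bar> powr (p - 2) * u t x * u s x)"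
    by (auto simp: eventually_at)
  define b where "b = min T (s + d)"
  have b: "s < b" "b \<le> T" "b \<le> s + d" using s d by (auto simp: b_def)
  have wf: "AE t in ST.IT. g t + (LINT x|L\<Omega>. wgrad \<Omega> (u t) x \<bullet> wgrad \<Omega> (u s) x)
      = (LINT x|L\<Omega>. \<bar>u t x\<bar> powr (p - 2) * u t x * u s x)"
  proof -
    have "(LINT x|surface_on \<Gamma>1. zt t x * trace_of \<Omega> \<phi> x) = (LINT x|\<sigma>. zt t x * \<psi> x)" for t
      unfolding surface_on_Gamma1 by (simp add: \<psi>_def \<phi>_def bdry_def mult.assoc)
    then have "AE t in lebesgue_on {0..T}. g t + (LINT x|L\<Omega>. wgrad \<Omega> (u t) x \<bullet> wgrad \<Omega> (u s) x)
      = (LINT x|L\<Omega>. \<bar>u t x\<bar> powr (p - 2) * u t x * u s x)"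
      using weak_form[OF \<phi>V] by (simp add: g_def \<phi>_def algebra_simps)
    then show ?thesis by (subst (asm) AE_restrict_space_iff, simp, subst AE_restrict_space_iff, simp) (auto elim!: eventually_mono)
  qed
  have g_nonneg: "AE t in ST.IT. s < t \<longrightarrow> t < b \<longrightarrow> g t \<ge> 0"
    using wf AE_in
  proof eventually_elim
    fix t assume t: "g t + (LINT x|L\<Omega>. wgrad \<Omega> (u t) x \<bullet> wgrad \<Omega> (u s) x)
      = (LINT x|L\<Omega>. \<bar>u t x\<bar> powr (p - 2) * u t x * u s x)" "t \<in> {0..T}"
    show "s < t \<longrightarrow> t < b \<longrightarrow> g t \<ge> 0"
    proof (intro impI)
      assume "s < t" "t < b"
      then have "dist t s < d" using b by (simp add: dist_real_def)
      then show "g t \<ge> 0" using d(2)[OF t(2)] t(1) \<open>s < t\<close> by simp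
    qed
  qed
  have mono: "F r \<le> F t" if "s < r" "r < t" "t < b" for r t
    by (rule weak_derivative_nonneg_imp_mono[OF weak f_eq f_meas _ g_nonneg s(1) b(2) that])
      (use s b in \<open>auto intro: continuous_on_subset[OF F_cont]\<close>)
  \<comment> \<open>The weak monotonicity compares times strictly after s; continuity of F adds s
    itself, also when s = 0.\<close>
  have F_s: "F s \<le> F t" if t: "s < t" "t < b" for t
  proof -
    have "continuous_on {s..t} F" using s b t by (intro continuous_on_subset[OF F_cont]) auto
    then have "continuous_on (closure {s<..<t}) F" using t by simp
    moreover have "s \<in> closure {s<..<t}" using t by simp
    ultimately show ?thesis
      by (rule continuous_le_on_closure) (use mono t in auto)
  qed
  \<comment> \<open>Together with the next bound, 2 F(s) \<le> 2 F(t) \<le> y(t) + y(s), and one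
    y(s) cancels.\<close>
  have FsY: "F s = l2_mass (u s)" by (simp add: F_def l2_mass_def \<phi>_def \<psi>_def power2_eq_square)
  have FtY: "2 * F t \<le> l2_mass (u t) + l2_mass (u s)" if t: "t \<in> {0..T}" for t
  proof -
    have ineq: "2 * (LINT x|M. q x * r x) \<le> (LINT x|M. (q x)\<^sup>2) + (LINT x|M. (r x)\<^sup>2)"
      if "sq_integrable M q" "sq_integrable M r" for q r :: "'a \<Rightarrow> real" and M
    proof -
      have "(LINT x|M. 2 * (q x * r x)) \<le> (LINT x|M. (q x)\<^sup>2 + (r x)\<^sup>2)"
      proof (rule integral_mono)
        show "integrable M (\<lambda>x. 2 * (q x * r x))" using sq_integrable_inner[OF that] by simp
        show "integrable M (\<lambda>x. (q x)\<^sup>2 + (r x)\<^sup>2)" using that by (simp add: sq_integrable_def)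
        show "2 * (q x * r x) \<le> (q x)\<^sup>2 + (r x)\<^sup>2" for x using sum_squares_bound[of "q x" "r x"] by simp
      qed
      then show ?thesis using that by (simp add: sq_integrable_def)
    qed
    show ?thesis
      using ineq[OF u_sq[OF t] u_sq[OF sI]] ineq[OF bdry_sq[OF t] bdry_sq[OF sI]]
      by (simp add: F_def l2_mass_def \<phi>_def \<psi>_def)
  qed
  show ?thesis
  proof (rule that[of "b - s"])
    show "b - s > 0" using b by simp
    fix t assume t: "s \<le> t" "t < s + (b - s)" "t \<le> T"
    show "l2_mass (u s) \<le> l2_mass (u t)"
    proof (cases "t = s")
      case False
      then show ?thesis using F_s[of t] FtY[of t] FsY t s by simp
    qed simp
  qed
qed

text \<open>While \<open>l2_mass\<close> is at least its initial value, the decrease of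
  \<open>J\<close> keeps the solution in \<open>B2\<close>, where K < 0 makes \<open>l2_mass\<close>
  locally no smaller. If the bound failed at t, the closed set of earlier times at which it holds
  would have a last element, and the local increase would extend past it.\<close>

lemma B2_invariant:
  assumes u0: "u0 \<in> B2 \<Omega> \<Gamma>0 \<Gamma>1 p" and t: "0 \<le> t" "t < T"
  shows "u t \<in> B2 \<Omega> \<Gamma>0 \<Gamma>1 p"
proof -
  have 0: "J \<Omega> p (u 0) = J \<Omega> p u0" "l2_mass (u 0) = l2_mass u0"
    using J_K_Y_cong[OF u_V u0_V initial] T by auto
  have B2: "u s \<in> B2 \<Omega> \<Gamma>0 \<Gamma>1 p" if s: "s \<in> {0..T}" and le: "l2_mass (u 0) \<le> l2_mass (u s)" for s
  proof -
    have "J \<Omega> p (u s) \<le> J \<Omega> p (u 0)" using J_antimono[of 0 s] s by simp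
    also have "\<dots> < B2_const * l2_mass u0" using u0 by (simp add: 0 B2_iff)
    also have "\<dots> \<le> B2_const * l2_mass (u s)" using le B2_const_nonneg[OF u0] by (intro mult_left_mono) (simp_all add: 0)
    finally show ?thesis using u_V[OF s] by (simp add: B2_iff)
  qed
  have "l2_mass (u 0) \<le> l2_mass (u t)"
  proof (rule ccontr)
    assume neg: "\<not> l2_mass (u 0) \<le> l2_mass (u t)"
    define Z where "Z = {s \<in> {0..t}. l2_mass (u 0) \<le> l2_mass (u s)}"
    have "continuous_on {0..t} (\<lambda>s. l2_mass (u s))" using t by (intro continuous_on_subset[OF l2_mass_continuous]) auto
    then have "closed Z" unfolding Z_def by (intro continuous_on_closed_Collect_le) auto
    then have "compact Z" using compact_Int_closed[of "{0..t}" Z] by (simp add: Z_def Int_absorb1 subset_eq)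
    moreover have "0 \<in> Z" using t by (simp add: Z_def)
    ultimately obtain s where s: "s \<in> Z" "\<And>r. r \<in> Z \<Longrightarrow> r \<le> s"
      using compact_attains_sup[of Z] by blast
    have s0: "0 \<le> s" "s \<le> t" "l2_mass (u 0) \<le> l2_mass (u s)" using s(1) by (simp_all add: Z_def)
    then have "s \<noteq> t" using neg by auto
    then have s': "0 \<le> s" "s < t" using s0 by auto
    have "K \<Omega> p (u s) < 0" by (rule B2_K_neg, rule B2) (use s0 t in auto)
    with s' t obtain \<delta> where \<delta>: "\<delta> > 0" "\<And>r. s \<le> r \<Longrightarrow> r < s + \<delta> \<Longrightarrow> r \<le> T \<Longrightarrow> l2_mass (u s) \<le> l2_mass (u r)"
      using l2_mass_locally_increasing[of s] by auto
    define r where "r = min t (s + \<delta> / 2)"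
    have r: "s < r" "r \<le> t" "r < s + \<delta>" using s' \<delta>(1) by (auto simp: r_def min_def)
    have "l2_mass (u s) \<le> l2_mass (u r)" using \<delta>(2)[of r] r t by simp
    then have "r \<in> Z" using r s0 by (simp add: Z_def)
    then show False using s(2)[of r] r by simp
  qed
  then show ?thesis using B2[of t] t by simp
qed

lemma B1_invariant:
  assumes u0: "u0 \<in> B1 \<Omega> \<Gamma>0 p" and t: "0 \<le> t" "t \<le> T"
  shows "u t \<in> B1 \<Omega> \<Gamma>0 p"
proof -
  have 0: "J \<Omega> p (u 0) = J \<Omega> p u0" "K \<Omega> p (u 0) = K \<Omega> p u0"
    using J_K_Y_cong[OF u_V u0_V initial] T by auto
  have Jd: "J \<Omega> p (u s) < well_depth \<Omega> \<Gamma>0 p" if "s \<in> {0..T}" for s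
    using J_antimono[of 0 s] that u0 by (simp add: B1_def 0)
  have "K \<Omega> p (u t) < 0"
  proof (rule ccontr)
    assume pos: "\<not> K \<Omega> p (u t) < 0"
    define Z where "Z = {s \<in> {0..t}. 0 \<le> K \<Omega> p (u s)}"
    have Kc: "continuous_on {0..r} (\<lambda>s. K \<Omega> p (u s))" if "r \<le> t" for r
      using that t by (intro continuous_on_subset[OF K_continuous]) auto
    have "closed Z" unfolding Z_def by (intro continuous_on_closed_Collect_le Kc) auto
    then have "compact Z" using compact_Int_closed[of "{0..t}" Z] by (simp add: Z_def Int_absorb1 subset_eq)
    moreover have "t \<in> Z" using t pos by (simp add: Z_def)
    ultimately obtain s where s: "s \<in> Z" "\<And>r. r \<in> Z \<Longrightarrow> s \<le> r"
      using compact_attains_inf[of Z] by blast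
    have K0: "K \<Omega> p (u 0) < 0" using u0 by (simp add: 0 B1_def)
    have s0: "0 \<le> s" "s \<le> t" "0 \<le> K \<Omega> p (u s)" using s(1) by (simp_all add: Z_def)
    then have "s \<noteq> 0" using K0 by auto
    then have s': "0 < s" "s \<le> t" using s0 by auto
    have sT: "s \<in> {0..T}" using s' t by simp
    \<comment> \<open>A zero of K supplied by the intermediate value theorem on [0, s] belongs to
      \<open>Z\<close>, whose least element is s; so the zero is s.\<close>
    have Ks: "K \<Omega> p (u s) = 0"
    proof -
      obtain r where r: "0 \<le> r" "r \<le> s" "K \<Omega> p (u r) = 0"
        using IVT'[of "\<lambda>s. K \<Omega> p (u s)" 0 0 s] K0 s0 Kc[of s] by auto
      then have "r \<in> Z" using s' by (simp add: Z_def)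
      then show ?thesis using s(2)[of r] r by auto
    qed
    show False
    proof (cases "nonzero \<Omega> (u s)")
      case True
      then have "u s \<in> nehari \<Omega> \<Gamma>0 p" using Ks u_V[OF sT] by (simp add: nehari_def)
      then show False using well_depth_le Jd[OF sT] by fastforce
    next
      case False
      note z = zero_AE_imp[OF u_V[OF sT] False]
      \<comment> \<open>The bound of \<open>well_depth_le_gradient\<close> solved for the Dirichlet
        term; it holds on [0, s) and passes to s by continuity.\<close>
      define \<kappa> where "\<kappa> = 2 * p / (p - 2) * well_depth \<Omega> \<Gamma>0 p"
      have "well_depth \<Omega> \<Gamma>0 p > 0" using Jd[OF sT] z by (simp add: J_eq)
      then have \<kappa>: "\<kappa> > 0" using p by (simp add: \<kappa>_def)
      have "dirichlet (u r) \<ge> \<kappa>" if "r \<in> {0..<s}" for r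
      proof -
        have "r \<notin> Z" using s(2)[of r] that by auto
        then have "K \<Omega> p (u r) < 0" using that s' by (simp add: Z_def)
        then have "well_depth \<Omega> \<Gamma>0 p \<le> (p - 2) / (2 * p) * dirichlet (u r)"
          using that s' t by (intro well_depth_le_gradient u_V) auto
        then show ?thesis using p by (simp add: \<kappa>_def field_simps)
      qed
      moreover have "continuous_on (closure {0..<s}) (\<lambda>r. dirichlet (u r))"
        using s' sT by (intro continuous_on_subset[OF dirichlet_continuous]) auto
      moreover have "s \<in> closure {0..<s}" using s' by simp
      ultimately have "dirichlet (u s) \<ge> \<kappa>" using continuous_ge_on_closure by blast
      then show False using \<kappa> z(1) by simp
    qed
  qed
  then show ?thesis using Jd[of t] u_V[of t] t by (simp add: B1_def)
qed

end

section \<open>Passage to maximal solutions\<close>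

theorem mainTheorem4:
  fixes \<Omega> \<Gamma>0 \<Gamma>1 :: "'a::euclidean_space set" and p :: real
  assumes "open \<Omega>" and "bounded \<Omega>" and "C1_boundary \<Omega>"
    and "\<Gamma>0 \<in> sets borel" and "\<Gamma>1 \<in> sets borel"
    and "frontier \<Omega> = \<Gamma>0 \<union> \<Gamma>1" and "\<Gamma>0 \<inter> \<Gamma>1 = {}" and "closure \<Gamma>0 \<inter> closure \<Gamma>1 = {}"
    and "emeasure (surface_on (frontier \<Omega>)) \<Gamma>0 > 0"
    and "poincare_inequality \<Omega> \<Gamma>0 \<Gamma>1"
    and "2 < p" and "ereal p \<le> 1 + two_star DIM('a) / 2"
    and "local_theory \<Omega> \<Gamma>0 \<Gamma>1 p"
  shows "(\<forall>B \<in> {B1 \<Omega> \<Gamma>0 p, B2 \<Omega> \<Gamma>0 \<Gamma>1 p}. \<forall>u0\<in>B. \<forall>Tmax u.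
            maximal_weak_solution \<Omega> \<Gamma>0 \<Gamma>1 p Tmax u0 u \<longrightarrow>
            (\<forall>t. 0 < t \<and> ereal t < Tmax \<longrightarrow> u t \<in> B))
       \<and> (\<forall>u0 \<in> B1 \<Omega> \<Gamma>0 p \<union> B2 \<Omega> \<Gamma>0 \<Gamma>1 p. \<forall>Tmax u.
            maximal_weak_solution \<Omega> \<Gamma>0 \<Gamma>1 p Tmax u0 u \<longrightarrow>
            (\<forall>t. 0 \<le> t \<and> ereal t < Tmax \<longrightarrow> K \<Omega> p (u t) < 0))"
proof -
  interpret well_problem \<Omega> \<Gamma>0 \<Gamma>1 p
    using assms(1-3,5,6,9-11)
    by (intro well_problem.intro bounded_domain.intro well_problem_axioms.intro essentially_borel_surface) auto
  have inv: "(u0 \<in> B1 \<Omega> \<Gamma>0 p \<longrightarrow> u t \<in> B1 \<Omega> \<Gamma>0 p) \<and> (u0 \<in> B2 \<Omega> \<Gamma>0 \<Gamma>1 p \<longrightarrow> u t \<in> B2 \<Omega> \<Gamma>0 \<Gamma>1 p)"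
    if u0: "u0 \<in> V" and mx: "maximal_weak_solution \<Omega> \<Gamma>0 \<Gamma>1 p Tmax u0 u" and t: "0 \<le> t" "ereal t < Tmax"
    for u0 u Tmax t
  proof -
    \<comment> \<open>A time strictly between t and Tmax reduces the claim at t to the compact
      interval [0, T], with t < T as \<open>B2_invariant\<close> demands.\<close>
    obtain T where tT: "t < T" "ereal T < Tmax" using ereal_dense2[OF t(2)] by auto
    define I where "I = {t. 0 \<le> t \<and> ereal t < Tmax}"
    have sub: "{0..T} \<subseteq> I" using tT by (auto simp: I_def intro: le_less_trans[of "ereal _" "ereal T"])
    from assms(13) u0 mx have "let I = {t. 0 \<le> t \<and> ereal t < Tmax} in
        (\<forall>t\<in>I. u t \<in> V \<and> integrable L\<Omega> (\<lambda>x. \<bar>u t x\<bar> powr p) \<and>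
          ((\<lambda>s. H1_norm \<Omega> (\<lambda>x. u s x - u t x)) \<longlongrightarrow> 0) (at t within I)) \<and>
        (\<exists>ut zt. (\<forall>T. 0 < T \<and> ereal T < Tmax \<longrightarrow> weak_solution_with \<Omega> \<Gamma>0 \<Gamma>1 p T u0 u ut zt) \<and>
          (\<forall>t\<in>I. J \<Omega> p (u t) - J \<Omega> p u0 = - (LINT \<tau>|lebesgue_on {0..t}.
            (Lnorm L\<Omega> 2 (ut \<tau>))\<^sup>2 + (Lnorm (surface_on \<Gamma>1) 2 (zt \<tau>))\<^sup>2)))"
      unfolding local_theory_def Let_def by blast
    then have reg: "\<forall>t\<in>I. u t \<in> V \<and> integrable L\<Omega> (\<lambda>x. \<bar>u t x\<bar> powr p) \<and>
          ((\<lambda>s. H1_norm \<Omega> (\<lambda>x. u s x - u t x)) \<longlongrightarrow> 0) (at t within I)"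
      and "\<exists>ut zt. (\<forall>T. 0 < T \<and> ereal T < Tmax \<longrightarrow> weak_solution_with \<Omega> \<Gamma>0 \<Gamma>1 p T u0 u ut zt) \<and>
          (\<forall>t\<in>I. J \<Omega> p (u t) - J \<Omega> p u0 = - (LINT \<tau>|lebesgue_on {0..t}.
            (Lnorm L\<Omega> 2 (ut \<tau>))\<^sup>2 + (Lnorm (surface_on \<Gamma>1) 2 (zt \<tau>))\<^sup>2))"
      unfolding Let_def I_def[symmetric] by simp_all
    then obtain ut zt where
      sol: "\<forall>T. 0 < T \<and> ereal T < Tmax \<longrightarrow> weak_solution_with \<Omega> \<Gamma>0 \<Gamma>1 p T u0 u ut zt" and
      J: "\<forall>t\<in>I. J \<Omega> p (u t) - J \<Omega> p u0 = - (LINT \<tau>|lebesgue_on {0..t}.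
            (Lnorm L\<Omega> 2 (ut \<tau>))\<^sup>2 + (Lnorm (surface_on \<Gamma>1) 2 (zt \<tau>))\<^sup>2)"
      by blast
    interpret well_flow \<Omega> \<Gamma>0 \<Gamma>1 p T u0 u ut zt
    proof
      show "0 < T" "u0 \<in> V" "weak_solution_with \<Omega> \<Gamma>0 \<Gamma>1 p T u0 u ut zt" using tT t u0 sol by auto
      fix t assume "t \<in> {0..T}"
      then have tI: "t \<in> I" using sub by blast
      from reg tI show "u t \<in> V" "integrable L\<Omega> (\<lambda>x. \<bar>u t x\<bar> powr p)" by blast+
      from reg tI have "((\<lambda>s. H1_norm \<Omega> (\<lambda>x. u s x - u t x)) \<longlongrightarrow> 0) (at t within I)" by blast
      then show "((\<lambda>s. H1_norm \<Omega> (\<lambda>x. u s x - u t x)) \<longlongrightarrow> 0) (at t within {0..T})"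
        by (rule tendsto_within_subset[OF _ sub])
      from J tI show "J \<Omega> p (u t) - J \<Omega> p u0 = - (LINT \<tau>|lebesgue_on {0..t}.
            (Lnorm L\<Omega> 2 (ut \<tau>))\<^sup>2 + (Lnorm (surface_on \<Gamma>1) 2 (zt \<tau>))\<^sup>2)" by blast
    qed
    show ?thesis using B1_invariant[of t] B2_invariant[of t] tT t by simp
  qed
  have V: "w \<in> V" if "w \<in> B1 \<Omega> \<Gamma>0 p \<or> w \<in> B2 \<Omega> \<Gamma>0 \<Gamma>1 p" for w
    using that by (auto simp: B1_def B2_def)
  have K: "K \<Omega> p w < 0" if "w \<in> B1 \<Omega> \<Gamma>0 p \<or> w \<in> B2 \<Omega> \<Gamma>0 \<Gamma>1 p" for w
    using that B2_K_neg by (auto simp: B1_def)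
  show ?thesis
  proof (intro conjI ballI allI impI)
    fix B u0 Tmax u t
    assume "B \<in> {B1 \<Omega> \<Gamma>0 p, B2 \<Omega> \<Gamma>0 \<Gamma>1 p}" "u0 \<in> B" "maximal_weak_solution \<Omega> \<Gamma>0 \<Gamma>1 p Tmax u0 u"
      "0 < t \<and> ereal t < Tmax"
    then show "u t \<in> B" using inv[of u0 Tmax u t] V[of u0] by auto
  next
    fix u0 Tmax u t
    assume "u0 \<in> B1 \<Omega> \<Gamma>0 p \<union> B2 \<Omega> \<Gamma>0 \<Gamma>1 p" "maximal_weak_solution \<Omega> \<Gamma>0 \<Gamma>1 p Tmax u0 u"
      "0 \<le> t \<and> ereal t < Tmax"
    then show "K \<Omega> p (u t) < 0" using inv[of u0 Tmax u t] V[of u0] K[of "u t"] by auto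
  qed
qed

end
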